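(* If Boolean-OMv can be solved in time $O(n^{3-\varepsilon})$ for some $\varepsilon>0$, then $\exists$Equality-OMv can be solved in time $O(n^{3-\varepsilon/2})$.
   Context: Both problems are online: an $n\times n$ matrix $M$ is given for preprocessing, then $n$ query column vectors $v_1,\dots,v_n$ arrive one at a time and the answer to query $j$ must be output before $v_{j+1}$ is received; running time counts preprocessing and all queries. Boolean-OMv: $M\in\{0,1\}^{n\times n}$, $v_j\in\{0,1\}^n$, output $u\in\{0,1\}^n$ with $u[i]=1$ iff $\exists k\in[n]$: $M[i,k]=v_j[k]=1$. $\exists$Equality-OMv: $M\in\mathbb{Z}^{n\times n}$, $v_j\in\mathbb{Z}^n$, output $u\in\{0,1\}^n$ with $u[i]=1$ iff $\exists k\in[n]$: $M[i,k]=v_j[k]$. *)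

theory Defs
  imports Complex_Main "HOL-Library.Landau_Symbols" "Jordan_Normal_Form.Matrix"
begin

section \<open>A word RAM with structured control flow\<close>

text \<open>
  A program uses finitely many registers and a zero-initialised memory whose cells are addressed by
  register contents. Every elementary operation and every branch test costs one step. The parameter
  \<open>b\<close> of the semantics is the word length (up to the sign bit): an operation whose result is not a
  word has no execution, so an execution for \<open>b\<close> is an overflow-free one, and it is also an execution
  for every larger word length.
\<close>

definition words :: "nat \<Rightarrow> int set" where
  "words b = {- (2 ^ b)..<2 ^ b}"

datatype bop = Add | Sub | Mul | Div | Mod | BitAnd | BitOr | BitXor | Shl | Shr | Less | Eq

fun bop_val :: "bop \<Rightarrow> int \<Rightarrow> int \<Rightarrow> int" where
  "bop_val Add x y = x + y"
| "bop_val Sub x y = x - y"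
| "bop_val Mul x y = x * y"
| "bop_val Div x y = x div y"
| "bop_val Mod x y = x mod y"
| "bop_val BitAnd x y = Bit_Operations.and x y"
| "bop_val BitOr x y = Bit_Operations.or x y"
| "bop_val BitXor x y = Bit_Operations.xor x y"
| "bop_val Shl x y = push_bit (nat y) x"
| "bop_val Shr x y = drop_bit (nat y) x"
| "bop_val Less x y = of_bool (x < y)"
| "bop_val Eq x y = of_bool (x = y)"

type_synonym reg = nat

datatype com =
    Skip
  | Const reg int
  | Op bop reg reg reg
  | Load reg reg
  | Store reg reg
  | Seq com com
  | If reg com com
  | While reg com

type_synonym state = "(reg \<Rightarrow> int) \<times> (nat \<Rightarrow> int)"

text \<open>\<open>exec b p s t s'\<close>: from state \<open>s\<close>, program \<open>p\<close> halts in state \<open>s'\<close> after exactly \<open>t\<close> steps.\<close>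

inductive exec :: "nat \<Rightarrow> com \<Rightarrow> state \<Rightarrow> nat \<Rightarrow> state \<Rightarrow> bool" for b where
  Skip: "exec b Skip s 1 s"
| Const: "k \<in> words b \<Longrightarrow> exec b (Const r k) (R, m) 1 (R(r := k), m)"
| Op: "bop_val f (R r1) (R r2) \<in> words b \<Longrightarrow>
    exec b (Op f r r1 r2) (R, m) 1 (R(r := bop_val f (R r1) (R r2)), m)"
| Load: "0 \<le> R a \<Longrightarrow> exec b (Load r a) (R, m) 1 (R(r := m (nat (R a))), m)"
| Store: "0 \<le> R a \<Longrightarrow> exec b (Store a r) (R, m) 1 (R, m(nat (R a) := R r))"
| Seq: "exec b p s t s' \<Longrightarrow> exec b q s' t' s'' \<Longrightarrow> exec b (Seq p q) s (t + t') s''"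
| IfTrue: "fst s r \<noteq> 0 \<Longrightarrow> exec b p s t s' \<Longrightarrow> exec b (If r p q) s (1 + t) s'"
| IfFalse: "fst s r = 0 \<Longrightarrow> exec b q s t s' \<Longrightarrow> exec b (If r p q) s (1 + t) s'"
| WhileFalse: "fst s r = 0 \<Longrightarrow> exec b (While r p) s 1 s"
| WhileTrue: "fst s r \<noteq> 0 \<Longrightarrow> exec b p s t s' \<Longrightarrow> exec b (While r p) s' t' s'' \<Longrightarrow>
    exec b (While r p) s (1 + t + t') s''"


section \<open>Online matrix-vector problems\<close>

text \<open>
  Memory layout: the matrix occupies cells \<open>0..<n\<^sup>2\<close> in row-major order, the current query vector
  cells \<open>n\<^sup>2..<n\<^sup>2 + n\<close>, and the answer is read off cells \<open>n\<^sup>2 + n..<n\<^sup>2 + 2 * n\<close>. The dimension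
  is initially in register 0.
\<close>

definition init_state :: "nat \<Rightarrow> int mat \<Rightarrow> state" where
  "init_state n M =
    ((\<lambda>_. 0)(0 := int n), \<lambda>a. if a < n * n then M $$ (a div n, a mod n) else 0)"

definition put_query :: "nat \<Rightarrow> int vec \<Rightarrow> state \<Rightarrow> state" where
  "put_query n v s =
    (fst s, \<lambda>a. if a \<in> {n * n..<n * n + n} then v $ (a - n * n) else snd s a)"

definition read_answer :: "nat \<Rightarrow> state \<Rightarrow> int vec" where
  "read_answer n s = vec n (\<lambda>i. snd s (n * n + n + i))"

text \<open>
  \<open>serves b query n ans s vs t\<close>: started in state \<open>s\<close>, the query program answers the queries \<open>vs\<close>
  correctly in \<open>t\<close> steps overall. A query vector is written into memory only after the preceding
  query has been answered; all other memory and the registers persist between queries.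
\<close>

inductive serves ::
  "nat \<Rightarrow> com \<Rightarrow> nat \<Rightarrow> (int vec \<Rightarrow> int vec) \<Rightarrow> state \<Rightarrow> int vec list \<Rightarrow> nat \<Rightarrow> bool"
  for b query n ans where
  Nil: "serves b query n ans s [] 0"
| Cons: "exec b query (put_query n v s) t s' \<Longrightarrow> read_answer n s' = ans v \<Longrightarrow>
    serves b query n ans s' vs t' \<Longrightarrow> serves b query n ans s (v # vs) (t + t')"

text \<open>
  An online problem is given by the set \<open>D\<close> of admissible entries and the answer function \<open>ans\<close>.
  If \<open>n\<close> and all entries fit into \<open>w\<close> bits (up to sign), the algorithm may use words of \<open>c * w\<close> bits,
  for a constant \<open>c\<close> of the algorithm; for entries in \<open>{0, 1}\<close> these are words of \<open>O(log n)\<close> bits.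
  The step bound \<open>T n\<close> covers preprocessing and all \<open>n\<close> queries and must not depend on \<open>w\<close>.
\<close>

definition solves_online ::
  "int set \<Rightarrow> (int mat \<Rightarrow> int vec \<Rightarrow> int vec) \<Rightarrow> com \<Rightarrow> com \<Rightarrow> nat \<Rightarrow> (nat \<Rightarrow> nat) \<Rightarrow> bool" where
  "solves_online D ans pre query c T \<longleftrightarrow>
    (\<forall>n w M vs.
      n \<ge> 1 \<and> int n \<in> words w \<and>
      M \<in> carrier_mat n n \<and> elements_mat M \<subseteq> D \<inter> words w \<and>
      length vs = n \<and> (\<forall>v \<in> set vs. v \<in> carrier_vec n \<and> vec_set v \<subseteq> D \<inter> words w) \<longrightarrow>
      (\<exists>t0 s t. exec (c * w) pre (init_state n M) t0 s \<and>
        serves (c * w) query n (ans M) s vs t \<and> t0 + t \<le> T n))"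

definition solvable_in_time_O ::
  "int set \<Rightarrow> (int mat \<Rightarrow> int vec \<Rightarrow> int vec) \<Rightarrow> (nat \<Rightarrow> real) \<Rightarrow> bool" where
  "solvable_in_time_O D ans f \<longleftrightarrow>
    (\<exists>pre query c T. solves_online D ans pre query c T \<and> (\<lambda>n. real (T n)) \<in> O(f))"

definition boolean_answer :: "int mat \<Rightarrow> int vec \<Rightarrow> int vec" where
  "boolean_answer M v =
    vec (dim_row M) (\<lambda>i. if \<exists>k < dim_col M. M $$ (i, k) = 1 \<and> v $ k = 1 then 1 else 0)"

definition equality_answer :: "int mat \<Rightarrow> int vec \<Rightarrow> int vec" where
  "equality_answer M v =
    vec (dim_row M) (\<lambda>i. if \<exists>k < dim_col M. M $$ (i, k) = v $ k then 1 else 0)"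

definition Boolean_OMv_in_time_O :: "(nat \<Rightarrow> real) \<Rightarrow> bool" where
  "Boolean_OMv_in_time_O f \<longleftrightarrow> solvable_in_time_O {0, 1} boolean_answer f"

definition Ex_Equality_OMv_in_time_O :: "(nat \<Rightarrow> real) \<Rightarrow> bool" where
  "Ex_Equality_OMv_in_time_O f \<longleftrightarrow> solvable_in_time_O UNIV equality_answer f"

end

theory Submission
  imports Defs
begin

text \<open>
  Sort every column and cut it into buckets of \<open>g\<close> consecutive ranks. Level \<open>j\<close> is the Boolean
  matrix marking the \<open>j\<close>-th bucket of each column. A query value selects the buckets that are
  constantly equal to it, which is a Boolean query on every level; at most two further buckets per
  column straddle the value, and these are scanned in \<open>O(g)\<close> steps. This costs \<open>n / g\<close> Boolean
  instances and \<open>O(n\<^sup>2 g)\<close> steps of scanning, so \<open>g = n\<close> to the power \<open>1 - \<epsilon>/2\<close> is the right choice.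

  No program can compute that \<open>g\<close>, since \<open>\<epsilon>\<close> may be an uncomputable real. Instead, the program
  counts the steps of the simulated Boolean instances and starts with \<open>g = 1\<close>. Once the count
  exceeds \<open>g n\<^sup>2\<close>, it answers the current query by brute force, doubles \<open>g\<close> and builds new
  instances in untouched memory. Abandoning \<open>g\<close> means that \<open>n / g\<close> instances took \<open>g n\<^sup>2\<close> steps, so
  \<open>g\<close> never grows beyond the right order. That sorting is affordable follows from \<open>\<epsilon> \<le> 1\<close>: an
  algorithm for Boolean-OMv has to rewrite all answer cells when the queries alternate between
  all-ones and zero.
\<close>

text \<open>If one Boolean instance costs X = n^(3-\<epsilon>), then n / g of them cost n X / g
  while the scans cost n^2 g; both are n^(3-\<epsilon>/2) at g = n^(1-\<epsilon>/2), and n X / g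
  \<ge> g n^2, the condition for abandoning g, fails beyond this order. Each phase may overshoot its
  limit by one X, and there are O(log n) phases; the resulting n^(3-\<epsilon>) log n is swallowed
  by the factor n^(\<epsilon>/2) between the two exponents. Two obstacles shape the rest. How much
  memory a Boolean instance touches is not known beforehand, so instances cannot receive consecutive
  blocks: they are interleaved, one residue class modulo S each, and a class never touched is the
  zeroed memory that a new instance has to find. Moreover, the hypothesis speaks of complete query
  sequences, each with its own run, whereas the reduction must answer a query before the next one
  exists; determinism of the machine glues these runs together.\<close>

inductive_cases SkipE: "exec b Skip s t s'"
inductive_cases ConstE: "exec b (Const r k) s t s'"
inductive_cases OpE: "exec b (Op f r r1 r2) s t s'"
inductive_cases LoadE: "exec b (Load r a) s t s'"
inductive_cases StoreE: "exec b (Store a r) s t s'"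
inductive_cases SeqE: "exec b (Seq p q) s t s'"
inductive_cases IfE: "exec b (If r p q) s t s'"

text \<open>\<open>solves_online\<close> supplies a run for each query sequence separately.
  Determinism makes the states after preprocessing, and after every common prefix of queries,
  coincide; \<open>good_init\<close> and \<open>good_step\<close> rest on this.\<close>

lemma exec_deterministic:
  assumes "exec b p s t s'" "exec b p s u s''"
  shows "t = u \<and> s' = s''"
  using assms
proof (induction arbitrary: u s'' rule: exec.induct)
  case (WhileTrue s r p t s' t' s2)
  from WhileTrue.prems obtain v v' s1 where
    *: "exec b p s v s1" "exec b (While r p) s1 v' s''" "u = 1 + v + v'"
    by cases (use WhileTrue.hyps(1) in auto)
  have "t = v" "s' = s1" using WhileTrue.IH(1)[OF *(1)] by auto
  moreover from this have "t' = v'" "s2 = s''" using WhileTrue.IH(2)[of v' s''] *(2) by auto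
  ultimately show ?case using *(3) by simp
next
  case (WhileFalse s r p)
  from WhileFalse.prems show ?case by cases (use WhileFalse.hyps in auto)
next
  case (Seq p s t s' q t' s2)
  from Seq.prems obtain v v' s1 where
    *: "exec b p s v s1" "exec b q s1 v' s''" "u = v + v'" by (elim SeqE) auto
  have "t = v" "s' = s1" using Seq.IH(1)[OF *(1)] by auto
  moreover from this have "t' = v'" "s2 = s''" using Seq.IH(2)[of v' s''] *(2) by auto
  ultimately show ?case using *(3) by simp
next
  case (IfTrue s r p t s' q)
  from IfTrue.prems IfTrue.hyps(1) obtain v where "exec b p s v s''" "u = 1 + v"
    by (elim IfE) auto
  with IfTrue.IH show ?case by simp
next
  case (IfFalse s r q t s' p)
  from IfFalse.prems IfFalse.hyps(1) obtain v where "exec b q s v s''" "u = 1 + v"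
    by (elim IfE) auto
  with IfFalse.IH show ?case by simp
qed (auto elim: SkipE ConstE OpE LoadE StoreE)

lemma words_mono:
  assumes "b \<le> b'"
  shows "words b \<subseteq> words b'"
proof -
  have "(2::int) ^ b \<le> 2 ^ b'" using assms by (simp add: power_increasing)
  then show ?thesis unfolding words_def by auto
qed

lemma exec_mono_word_length: "exec b p s t s' \<Longrightarrow> b \<le> b' \<Longrightarrow> exec b' p s t s'"
proof (induction rule: exec.induct)
  case (Const k r R m)
  then show ?case using words_mono exec.Const by blast
next
  case (Op f R r1 r2 r m)
  then show ?case using words_mono exec.Op by blast
qed (blast intro: exec.intros)+

lemma serves_mono_word_length:
  "serves b query n ans s vs t \<Longrightarrow> b \<le> b' \<Longrightarrow> serves b' query n ans s vs t"
  by (induction rule: serves.induct) (blast intro: serves.intros exec_mono_word_length)+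

text \<open>One step writes at most one cell. This turns a number of answer cells that have to
  change into a lower bound on running time.\<close>

lemma exec_changes_few_cells:
  "exec b p s t s' \<Longrightarrow> finite {a. snd s' a \<noteq> snd s a} \<and> card {a. snd s' a \<noteq> snd s a} \<le> t"
proof (induction rule: exec.induct)
  case (Store R a r m)
  have "{x. snd (R, m(nat (R a) := R r)) x \<noteq> snd (R, m) x} \<subseteq> {nat (R a)}" by auto
  then show ?case using card_mono[of "{nat (R a)}"] finite_subset by fastforce
next
  case (Seq p s t s' q t' s'')
  let ?D = "\<lambda>s s' :: state. {a. snd s' a \<noteq> snd s a}"
  have "?D s s'' \<subseteq> ?D s s' \<union> ?D s' s''" by auto
  with Seq show ?case
    by (meson add_mono card_Un_le card_mono finite_UnI finite_subset order_trans)
next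
  case (WhileTrue s r p t s' t' s'')
  let ?D = "\<lambda>s s' :: state. {a. snd s' a \<noteq> snd s a}"
  have "?D s s'' \<subseteq> ?D s s' \<union> ?D s' s''" by auto
  moreover have "card (?D s s' \<union> ?D s' s'') \<le> t + t'"
    using WhileTrue by (meson add_mono card_Un_le order_trans)
  moreover have "finite (?D s s' \<union> ?D s' s'')" using WhileTrue by blast
  ultimately have "finite (?D s s'') \<and> card (?D s s'') \<le> t + t'"
    by (meson card_mono finite_subset order_trans)
  then show ?case by simp
qed auto

section \<open>Expressions and a weakest-precondition calculus\<close>

datatype exp = EConst int | EVar reg | EOp bop exp exp | ELoad exp

abbreviation EAdd (infixl "+\<^sub>e" 65) where "e +\<^sub>e f \<equiv> EOp Add e f"
abbreviation ESub (infixl "-\<^sub>e" 65) where "e -\<^sub>e f \<equiv> EOp Sub e f"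
abbreviation EMul (infixl "*\<^sub>e" 70) where "e *\<^sub>e f \<equiv> EOp Mul e f"
abbreviation ELess (infix "<\<^sub>e" 50) where "e <\<^sub>e f \<equiv> EOp Less e f"
abbreviation EEq (infix "=\<^sub>e" 50) where "e =\<^sub>e f \<equiv> EOp Eq e f"

text \<open>Registers below \<open>nvars\<close> are program variables, the others hold intermediate results.\<close>

abbreviation nvars :: nat where "nvars \<equiv> 30"

type_synonym env = "reg \<Rightarrow> int"
type_synonym imem = "int \<Rightarrow> int"

fun val :: "exp \<Rightarrow> env \<Rightarrow> imem \<Rightarrow> int" where
  "val (EConst k) V m = k"
| "val (EVar x) V m = V x"
| "val (EOp f e1 e2) V m = bop_val f (val e1 V m) (val e2 V m)"
| "val (ELoad e) V m = m (val e V m)"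

fun safe :: "nat \<Rightarrow> exp \<Rightarrow> env \<Rightarrow> imem \<Rightarrow> bool" where
  "safe b (EConst k) V m \<longleftrightarrow> k \<in> words b"
| "safe b (EVar x) V m \<longleftrightarrow> x < nvars"
| "safe b (EOp f e1 e2) V m \<longleftrightarrow>
    safe b e1 V m \<and> safe b e2 V m \<and> bop_val f (val e1 V m) (val e2 V m) \<in> words b"
| "safe b (ELoad e) V m \<longleftrightarrow> safe b e V m \<and> 0 \<le> val e V m"

fun cost :: "exp \<Rightarrow> nat" where
  "cost (EConst k) = 1"
| "cost (EVar x) = 1"
| "cost (EOp f e1 e2) = cost e1 + cost e2 + 1"
| "cost (ELoad e) = cost e + 1"

text \<open>A variable is read where it lies, so its code is \<open>Skip\<close>; every other
  expression leaves its value in the target register \<open>d\<close>.\<close>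

fun operand :: "exp \<Rightarrow> reg \<Rightarrow> reg" where
  "operand (EVar x) d = x"
| "operand e d = d"

fun code :: "exp \<Rightarrow> reg \<Rightarrow> reg \<Rightarrow> com" where
  "code (EConst k) d u = Const d k"
| "code (EVar x) d u = Skip"
| "code (EOp f e1 e2) d u =
    Seq (code e1 u (Suc u)) (Seq (code e2 (Suc u) (Suc (Suc u)))
      (Op f d (operand e1 u) (operand e2 (Suc u))))"
| "code (ELoad e) d u = Seq (code e u (Suc u)) (Load d (operand e u))"

definition represents :: "(reg \<Rightarrow> int) \<Rightarrow> (nat \<Rightarrow> int) \<Rightarrow> env \<Rightarrow> imem \<Rightarrow> bool" where
  "represents R h V m \<longleftrightarrow> (\<forall>x < nvars. R x = V x) \<and> (\<forall>a. h a = m (int a))"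

lemma safe_EVar_bound: "safe b e V m \<Longrightarrow> operand e d \<noteq> d \<Longrightarrow> operand e d < nvars"
  by (cases e) auto

text \<open>The registers from \<open>u\<close> on act as an evaluation stack: the value of the
  first operand waits in \<open>u\<close> while the second is evaluated with the registers above.
  The frame clause about registers below \<open>u\<close> is what makes the induction
  compose.\<close>

lemma exec_code:
  assumes "safe b e V m" "represents R h V m" "nvars \<le> u"
  shows "\<exists>R'. exec b (code e d u) (R, h) (cost e) (R', h) \<and> R' (operand e d) = val e V m \<and>
    (\<forall>x < u. x \<noteq> d \<longrightarrow> R' x = R x)"
  using assms
proof (induction e arbitrary: d u R)
  case (EConst k)
  then have "exec b (code (EConst k) d u) (R, h) (cost (EConst k)) (R(d := k), h)"
    using exec.Const[of k b d R h] by simp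
  moreover have "(R(d := k)) (operand (EConst k) d) = val (EConst k) V m \<and>
      (\<forall>x < u. x \<noteq> d \<longrightarrow> (R(d := k)) x = R x)" by simp
  ultimately show ?case by blast
next
  case (EVar x)
  then have "R x = V x" by (simp add: represents_def)
  then show ?case using exec.Skip[of b "(R, h)"] by (intro exI[of _ R]) simp
next
  case (EOp f e1 e2)
  obtain R1 where R1: "exec b (code e1 u (Suc u)) (R, h) (cost e1) (R1, h)"
    "R1 (operand e1 u) = val e1 V m" "\<forall>x < Suc u. x \<noteq> u \<longrightarrow> R1 x = R x"
    using EOp.IH(1)[of R "Suc u" u] EOp.prems by auto
  have "represents R1 h V m" using R1(3) EOp.prems by (auto simp: represents_def)
  then obtain R2 where R2:
    "exec b (code e2 (Suc u) (Suc (Suc u))) (R1, h) (cost e2) (R2, h)"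
    "R2 (operand e2 (Suc u)) = val e2 V m" "\<forall>x < Suc (Suc u). x \<noteq> Suc u \<longrightarrow> R2 x = R1 x"
    using EOp.IH(2)[of R1 "Suc (Suc u)" "Suc u"] EOp.prems by auto
  \<comment> \<open>The first value lies in \<open>u\<close> or, for a variable, in a register below
    \<open>nvars\<close>; evaluating the second operand changes neither.\<close>
  have "operand e1 u \<le> u"
    using safe_EVar_bound[of b e1 V m u] EOp.prems by (cases "operand e1 u = u") auto
  then have o1: "R2 (operand e1 u) = val e1 V m" using R1(2) R2(3) by auto
  let ?v = "bop_val f (val e1 V m) (val e2 V m)"
  have "exec b (Op f d (operand e1 u) (operand e2 (Suc u))) (R2, h) 1 (R2(d := ?v), h)"
    using exec.Op[of f R2 "operand e1 u" "operand e2 (Suc u)" b d h] o1 R2(2) EOp.prems by simp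
  from exec.Seq[OF R1(1) exec.Seq[OF R2(1) this]]
  have "exec b (code (EOp f e1 e2) d u) (R, h) (cost (EOp f e1 e2)) (R2(d := ?v), h)"
    by (simp add: add.assoc)
  moreover have "(R2(d := ?v)) (operand (EOp f e1 e2) d) = val (EOp f e1 e2) V m \<and>
      (\<forall>x < u. x \<noteq> d \<longrightarrow> (R2(d := ?v)) x = R x)" using R1(3) R2(3) by simp
  ultimately show ?case by blast
next
  case (ELoad e)
  obtain R1 where R1: "exec b (code e u (Suc u)) (R, h) (cost e) (R1, h)"
    "R1 (operand e u) = val e V m" "\<forall>x < Suc u. x \<noteq> u \<longrightarrow> R1 x = R x"
    using ELoad.IH[of R "Suc u" u] ELoad.prems by auto
  have "h (nat (val e V m)) = m (val e V m)" using ELoad.prems by (simp add: represents_def)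
  then have "exec b (Load d (operand e u)) (R1, h) 1 (R1(d := m (val e V m)), h)"
    using exec.Load[of R1 "operand e u" b d h] R1(2) ELoad.prems by simp
  from exec.Seq[OF R1(1) this]
  have "exec b (code (ELoad e) d u) (R, h) (cost (ELoad e)) (R1(d := m (val e V m)), h)" by simp
  moreover have "(R1(d := m (val e V m))) (operand (ELoad e) d) = val (ELoad e) V m \<and>
      (\<forall>x < u. x \<noteq> d \<longrightarrow> (R1(d := m (val e V m))) x = R x)" using R1(3) by simp
  ultimately show ?case by blast
qed

text \<open>
  Weakest preconditions with a ghost clock \<open>t\<close>. Memory is indexed by integers, so that no address
  needs a conversion; cells with a negative index are junk.
\<close>

definition wp :: "nat \<Rightarrow> com \<Rightarrow> (int \<Rightarrow> env \<Rightarrow> imem \<Rightarrow> bool) \<Rightarrow> int \<Rightarrow> env \<Rightarrow> imem \<Rightarrow> bool" where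
  "wp b p Q t V m \<longleftrightarrow> (\<forall>R h. represents R h V m \<longrightarrow>
    (\<exists>u R' h' V' m'. exec b p (R, h) u (R', h') \<and> represents R' h' V' m' \<and> Q (t + int u) V' m'))"

definition assign :: "reg \<Rightarrow> exp \<Rightarrow> com" where
  "assign x e = code e x nvars"

definition store :: "exp \<Rightarrow> exp \<Rightarrow> com" where
  "store e1 e2 = Seq (code e1 nvars (Suc nvars)) (Seq (code e2 (Suc nvars) (Suc (Suc nvars)))
     (Store (operand e1 nvars) (operand e2 (Suc nvars))))"

definition cond :: "exp \<Rightarrow> com \<Rightarrow> com \<Rightarrow> com" where
  "cond e p q = Seq (code e nvars (Suc nvars)) (If (operand e nvars) p q)"

definition loop :: "exp \<Rightarrow> com \<Rightarrow> com" where
  "loop e p = Seq (code e nvars (Suc nvars))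
     (While (operand e nvars) (Seq p (code e nvars (Suc nvars))))"

lemma wp_mono:
  assumes "wp b p P t V m" "\<And>t' V' m'. P t' V' m' \<Longrightarrow> Q t' V' m'"
  shows "wp b p Q t V m"
  using assms unfolding wp_def by meson

lemma wp_Skip: "Q (t + 1) V m \<Longrightarrow> wp b Skip Q t V m"
  unfolding wp_def by (fastforce intro: exec.Skip)

lemma wp_Seq:
  assumes "wp b p (\<lambda>t V m. wp b q Q t V m) t V m"
  shows "wp b (Seq p q) Q t V m"
  unfolding wp_def
proof (intro allI impI)
  fix R h assume "represents R h V m"
  then obtain u R' h' V' m' where 1: "exec b p (R, h) u (R', h')" "represents R' h' V' m'"
    "wp b q Q (t + int u) V' m'" using assms unfolding wp_def by meson
  then obtain u' R'' h'' V'' m'' where 2: "exec b q (R', h') u' (R'', h'')"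
    "represents R'' h'' V'' m''" "Q (t + int u + int u') V'' m''" unfolding wp_def by meson
  show "\<exists>u R' h' V' m'. exec b (Seq p q) (R, h) u (R', h') \<and> represents R' h' V' m' \<and>
      Q (t + int u) V' m'"
    using exec.Seq[OF 1(1) 2(1)] 2(2,3) by (metis add.assoc of_nat_add)
qed

text \<open>For a bare variable no code is emitted and \<open>x\<close> would keep its old value,
  hence the exclusion. Copies are therefore written as a sum with the constant 0.\<close>

lemma wp_assign:
  assumes "safe b e V m" "\<nexists>y. e = EVar y" "x < nvars"
    and "Q (t + int (cost e)) (V(x := val e V m)) m"
  shows "wp b (assign x e) Q t V m"
  unfolding wp_def
proof (intro allI impI)
  fix R h assume rep: "represents R h V m"
  obtain R' where R': "exec b (code e x nvars) (R, h) (cost e) (R', h)"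
    "R' (operand e x) = val e V m" "\<forall>y < nvars. y \<noteq> x \<longrightarrow> R' y = R y"
    using exec_code[OF assms(1) rep order_refl] by blast
  moreover have "operand e x = x" using assms(2) by (cases e) auto
  ultimately show "\<exists>u R' h' V' m'. exec b (assign x e) (R, h) u (R', h') \<and>
      represents R' h' V' m' \<and> Q (t + int u) V' m'"
    using rep assms(4) unfolding assign_def represents_def
    by (intro exI[of _ "cost e"] exI[of _ R'] exI[of _ h] exI[of _ "V(x := val e V m)"] exI[of _ m])
      auto
qed

lemma wp_store:
  assumes "safe b e1 V m" "safe b e2 V m" "0 \<le> val e1 V m"
    and "Q (t + int (cost e1 + cost e2 + 1)) V (m(val e1 V m := val e2 V m))"
  shows "wp b (store e1 e2) Q t V m"
  unfolding wp_def
proof (intro allI impI)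
  fix R h assume rep: "represents R h V m"
  obtain R1 where R1: "exec b (code e1 nvars (Suc nvars)) (R, h) (cost e1) (R1, h)"
    "R1 (operand e1 nvars) = val e1 V m" "\<forall>y < Suc nvars. y \<noteq> nvars \<longrightarrow> R1 y = R y"
    using exec_code[OF assms(1) rep, of "Suc nvars" nvars] by auto
  have rep1: "represents R1 h V m" using rep R1(3) by (auto simp: represents_def)
  obtain R2 where R2:
    "exec b (code e2 (Suc nvars) (Suc (Suc nvars))) (R1, h) (cost e2) (R2, h)"
    "R2 (operand e2 (Suc nvars)) = val e2 V m"
    "\<forall>y < Suc (Suc nvars). y \<noteq> Suc nvars \<longrightarrow> R2 y = R1 y"
    using exec_code[OF assms(2) rep1, of "Suc (Suc nvars)" "Suc nvars"] by auto
  have "operand e1 nvars \<le> nvars"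
    using safe_EVar_bound[OF assms(1), of nvars] by (cases "operand e1 nvars = nvars") auto
  then have o1: "R2 (operand e1 nvars) = val e1 V m" using R1(2) R2(3) by auto
  let ?h = "h(nat (val e1 V m) := val e2 V m)"
  have "exec b (Store (operand e1 nvars) (operand e2 (Suc nvars))) (R2, h) 1 (R2, ?h)"
    using exec.Store[of R2 "operand e1 nvars" b "operand e2 (Suc nvars)" h] o1 R2(2) assms(3) by simp
  from exec.Seq[OF R1(1) exec.Seq[OF R2(1) this]]
  have ex: "exec b (store e1 e2) (R, h) (cost e1 + cost e2 + 1) (R2, ?h)"
    by (simp add: add.assoc store_def)
  have "represents R2 ?h V (m(val e1 V m := val e2 V m))"
    using rep1 R2(3) assms(3) by (auto simp: represents_def)
  with ex assms(4) show "\<exists>u R' h' V' m'. exec b (store e1 e2) (R, h) u (R', h') \<and>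
      represents R' h' V' m' \<and> Q (t + int u) V' m'" by blast
qed

lemma wp_cond:
  assumes "safe b e V m"
    and "val e V m \<noteq> 0 \<Longrightarrow> wp b p Q (t + int (cost e) + 1) V m"
    and "val e V m = 0 \<Longrightarrow> wp b q Q (t + int (cost e) + 1) V m"
  shows "wp b (cond e p q) Q t V m"
  unfolding wp_def
proof (intro allI impI)
  fix R h assume rep: "represents R h V m"
  obtain R1 where R1: "exec b (code e nvars (Suc nvars)) (R, h) (cost e) (R1, h)"
    "R1 (operand e nvars) = val e V m" "\<forall>y < Suc nvars. y \<noteq> nvars \<longrightarrow> R1 y = R y"
    using exec_code[OF assms(1) rep, of "Suc nvars" nvars] by auto
  have rep1: "represents R1 h V m" using rep R1(3) by (auto simp: represents_def)
  have "\<exists>u R' h' V' m'. exec b (If (operand e nvars) p q) (R1, h) (1 + u) (R', h') \<and>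
      represents R' h' V' m' \<and> Q (t + int (cost e) + 1 + int u) V' m'"
  proof (cases "val e V m = 0")
    case True
    then show ?thesis using assms(3) rep1 R1(2) unfolding wp_def
      by (metis exec.IfFalse fst_conv)
  next
    case False
    then show ?thesis using assms(2) rep1 R1(2) unfolding wp_def
      by (metis exec.IfTrue fst_conv)
  qed
  then obtain u R' h' V' m' where 2: "exec b (If (operand e nvars) p q) (R1, h) (1 + u) (R', h')"
    "represents R' h' V' m'" "Q (t + int (cost e) + 1 + int u) V' m'" by blast
  have "exec b (cond e p q) (R, h) (cost e + (1 + u)) (R', h')"
    unfolding cond_def by (rule exec.Seq[OF R1(1) 2(1)])
  moreover have "Q (t + int (cost e + (1 + u))) V' m'" using 2(3) by (simp add: algebra_simps)
  ultimately show "\<exists>u R' h' V' m'. exec b (cond e p q) (R, h) u (R', h') \<and>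
      represents R' h' V' m' \<and> Q (t + int u) V' m'" using 2(2) by blast
qed

text \<open>Total correctness: the measure \<open>f\<close> drives the induction. The clock is an
  argument of the invariant, so a time bound is just one more conjunct of \<open>I\<close>.\<close>

lemma wp_loop:
  fixes f :: "env \<Rightarrow> imem \<Rightarrow> nat"
  assumes "I t V m"
    and "\<And>t V m. I t V m \<Longrightarrow> safe b e V m"
    and body: "\<And>t V m. I t V m \<Longrightarrow> val e V m \<noteq> 0 \<Longrightarrow>
      wp b p (\<lambda>t' V' m'. I t' V' m' \<and> f V' m' < f V m) (t + int (cost e) + 1) V m"
    and exit: "\<And>t V m. I t V m \<Longrightarrow> val e V m = 0 \<Longrightarrow> Q (t + int (cost e) + 1) V m"
  shows "wp b (loop e p) Q t V m"
  unfolding wp_def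
proof (intro allI impI)
  fix R h assume rep: "represents R h V m"
  let ?c = "code e nvars (Suc nvars)"
  let ?W = "While (operand e nvars) (Seq p ?c)"
  have evl: "\<exists>R'. exec b ?c (R, h) (cost e) (R', h) \<and>
      R' (operand e nvars) = val e V m \<and> represents R' h V m"
    if "I t V m" "represents R h V m" for t V m R h
    using exec_code[OF assms(2)[OF that(1)] that(2), of "Suc nvars" nvars] that(2)
    unfolding represents_def by fastforce
  have W: "\<exists>u R' h' V' m'. exec b ?W (R, h) u (R', h') \<and> represents R' h' V' m' \<and>
      Q (t + int (cost e) + int u) V' m'"
    if "I t V m" "represents R h V m" "R (operand e nvars) = val e V m" for t V m R h
    using that
  proof (induction "f V m" arbitrary: t V m R h rule: less_induct)
    case less
    show ?case
    proof (cases "val e V m = 0")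
      case True
      then have "exec b ?W (R, h) 1 (R, h)" using less.prems by (intro exec.WhileFalse) simp
      moreover have "Q (t + int (cost e) + int 1) V m" using exit less.prems(1) True by simp
      ultimately show ?thesis using less.prems(2) by blast
    next
      case False
      obtain u R1 h1 V1 m1 where 1: "exec b p (R, h) u (R1, h1)" "represents R1 h1 V1 m1"
        "I (t + int (cost e) + 1 + int u) V1 m1" "f V1 m1 < f V m"
        using body[OF less.prems(1) False] less.prems(2) unfolding wp_def by blast
      obtain R2 where 2: "exec b ?c (R1, h1) (cost e) (R2, h1)"
        "R2 (operand e nvars) = val e V1 m1" "represents R2 h1 V1 m1"
        using evl[OF 1(3,2)] by blast
      obtain u' R' h' V' m' where 3: "exec b ?W (R2, h1) u' (R', h')" "represents R' h' V' m'"
        "Q (t + int (cost e) + 1 + int u + int (cost e) + int u') V' m'"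
        using less.hyps[OF 1(4,3) 2(3,2)] by blast
      have "exec b ?W (R, h) (1 + (u + cost e) + u') (R', h')"
        using less.prems(3) False by (intro exec.WhileTrue[OF _ exec.Seq[OF 1(1) 2(1)] 3(1)]) simp
      moreover have "Q (t + int (cost e) + int (1 + (u + cost e) + u')) V' m'"
        using 3(3) by (simp add: algebra_simps)
      ultimately show ?thesis using 3(2) by blast
    qed
  qed
  obtain R1 where R1: "exec b ?c (R, h) (cost e) (R1, h)"
    "R1 (operand e nvars) = val e V m" "represents R1 h V m"
    using evl[OF assms(1) rep] by blast
  obtain u R' h' V' m' where 2: "exec b ?W (R1, h) u (R', h')" "represents R' h' V' m'"
    "Q (t + int (cost e) + int u) V' m'" using W[OF assms(1) R1(3,2)] by blast
  have "exec b (loop e p) (R, h) (cost e + u) (R', h')"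
    unfolding loop_def by (rule exec.Seq[OF R1(1) 2(1)])
  moreover have "Q (t + int (cost e + u)) V' m'" using 2(3) by (simp add: algebra_simps)
  ultimately show "\<exists>u R' h' V' m'. exec b (loop e p) (R, h) u (R', h') \<and>
      represents R' h' V' m' \<and> Q (t + int u) V' m'" using 2(2) by blast
qed

definition for_below :: "reg \<Rightarrow> reg \<Rightarrow> com \<Rightarrow> com" where
  "for_below x y p = loop (EVar x <\<^sub>e EVar y) (Seq p (assign x (EVar x +\<^sub>e EConst 1)))"

text \<open>The clock advances by 7 per iteration in addition to the body: 4 for the test, 3 for the
  increment.\<close>

lemma wp_for_below:
  assumes x: "x < nvars" "y < nvars" "x \<noteq> y" "0 \<le> V x" "V x \<le> V y" "V y < 2 ^ b"
    and b: "1 \<le> b"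
    and init: "I (V x) t V m"
    and body: "\<And>i t V' m. V x \<le> i \<Longrightarrow> i < V y \<Longrightarrow> V' x = i \<Longrightarrow> V' y = V y \<Longrightarrow> I i t V' m \<Longrightarrow>
      wp b p (\<lambda>t' V'' m'. V'' x = i \<and> V'' y = V y \<and> I (i + 1) (t' + 3) (V''(x := i + 1)) m')
        (t + 4) V' m"
    and exit: "\<And>t V' m. V' x = V y \<Longrightarrow> V' y = V y \<Longrightarrow> I (V y) t V' m \<Longrightarrow> Q (t + 4) V' m"
  shows "wp b (for_below x y p) Q t V m"
proof -
  have two: "(2::int) \<le> 2 ^ b" using b self_le_power[of "2::int" b] by simp
  show ?thesis unfolding for_below_def
  proof (rule wp_loop[where I = "\<lambda>t V' m. V x \<le> V' x \<and> V' x \<le> V y \<and> V' y = V y \<and> I (V' x) t V' m"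
        and f = "\<lambda>V' m. nat (V y - V' x)"])
    show "safe b (EVar x <\<^sub>e EVar y) V' m" for V' m
      using x two by (simp add: words_def)
  next
    fix t V' m
    assume I: "V x \<le> V' x \<and> V' x \<le> V y \<and> V' y = V y \<and> I (V' x) t V' m"
      and "val (EVar x <\<^sub>e EVar y) V' m \<noteq> 0"
    then have "V' x < V y" by (auto split: if_splits)
    with I have "wp b p (\<lambda>t' V'' m'. V'' x = V' x \<and> V'' y = V y \<and>
        I (V' x + 1) (t' + 3) (V''(x := V' x + 1)) m') (t + 4) V' m"
      by (intro body) auto
    then have "wp b p (\<lambda>t' V'' m'. wp b (assign x (EVar x +\<^sub>e EConst 1))
      (\<lambda>t' V'' m'. (V x \<le> V'' x \<and> V'' x \<le> V y \<and> V'' y = V y \<and> I (V'' x) t' V'' m') \<and>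
         nat (V y - V'' x) < nat (V y - V' x)) t' V'' m') (t + 4) V' m"
      by (rule wp_mono, intro wp_assign) (use x two I \<open>V' x < V y\<close> in \<open>auto simp: words_def\<close>)
    then show "wp b (Seq p (assign x (EVar x +\<^sub>e EConst 1)))
      (\<lambda>t' V'' m'. (V x \<le> V'' x \<and> V'' x \<le> V y \<and> V'' y = V y \<and> I (V'' x) t' V'' m') \<and>
         nat (V y - V'' x) < nat (V y - V' x)) (t + int (cost (EVar x <\<^sub>e EVar y)) + 1) V' m"
      by (intro wp_Seq) (simp add: algebra_simps)
  next
    show "Q (t + int (cost (EVar x <\<^sub>e EVar y)) + 1) V' m"
      if "V x \<le> V' x \<and> V' x \<le> V y \<and> V' y = V y \<and> I (V' x) t V' m"
        "val (EVar x <\<^sub>e EVar y) V' m = 0" for t V' m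
      using exit[of V' t m] that by (auto split: if_splits simp: add.commute)
  qed (use x init in auto)
qed

text \<open>The shape is made for simulated loops. With \<open>tick\<close> for \<open>q\<close>,
  the remainder \<open>Seq q (loop e (Seq p q))\<close> is literally the simulation of the same
  \<open>While\<close> again, so an induction hypothesis about the rest of the loop applies to it.
  The proof only reassociates sequential composition.\<close>

lemma wp_loop_unfold:
  assumes "safe b e V m" "val e V m \<noteq> 0"
    and "wp b p (\<lambda>t V m. wp b (Seq q (loop e (Seq p q))) Q t V m) (t + int (cost e) + 1) V m"
  shows "wp b (loop e (Seq p q)) Q t V m"
  unfolding wp_def
proof (intro allI impI)
  fix R h assume rep: "represents R h V m"
  let ?c = "code e nvars (Suc nvars)"
  let ?W = "While (operand e nvars) (Seq (Seq p q) ?c)"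
  obtain R1 where R1: "exec b ?c (R, h) (cost e) (R1, h)"
    "R1 (operand e nvars) = val e V m" "\<forall>x < Suc nvars. x \<noteq> nvars \<longrightarrow> R1 x = R x"
    using exec_code[OF assms(1) rep, of "Suc nvars" nvars] by auto
  have "represents R1 h V m" using R1(3) rep by (simp add: represents_def)
  then obtain u1 R2 h2 V2 m2 where 2: "exec b p (R1, h) u1 (R2, h2)" "represents R2 h2 V2 m2"
    "wp b (Seq q (loop e (Seq p q))) Q (t + int (cost e) + 1 + int u1) V2 m2"
    using assms(3) unfolding wp_def[of b p] by blast
  then obtain u2 R3 h3 V3 m3 where 3: "exec b (Seq q (loop e (Seq p q))) (R2, h2) u2 (R3, h3)"
    "represents R3 h3 V3 m3" "Q (t + int (cost e) + 1 + int u1 + int u2) V3 m3"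
    unfolding wp_def[of b "Seq _ _"] by blast
  from 3(1) obtain a1 a2 a3 s1 s2 where 4: "exec b q (R2, h2) a1 s1" "exec b ?c s1 a2 s2"
    "exec b ?W s2 a3 (R3, h3)" "u2 = a1 + (a2 + a3)"
    unfolding loop_def by (elim SeqE) simp
  have "exec b ?W (R1, h) (1 + ((u1 + a1) + a2) + a3) (R3, h3)"
    using R1(2) assms(2)
    by (intro exec.WhileTrue[OF _ exec.Seq[OF exec.Seq[OF 2(1) 4(1)] 4(2)] 4(3)]) simp
  from exec.Seq[OF R1(1) this]
  have "exec b (loop e (Seq p q)) (R, h) (cost e + (1 + ((u1 + a1) + a2) + a3)) (R3, h3)"
    unfolding loop_def .
  moreover have "Q (t + int (cost e + (1 + ((u1 + a1) + a2) + a3))) V3 m3"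
    using 3(3) 4(4) by (simp add: algebra_simps)
  ultimately show "\<exists>u R' h' V' m'. exec b (loop e (Seq p q)) (R, h) u (R', h') \<and>
      represents R' h' V' m' \<and> Q (t + int u) V' m'" using 3(2) by blast
qed

lemma wp_loop_exit:
  assumes "safe b e V m" "val e V m = 0" "Q (t + int (cost e) + 1) V m"
  shows "wp b (loop e p) Q t V m"
  by (rule wp_loop[where I = "\<lambda>t' V' m'. t' = t \<and> V' = V \<and> m' = m" and f = "\<lambda>_ _. 0"])
    (use assms in auto)

section \<open>Simulating many machines in one memory\<close>

abbreviation (input) vS :: reg where "vS \<equiv> 2"
abbreviation (input) vL :: reg where "vL \<equiv> 3"
abbreviation (input) vC :: reg where "vC \<equiv> 4"

section \<open>Bounds on the registers that a program uses\<close>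

fun regs_below :: "nat \<Rightarrow> com \<Rightarrow> bool" where
  "regs_below K Skip \<longleftrightarrow> True"
| "regs_below K (Const r k) \<longleftrightarrow> r < K"
| "regs_below K (Op f r r1 r2) \<longleftrightarrow> r < K \<and> r1 < K \<and> r2 < K"
| "regs_below K (Load r a) \<longleftrightarrow> r < K \<and> a < K"
| "regs_below K (Store a r) \<longleftrightarrow> a < K \<and> r < K"
| "regs_below K (Seq p q) \<longleftrightarrow> regs_below K p \<and> regs_below K q"
| "regs_below K (If r p q) \<longleftrightarrow> r < K \<and> regs_below K p \<and> regs_below K q"
| "regs_below K (While r p) \<longleftrightarrow> r < K \<and> regs_below K p"

lemma regs_below_mono: "regs_below K p \<Longrightarrow> K \<le> K' \<Longrightarrow> regs_below K' p"
  by (induction p) auto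

lemma ex_regs_below: "\<exists>K. regs_below K p"
proof (induction p)
  case Skip
  then show ?case by simp
next
  case (Const r k)
  show ?case by (intro exI[of _ "Suc r"]) simp
next
  case (Op f r r1 r2)
  show ?case by (intro exI[of _ "Suc (r + r1 + r2)"]) simp
next
  case (Load r a)
  show ?case by (intro exI[of _ "Suc (r + a)"]) simp
next
  case (Store a r)
  show ?case by (intro exI[of _ "Suc (r + a)"]) simp
next
  case (Seq p q)
  then obtain K L where "regs_below K p" "regs_below L q" by blast
  then show ?case
    by (intro exI[of _ "K + L"]) (auto elim: regs_below_mono)
next
  case (If r p q)
  then obtain K L where "regs_below K p" "regs_below L q" by blast
  then show ?case
    by (intro exI[of _ "Suc r + K + L"]) (auto elim: regs_below_mono)
next
  case (While r p)
  then obtain K where "regs_below K p" by blast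
  then show ?case
    by (intro exI[of _ "Suc r + K"]) (auto elim: regs_below_mono)
qed

definition rcell :: "reg \<Rightarrow> exp" where
  "rcell r = EConst (int r + 1) *\<^sub>e EVar vS +\<^sub>e EVar vL"

definition mcell :: "nat \<Rightarrow> exp \<Rightarrow> exp" where
  "mcell K e = (e +\<^sub>e EConst (int K + 1)) *\<^sub>e EVar vS +\<^sub>e EVar vL"

definition tick :: com where
  "tick = assign vC (EVar vC +\<^sub>e EConst 1)"

text \<open>
  The simulated machine keeps its registers \<open>r < K\<close> and its memory cells \<open>a\<close> as virtual cells
  \<open>r\<close> and \<open>K + a\<close>; virtual cell \<open>v\<close> of machine number \<open>l\<close> is the memory cell \<open>(v + 1) * S + l\<close>.
  Register \<open>vC\<close> counts the simulated steps.
\<close>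

fun sim :: "nat \<Rightarrow> com \<Rightarrow> com" where
  "sim K Skip = tick"
| "sim K (Const r k) = Seq tick (store (rcell r) (EConst k))"
| "sim K (Op f r r1 r2) = Seq tick (store (rcell r) (EOp f (ELoad (rcell r1)) (ELoad (rcell r2))))"
| "sim K (Load r a) = Seq tick (store (rcell r) (ELoad (mcell K (ELoad (rcell a)))))"
| "sim K (Store a r) = Seq tick (store (mcell K (ELoad (rcell a))) (ELoad (rcell r)))"
| "sim K (Seq p q) = Seq (sim K p) (sim K q)"
| "sim K (If r p q) = Seq tick (cond (ELoad (rcell r)) (sim K p) (sim K q))"
| "sim K (While r p) = Seq tick (loop (ELoad (rcell r)) (Seq (sim K p) tick))"

text \<open>Interleaving gives each of the S machines an unbounded address space without knowing its
  memory use in advance. The shift by one keeps all lanes at or above S (\<open>cell_ge\<close>), so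
  the cells below S remain free for the data of the simulating program itself.\<close>

definition cell :: "int \<Rightarrow> int \<Rightarrow> int \<Rightarrow> int" where
  "cell S l v = (v + 1) * S + l"

text \<open>The lane number is the remainder of the address modulo S, and the virtual cell is then
  determined by the quotient.\<close>

lemma cell_eq_iff:
  assumes "0 \<le> l" "l < S" "0 \<le> l'" "l' < S"
  shows "cell S l v = cell S l' v' \<longleftrightarrow> v = v' \<and> l = l'"
proof
  assume eq: "cell S l v = cell S l' v'"
  have "cell S l v mod S = l" "cell S l' v' mod S = l'" using assms by (simp_all add: cell_def)
  with eq have "l = l'" by simp
  with eq assms show "v = v' \<and> l = l'" by (simp add: cell_def)
qed simp

lemma cell_ge:
  assumes "0 \<le> v" "0 < S" "0 \<le> l"
  shows "S \<le> cell S l v"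
proof -
  have "1 * S \<le> (v + 1) * S" using assms by (intro mult_right_mono) auto
  then show ?thesis using assms unfolding cell_def by linarith
qed

definition off_lane :: "int \<Rightarrow> int \<Rightarrow> imem \<Rightarrow> imem \<Rightarrow> bool" where
  "off_lane S l m m' \<longleftrightarrow> (\<forall>x. (\<forall>v\<ge>0. x \<noteq> cell S l v) \<longrightarrow> m' x = m x)"

lemma off_lane_refl: "off_lane S l m m"
  by (simp add: off_lane_def)

lemma off_lane_trans: "off_lane S l m m' \<Longrightarrow> off_lane S l m' m'' \<Longrightarrow> off_lane S l m m''"
  by (simp add: off_lane_def)

lemma off_lane_upd: "0 \<le> v \<Longrightarrow> off_lane S l m (m(cell S l v := y))"
  by (auto simp: off_lane_def)

lemma in_words_nonneg: "0 \<le> x \<Longrightarrow> x < 2 ^ b \<Longrightarrow> x \<in> words b"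
  by (simp add: words_def order.trans[of _ 0])

text \<open>Simulated machines have word length \<open>b0\<close>, the simulating one
  \<open>b\<close>. For a virtual cell v < 2^b0 + K and l < S, the address (v + 1) * S + l stays
  below (2^b0 + K + 2) * S, so \<open>fits\<close> turns every address that occurs into a
  word.\<close>

locale lanes =
  fixes K b0 b :: nat and S :: int
  assumes S_pos: "0 < S" and b0_le: "b0 \<le> b"
    and fits: "(2 ^ b0 + int K + 2) * S \<le> 2 ^ b"
begin

text \<open>The semantics puts no upper bound on the address of a \<open>Load\<close> or
  \<open>Store\<close>. Requiring all simulated contents to be words of length \<open>b0\<close>
  bounds every such address, as it comes from a register, and hence rules out overflow in
  \<open>mcell\<close>.\<close>

definition lane :: "int \<Rightarrow> imem \<Rightarrow> state \<Rightarrow> bool" where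
  "lane l m s \<longleftrightarrow> (\<forall>r < K. m (cell S l (int r)) = fst s r \<and> fst s r \<in> words b0) \<and>
    (\<forall>a. m (cell S l (int K + int a)) = snd s a \<and> snd s a \<in> words b0)"

lemma cell_less:
  assumes "v < 2 ^ b0 + int K" "l < S"
  shows "cell S l v < 2 ^ b"
proof -
  have "(v + 2) * S \<le> (2 ^ b0 + int K + 2) * S"
    using assms S_pos by (intro mult_right_mono) auto
  then show ?thesis using fits assms(2) by (simp add: cell_def algebra_simps)
qed

lemma S_bound: "S * (int K + 3) \<le> 2 ^ b" "int K + 3 \<le> 2 ^ b"
proof -
  have "(1 + int K + 2) * S \<le> (2 ^ b0 + int K + 2) * S"
    using S_pos by (intro mult_right_mono) auto
  then show *: "S * (int K + 3) \<le> 2 ^ b" using fits by (simp add: algebra_simps)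
  have "1 * (int K + 3) \<le> S * (int K + 3)" using S_pos by (intro mult_right_mono) auto
  also note *
  finally show "int K + 3 \<le> 2 ^ b" by simp
qed

lemma safe_rcell:
  assumes "r < K" "V vS = S" "V vL = l" "0 \<le> l" "l < S"
  shows "safe b (rcell r) V m" "val (rcell r) V m = cell S l (int r)" "cost (rcell r) = 5"
proof -
  have "(int r + 1) * S \<le> S * (int K + 3)"
    using assms S_pos by (simp add: mult.commute mult_left_mono)
  then have "(int r + 1) * S \<le> 2 ^ b" using S_bound by linarith
  moreover have "cell S l (int r) < 2 ^ b" using assms by (intro cell_less) (auto intro: add_strict_increasing)
  moreover have "S \<le> (int r + 1) * S" using S_pos by (simp add: algebra_simps)
  ultimately show "safe b (rcell r) V m" "val (rcell r) V m = cell S l (int r)"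
    using assms S_pos S_bound unfolding rcell_def
    by (auto simp: cell_def intro!: in_words_nonneg)
qed (simp add: rcell_def)

lemma safe_mcell:
  assumes "safe b e V m" "val e V m = int a" "int a < 2 ^ b0"
    and "V vS = S" "V vL = l" "0 \<le> l" "l < S"
  shows "safe b (mcell K e) V m" "val (mcell K e) V m = cell S l (int K + int a)"
    "cost (mcell K e) = cost e + 6"
proof -
  have *: "cell S l (int K + int a) < 2 ^ b" using assms by (intro cell_less) auto
  moreover have "S \<le> (int a + (int K + 1)) * S" using S_pos by (simp add: algebra_simps)
  moreover have "(int a + (int K + 1)) * 1 \<le> (int a + (int K + 1)) * S"
    using S_pos by (intro mult_left_mono) auto
  moreover have **: "(int a + (int K + 1)) * S < 2 ^ b"
    using * assms(6) by (auto simp: cell_def add_ac)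
  moreover have "int a + (int K + 1) < 2 ^ b"
    using order.strict_trans1[OF calculation(3) **] by simp
  ultimately show "safe b (mcell K e) V m" "val (mcell K e) V m = cell S l (int K + int a)"
    using assms S_pos S_bound unfolding mcell_def
    by (auto simp: cell_def add_ac intro!: in_words_nonneg)
qed (simp add: mcell_def)

lemma lane_reg: "lane l m s \<Longrightarrow> r < K \<Longrightarrow> m (cell S l (int r)) = fst s r \<and> fst s r \<in> words b0"
  by (simp add: lane_def)

lemma lane_mem:
  "lane l m s \<Longrightarrow> m (cell S l (int K + int a)) = snd s a \<and> snd s a \<in> words b0"
  by (simp add: lane_def)

lemma lane_upd_reg:
  assumes "lane l m (R, h)" "r < K" "y \<in> words b0" "0 \<le> l" "l < S"
  shows "lane l (m(cell S l (int r) := y)) (R(r := y), h)"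
  using assms unfolding lane_def by (auto simp: cell_eq_iff)

lemma lane_upd_mem:
  assumes "lane l m (R, h)" "y \<in> words b0" "0 \<le> l" "l < S"
  shows "lane l (m(cell S l (int K + int a) := y)) (R, h(a := y))"
  using assms unfolding lane_def by (auto simp: cell_eq_iff)

lemma wp_tick:
  assumes "0 \<le> V vC" "V vC + 1 < 2 ^ b" "Q (t + 3) (V(vC := V vC + 1)) m"
  shows "wp b tick Q t V m"
  unfolding tick_def using assms
  by (intro wp_assign) (auto intro!: in_words_nonneg)

text \<open>\<open>Op\<close>, \<open>Load\<close> and \<open>Store\<close> are the dearest
  instructions: 3 steps for the \<open>tick\<close> and 19 for the \<open>store\<close> make 22. The
  count in \<open>vC\<close> is exact while the time is only bounded, so the program can act on the
  true number of simulated steps. The arbitrary \<open>Q\<close> lets the induction hypotheses be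
  chained as continuations.\<close>

lemma wp_sim:
  assumes "exec b0 p s u s'" "regs_below K p" "lane l m s"
    and "V vS = S" "V vL = l" "0 \<le> l" "l < S" "0 \<le> V vC" "V vC + int u < 2 ^ b"
    and "\<And>t' m'. lane l m' s' \<Longrightarrow> off_lane S l m m' \<Longrightarrow> t' \<le> t + 22 * int u \<Longrightarrow>
      Q t' (V(vC := V vC + int u)) m'"
  shows "wp b (sim K p) Q t V m"
  using assms
proof (induction arbitrary: t V m Q rule: exec.induct)
  case (Skip s)
  have "Q (t + 3) (V(vC := V vC + 1)) m"
    using Skip.prems(9)[of m "t + 3"] Skip.prems(2) by (simp add: off_lane_refl fun_upd_def)
  then show ?case using Skip.prems by (simp, intro wp_tick) auto
next
  case (Const k r R h)
  have k: "k \<in> words b" using Const words_mono[OF b0_le] by blast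
  have r: "r < K" using Const by simp
  let ?V = "V(vC := V vC + 1)"
  have V: "?V vS = S" "?V vL = l" using Const by auto
  note c = safe_rcell[of _ ?V, OF r V Const(6,7)]
  have "Q (t + 3 + int (cost (rcell r) + cost (EConst k) + 1)) ?V (m(cell S l (int r) := k))"
    using Const.prems(9)[of "m(cell S l (int r) := k)" "t + 10"]
      off_lane_upd[of "int r" S l m k] lane_upd_reg[OF Const(3) r Const(1,6,7)] c(3) by (simp add: fun_upd_def add_ac)
  then have "wp b (store (rcell r) (EConst k)) Q (t + 3) ?V m"
    using c k cell_ge[of "int r" S l] Const(6) S_pos by (intro wp_store) auto
  then show ?case using Const by (simp, intro wp_Seq wp_tick) auto
next
  case (Op f R r1 r2 r h)
  let ?V = "V(vC := V vC + 1)" and ?y = "bop_val f (R r1) (R r2)"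
  let ?e = "EOp f (ELoad (rcell r1)) (ELoad (rcell r2))"
  have y: "?y \<in> words b" using Op words_mono[OF b0_le] by blast
  have r: "r < K" "r1 < K" "r2 < K" using Op by auto
  have V: "?V vS = S" "?V vL = l" using Op by auto
  note c = safe_rcell[of _ ?V, OF r(1) V Op(6,7)] safe_rcell[of _ ?V, OF r(2) V Op(6,7)] safe_rcell[of _ ?V, OF r(3) V Op(6,7)]
  have ld: "m (cell S l (int r1)) = R r1" "m (cell S l (int r2)) = R r2"
    using lane_reg[OF Op(3)] r by auto
  have nn: "0 \<le> cell S l (int x)" for x using cell_ge[of "int x" S l] Op(6) S_pos by simp
  have "Q (t + 3 + int (cost (rcell r) + cost ?e + 1)) ?V (m(cell S l (int r) := ?y))"
    using Op.prems(9)[of "m(cell S l (int r) := ?y)" "t + 22"]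
      off_lane_upd[of "int r" S l m ?y] lane_upd_reg[OF Op(3) r(1) Op(1,6,7)] c(3,6,9) by (simp add: fun_upd_def add_ac)
  then have "wp b (store (rcell r) ?e) Q (t + 3) ?V m"
    using c y ld nn by (intro wp_store) auto
  then show ?case using Op by (simp, intro wp_Seq wp_tick) auto
next
  case (Load R a r h)
  let ?V = "V(vC := V vC + 1)" and ?y = "h (nat (R a))"
  let ?e = "ELoad (mcell K (ELoad (rcell a)))"
  have r: "r < K" "a < K" using Load by auto
  have V: "?V vS = S" "?V vL = l" using Load by auto
  note c = safe_rcell[of _ ?V, OF r(1) V Load(6,7)] safe_rcell[of _ ?V, OF r(2) V Load(6,7)]
  have nn: "0 \<le> cell S l (int x)" for x using cell_ge[of "int x" S l] Load(6) S_pos by simp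
  have nn': "0 \<le> cell S l (int K + R a)"
    using cell_ge[of "int K + R a" S l] Load(1,6) S_pos by simp
  have ld: "m (cell S l (int a)) = R a" "R a < 2 ^ b0"
    using lane_reg[OF Load(3), of a] r by (auto simp: words_def)
  have "safe b (ELoad (rcell a)) ?V m" "val (ELoad (rcell a)) ?V m = int (nat (R a))"
    using c nn ld Load(1) by auto
  note d = safe_mcell[of _ ?V, OF this _ V Load(6,7)]
  have y: "m (cell S l (int K + int (nat (R a)))) = ?y" "?y \<in> words b0"
    using lane_mem[OF Load(3), of "nat (R a)"] by auto
  have "Q (t + 3 + int (cost (rcell r) + cost ?e + 1)) ?V (m(cell S l (int r) := ?y))"
    using Load.prems(9)[of "m(cell S l (int r) := ?y)" "t + 22"]
      off_lane_upd[of "int r" S l m ?y] lane_upd_reg[OF Load(3) r(1) y(2) Load(6,7)] c(3,6) d(3) ld(2) by (simp add: fun_upd_def add_ac)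
  then have "wp b (store (rcell r) ?e) Q (t + 3) ?V m"
    using c d y ld nn nn' Load(1) by (intro wp_store) auto
  then show ?case using Load by (simp, intro wp_Seq wp_tick) auto
next
  case (Store R a r h)
  let ?V = "V(vC := V vC + 1)" and ?y = "R r"
  let ?e = "mcell K (ELoad (rcell a))" and ?f = "ELoad (rcell r)"
  have r: "r < K" "a < K" using Store by auto
  have V: "?V vS = S" "?V vL = l" using Store by auto
  note c = safe_rcell[of _ ?V, OF r(1) V Store(6,7)] safe_rcell[of _ ?V, OF r(2) V Store(6,7)]
  have nn: "0 \<le> cell S l (int x)" for x using cell_ge[of "int x" S l] Store(6) S_pos by simp
  have nn': "0 \<le> cell S l (int K + R a)"
    using cell_ge[of "int K + R a" S l] Store(1,6) S_pos by simp
  have ld: "m (cell S l (int a)) = R a" "R a < 2 ^ b0" "m (cell S l (int r)) = R r" "R r \<in> words b0"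
    using lane_reg[OF Store(3), of a] lane_reg[OF Store(3), of r] r by (auto simp: words_def)
  have "safe b (ELoad (rcell a)) ?V m" "val (ELoad (rcell a)) ?V m = int (nat (R a))"
    using c nn ld Store(1) by auto
  note d = safe_mcell[of _ ?V, OF this _ V Store(6,7)]
  have "Q (t + 3 + int (cost ?e + cost ?f + 1)) ?V (m(cell S l (int K + int (nat (R a))) := ?y))"
    using Store.prems(9)[of "m(cell S l (int K + int (nat (R a))) := ?y)" "t + 22"]
      off_lane_upd[of "int K + int (nat (R a))" S l m ?y] lane_upd_mem[OF Store(3) ld(4) Store(6,7), of "nat (R a)"]
      Store(1) c(3,6) d(3) ld(2) by (simp add: fun_upd_def add_ac)
  then have "wp b (store ?e ?f) Q (t + 3) ?V m"
    using c d ld nn nn' Store(1) by (intro wp_store) auto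
  then show ?case using Store by (simp, intro wp_Seq wp_tick) auto
next
  case (Seq p s u1 s1 q u2 s2)
  have "wp b (sim K p) (\<lambda>t' V' m'. lane l m' s1 \<and> off_lane S l m m' \<and> t' \<le> t + 22 * int u1 \<and>
      V' = V(vC := V vC + int u1)) t V m"
    using Seq.prems by (intro Seq.IH(1)) auto
  then show ?case unfolding sim.simps
  proof (intro wp_Seq, elim wp_mono, elim conjE)
    fix t' V' m'
    assume 1: "lane l m' s1" "off_lane S l m m'" "t' \<le> t + 22 * int u1"
      "V' = V(vC := V vC + int u1)"
    show "wp b (sim K q) Q t' V' m'"
    proof (rule Seq.IH(2))
      fix t2 m2 assume "lane l m2 s2" "off_lane S l m' m2" "t2 \<le> t' + 22 * int u2"
      then show "Q t2 (V'(vC := V' vC + int u2)) m2"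
        using Seq.prems(9)[of m2 t2] 1 off_lane_trans[OF 1(2)] by (simp add: algebra_simps fun_upd_def cong: if_cong)
    qed (use 1 Seq.prems in auto)
  qed
next
  case (IfTrue s r p u s' q)
  let ?V = "V(vC := V vC + 1)"
  have r: "r < K" using IfTrue by simp
  have V: "?V vS = S" "?V vL = l" using IfTrue by auto
  note c = safe_rcell[of _ ?V, OF r V IfTrue.prems(5,6)]
  have nn: "0 \<le> cell S l (int r)" using cell_ge[of "int r" S l] IfTrue S_pos by simp
  have ld: "m (cell S l (int r)) = fst s r" using lane_reg[OF IfTrue.prems(2) r] by simp
  have "wp b (sim K p) Q (t + 10) ?V m"
  proof (rule IfTrue.IH)
    fix t2 m2 assume "lane l m2 s'" "off_lane S l m m2" "t2 \<le> t + 10 + 22 * int u"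
    then show "Q t2 (?V(vC := ?V vC + int u)) m2"
      using IfTrue.prems(9)[of m2 t2] by (simp add: algebra_simps fun_upd_def cong: if_cong)
  qed (use IfTrue.prems in auto)
  then have "wp b (cond (ELoad (rcell r)) (sim K p) (sim K q)) Q (t + 3) ?V m"
    using c nn ld IfTrue.hyps by (intro wp_cond) (auto simp: add.commute)
  then show ?case using IfTrue.prems by (simp, intro wp_Seq wp_tick) auto
next
  case (IfFalse s r q u s' p)
  let ?V = "V(vC := V vC + 1)"
  have r: "r < K" using IfFalse by simp
  have V: "?V vS = S" "?V vL = l" using IfFalse by auto
  note c = safe_rcell[of _ ?V, OF r V IfFalse.prems(5,6)]
  have nn: "0 \<le> cell S l (int r)" using cell_ge[of "int r" S l] IfFalse S_pos by simp
  have ld: "m (cell S l (int r)) = fst s r" using lane_reg[OF IfFalse.prems(2) r] by simp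
  have "wp b (sim K q) Q (t + 10) ?V m"
  proof (rule IfFalse.IH)
    fix t2 m2 assume "lane l m2 s'" "off_lane S l m m2" "t2 \<le> t + 10 + 22 * int u"
    then show "Q t2 (?V(vC := ?V vC + int u)) m2"
      using IfFalse.prems(9)[of m2 t2] by (simp add: algebra_simps fun_upd_def cong: if_cong)
  qed (use IfFalse.prems in auto)
  then have "wp b (cond (ELoad (rcell r)) (sim K p) (sim K q)) Q (t + 3) ?V m"
    using c nn ld IfFalse.hyps by (intro wp_cond) (auto simp: add.commute)
  then show ?case using IfFalse.prems by (simp, intro wp_Seq wp_tick) auto
next
  case (WhileFalse s r p)
  let ?V = "V(vC := V vC + 1)"
  have r: "r < K" using WhileFalse by simp
  have V: "?V vS = S" "?V vL = l" using WhileFalse by auto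
  note c = safe_rcell[of _ ?V, OF r V WhileFalse.prems(5,6)]
  have nn: "0 \<le> cell S l (int r)" using cell_ge[of "int r" S l] WhileFalse S_pos by simp
  have ld: "m (cell S l (int r)) = fst s r" using lane_reg[OF WhileFalse.prems(2) r] by simp
  have "Q (t + 10) ?V m"
    using WhileFalse.prems(9)[of m "t + 10"] WhileFalse.prems(2) by (simp add: off_lane_refl fun_upd_def)
  then have "wp b (loop (ELoad (rcell r)) (Seq (sim K p) tick)) Q (t + 3) ?V m"
    using c nn ld WhileFalse.hyps by (intro wp_loop_exit) (auto simp: add.commute)
  then show ?case using WhileFalse.prems by (simp, intro wp_Seq wp_tick) auto
next
  case (WhileTrue s r p u1 s1 u2 s2)
  let ?V = "V(vC := V vC + 1)"
  have r: "r < K" using WhileTrue by simp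
  have V: "?V vS = S" "?V vL = l" using WhileTrue by auto
  note c = safe_rcell[of _ ?V, OF r V WhileTrue.prems(5,6)]
  have nn: "0 \<le> cell S l (int r)" using cell_ge[of "int r" S l] WhileTrue S_pos by simp
  have ld: "m (cell S l (int r)) = fst s r" using lane_reg[OF WhileTrue.prems(2) r] by simp
  have "wp b (sim K p) (\<lambda>t' V' m'. lane l m' s1 \<and> off_lane S l m m' \<and>
      t' \<le> t + 10 + 22 * int u1 \<and> V' = ?V(vC := ?V vC + int u1)) (t + 10) ?V m"
    using WhileTrue.prems by (intro WhileTrue.IH(1)) auto
  then have "wp b (sim K p) (\<lambda>t V m. wp b (sim K (While r p)) Q t V m) (t + 10) ?V m"
  proof (elim wp_mono, elim conjE)
    fix t' V' m'
    assume 1: "lane l m' s1" "off_lane S l m m'" "t' \<le> t + 10 + 22 * int u1"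
      "V' = ?V(vC := ?V vC + int u1)"
    show "wp b (sim K (While r p)) Q t' V' m'"
    proof (rule WhileTrue.IH(2))
      fix t2 m2 assume "lane l m2 s2" "off_lane S l m' m2" "t2 \<le> t' + 22 * int u2"
      then show "Q t2 (V'(vC := V' vC + int u2)) m2"
        using WhileTrue.prems(9)[of m2 t2] 1 off_lane_trans[OF 1(2)] by (simp add: algebra_simps fun_upd_def cong: if_cong)
    qed (use 1 WhileTrue.prems in auto)
  qed
  then have "wp b (loop (ELoad (rcell r)) (Seq (sim K p) tick)) Q (t + 3) ?V m"
    using c nn ld WhileTrue.hyps by (intro wp_loop_unfold) (auto simp: add.commute)
  then show ?case using WhileTrue.prems by (simp, intro wp_Seq wp_tick) auto
qed

end

section \<open>Sorting the columns with a tournament tree\<close>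

text \<open>Contestants are stored as row number plus one, so that 0, the initial content of memory,
  stands for an empty place.\<close>

definition better :: "(int \<Rightarrow> int) \<Rightarrow> int \<Rightarrow> int \<Rightarrow> int" where
  "better key a c = (if a = 0 then c else if c = 0 then a else
     if key (c - 1) < key (a - 1) then c else a)"

definition tournament_at :: "(int \<Rightarrow> int) \<Rightarrow> (int \<Rightarrow> int) \<Rightarrow> int \<Rightarrow> bool" where
  "tournament_at key f x \<longleftrightarrow> f x = better key (f (2 * x)) (f (2 * x + 1))"

text \<open>Passing from a node to its parent never raises the key and never turns an occupied place
  into an empty one. In heap numbering, with leaves n to 2 n - 1, this needs no assumption that n is
  a power of two.\<close>

lemma tournament_root_le:
  assumes "\<And>x. 1 \<le> x \<Longrightarrow> x < n \<Longrightarrow> tournament_at key f x"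
    and "1 \<le> y" "y < 2 * n" "f y \<noteq> 0"
  shows "f 1 \<noteq> 0 \<and> key (f 1 - 1) \<le> key (f y - 1)"
  using assms(2-)
proof (induction "nat y" arbitrary: y rule: less_induct)
  case less
  show ?case
  proof (cases "y = 1")
    case False
    define x where "x = y div 2"
    have x: "1 \<le> x" "x < n" "y = 2 * x \<or> y = 2 * x + 1" "x < y"
      using less.prems False by (auto simp: x_def)
    from assms(1)[OF x(1,2)] x(3) less.prems(3)
    have "f x \<noteq> 0 \<and> key (f x - 1) \<le> key (f y - 1)"
      unfolding tournament_at_def better_def by (auto split: if_splits)
    then show ?thesis using less.hyps[of x] x less.prems by fastforce
  qed (use less.prems in auto)
qed

text \<open>An inner node copies one of its children; following the copies downwards ends at a
  leaf.\<close>

lemma tournament_root_leaf: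
  assumes "\<And>x. 1 \<le> x \<Longrightarrow> x < n \<Longrightarrow> tournament_at key f x"
    and "1 \<le> x" "x < 2 * n" "f x \<noteq> 0"
  shows "\<exists>y. n \<le> y \<and> y < 2 * n \<and> f y = f x"
  using assms(2-)
proof (induction "nat (2 * n - x)" arbitrary: x rule: less_induct)
  case less
  show ?case
  proof (cases "n \<le> x")
    case False
    then have "tournament_at key f x" using assms(1) less.prems by simp
    then have "f x = f (2 * x) \<or> f x = f (2 * x + 1)"
      unfolding tournament_at_def better_def by (auto split: if_splits)
    then show ?thesis
      using less.hyps[of "2 * x"] less.hyps[of "2 * x + 1"] less.prems False by fastforce
  qed (use less.prems in auto)
qed

section \<open>The sorting program and its memory layout\<close>

abbreviation (input) vN :: reg where "vN \<equiv> 0"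
abbreviation (input) vG :: reg where "vG \<equiv> 5"
abbreviation (input) vA :: reg where "vA \<equiv> 6"
abbreviation (input) vE :: reg where "vE \<equiv> 7"
abbreviation (input) vK :: reg where "vK \<equiv> 8"
abbreviation (input) vR :: reg where "vR \<equiv> 9"
abbreviation (input) vX :: reg where "vX \<equiv> 10"
abbreviation (input) vI :: reg where "vI \<equiv> 11"
abbreviation (input) vF :: reg where "vF \<equiv> 12"
abbreviation (input) vT :: reg where "vT \<equiv> 13"
abbreviation (input) vQ :: reg where "vQ \<equiv> 14"
abbreviation (input) vNN :: reg where "vNN \<equiv> 15"
abbreviation (input) vAB :: reg where "vAB \<equiv> 16"
abbreviation (input) vPB :: reg where "vPB \<equiv> 17"
abbreviation (input) vTB :: reg where "vTB \<equiv> 18"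

definition matrix_entry :: "exp \<Rightarrow> exp" where
  "matrix_entry e = ELoad (e *\<^sub>e EVar vN +\<^sub>e EVar vK)"

definition sift_up :: com where
  "sift_up = loop (EConst 1 <\<^sub>e EVar vX)
    (Seq (assign vX (EOp Div (EVar vX) (EConst 2)))
    (Seq (assign vF (ELoad (EVar vTB +\<^sub>e (EVar vX +\<^sub>e EVar vX))))
    (Seq (assign vT (ELoad (EVar vTB +\<^sub>e (EVar vX +\<^sub>e EVar vX) +\<^sub>e EConst 1)))
      (cond (EVar vF =\<^sub>e EConst 0)
        (store (EVar vTB +\<^sub>e EVar vX) (EVar vT))
        (cond (EVar vT =\<^sub>e EConst 0)
          (store (EVar vTB +\<^sub>e EVar vX) (EVar vF))
          (cond (matrix_entry (EVar vT -\<^sub>e EConst 1) <\<^sub>e matrix_entry (EVar vF -\<^sub>e EConst 1))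
            (store (EVar vTB +\<^sub>e EVar vX) (EVar vT))
            (store (EVar vTB +\<^sub>e EVar vX) (EVar vF))))))))"

definition sort_column :: com where
  "sort_column =
    Seq (assign vI (EConst 0))
    (Seq (for_below vI vN
      (Seq (assign vX (EVar vN +\<^sub>e EVar vI))
      (Seq (store (EVar vTB +\<^sub>e EVar vX) (EVar vI +\<^sub>e EConst 1)) sift_up)))
    (Seq (assign vR (EConst 0))
      (for_below vR vN
        (Seq (assign vI (ELoad (EVar vTB +\<^sub>e EConst 1) -\<^sub>e EConst 1))
        (Seq (store (EVar vPB +\<^sub>e EVar vK *\<^sub>e EVar vN +\<^sub>e EVar vR) (EVar vI))
        (Seq (assign vX (EVar vN +\<^sub>e EVar vI))
        (Seq (store (EVar vTB +\<^sub>e EVar vX) (EConst 0)) sift_up)))))))"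

definition sort_columns :: com where
  "sort_columns = Seq (assign vK (EConst 0)) (for_below vK vN sort_column)"

text \<open>The frame condition, used for program variables and for memory alike.\<close>

definition agree_off :: "'a set \<Rightarrow> ('a \<Rightarrow> 'b) \<Rightarrow> ('a \<Rightarrow> 'b) \<Rightarrow> bool" where
  "agree_off X f g \<longleftrightarrow> (\<forall>x. x \<notin> X \<longrightarrow> g x = f x)"

lemma agree_offD: "agree_off X f g \<Longrightarrow> x \<notin> X \<Longrightarrow> g x = f x"
  by (simp add: agree_off_def)

lemma agree_off_refl: "agree_off X f f"
  by (simp add: agree_off_def)

lemma agree_off_upd: "agree_off X f g \<Longrightarrow> x \<in> X \<Longrightarrow> agree_off X f (g(x := y))"
  by (auto simp: agree_off_def)

lemma agree_off_trans: "agree_off X f g \<Longrightarrow> agree_off Y g h \<Longrightarrow> X \<union> Y \<subseteq> Z \<Longrightarrow> agree_off Z f h"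
  unfolding agree_off_def by (metis UnI1 UnI2 subsetD)

text \<open>The invariant of selection sort after r draws, with U still in the tournament. The last
  clause, that nothing in U undercuts what has been drawn, is what keeps the drawn sequence sorted
  in the next step.\<close>

definition extracted :: "int \<Rightarrow> (int \<Rightarrow> int) \<Rightarrow> int set \<Rightarrow> (int \<Rightarrow> int) \<Rightarrow> int \<Rightarrow> bool" where
  "extracted n key U p r \<longleftrightarrow> U \<subseteq> {0..<n} \<and> bij_betw p {0..<r} ({0..<n} - U) \<and>
    (\<forall>a c. 0 \<le> a \<and> a \<le> c \<and> c < r \<longrightarrow> key (p a) \<le> key (p c)) \<and>
    (\<forall>a u. 0 \<le> a \<and> a < r \<and> u \<in> U \<longrightarrow> key (p a) \<le> key u)"

lemma extracted_step:
  assumes "extracted n key U p r" "i \<in> U" "\<And>u. u \<in> U \<Longrightarrow> key i \<le> key u" "0 \<le> r"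
    and p': "\<And>a. 0 \<le> a \<Longrightarrow> a < r \<Longrightarrow> p' a = p a" "p' r = i"
  shows "extracted n key (U - {i}) p' (r + 1)"
proof -
  have "bij_betw p' {0..<r} ({0..<n} - U)"
    using assms(1) p'(1) unfolding extracted_def by (subst bij_betw_cong[of _ _ p]) auto
  then have "bij_betw p' (insert r {0..<r}) (insert (p' r) ({0..<n} - U))"
    using p'(2) assms(2) by (subst notIn_Un_bij_betw3[symmetric, of r "{0..<r}" p' "{0..<n} - U",
          simplified]) auto
  moreover have "insert r {0..<r} = {0..<r + 1}" using assms(4) by auto
  moreover have "insert (p' r) ({0..<n} - U) = {0..<n} - (U - {i})"
    using p'(2) assms(1,2) unfolding extracted_def by auto
  ultimately have "bij_betw p' {0..<r + 1} ({0..<n} - (U - {i}))" by simp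
  moreover have "key (p' a) \<le> key (p' c)" if "0 \<le> a" "a \<le> c" "c < r + 1" for a c
  proof (cases "c = r")
    case True
    then show ?thesis using that assms p' unfolding extracted_def by (cases "a = r") auto
  next
    case False
    then show ?thesis using that assms p' unfolding extracted_def by auto
  qed
  moreover have "key (p' a) \<le> key u" if "0 \<le> a" "a < r + 1" "u \<in> U - {i}" for a u
    using that assms p' unfolding extracted_def by (cases "a = r") auto
  ultimately show ?thesis using assms(1) unfolding extracted_def by blast
qed

lemma extracted_card:
  assumes "extracted n key U p r" "0 \<le> r" "0 \<le> n"
  shows "int (card U) = n - r"
proof -
  have "card {0..<r} = card ({0..<n} - U)"
    using assms bij_betw_same_card unfolding extracted_def by blast
  also have "\<dots> = card {0..<n} - card U"
    using assms unfolding extracted_def by (intro card_Diff_subset) (auto intro: finite_subset)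
  finally have "nat r = nat n - card U" by simp
  moreover have "card U \<le> nat n" using assms card_mono[of "{0..<n}" U] unfolding extracted_def by auto
  ultimately show ?thesis using assms by linarith
qed

text \<open>The program's own data end below 2 n^2 + 4 n, so \<open>S_ge\<close> places them below
  all lanes. The factor 10 leaves room for the intermediate values of address arithmetic, see
  \<open>small_word\<close>.\<close>

locale layout =
  fixes n S :: int and b :: nat and M :: "int \<Rightarrow> int \<Rightarrow> int"
  assumes n_pos: "1 \<le> n" and S_ge: "10 * (n * n) \<le> S" and S_fits: "S \<le> 2 ^ b"
begin

definition nn :: int where "nn = n * n"

text \<open>Matrix, query vector and the answer, from \<open>ab\<close> on, lie where the problem
  prescribes. Behind them come the n sorting permutations at \<open>pb\<close> and the tournament
  tree at \<open>tb\<close>.\<close>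

abbreviation ab :: int where "ab \<equiv> nn + n"
abbreviation pb :: int where "pb \<equiv> nn + 2 * n"
abbreviation tb :: int where "tb \<equiv> 2 * nn + 2 * n"

definition static_env :: "env \<Rightarrow> bool" where
  "static_env V \<longleftrightarrow> V vN = n \<and> V vS = S \<and> V vNN = nn \<and> V vAB = ab \<and> V vPB = pb \<and> V vTB = tb"

definition has_matrix :: "imem \<Rightarrow> bool" where
  "has_matrix m \<longleftrightarrow> (\<forall>i k. 0 \<le> i \<and> i < n \<and> 0 \<le> k \<and> k < n \<longrightarrow> m (i * n + k) = M i k)"

definition sorted_col :: "imem \<Rightarrow> int \<Rightarrow> bool" where
  "sorted_col m k \<longleftrightarrow> bij_betw (\<lambda>r. m (pb + k * n + r)) {0..<n} {0..<n} \<and>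
    (\<forall>r r'. 0 \<le> r \<and> r \<le> r' \<and> r' < n \<longrightarrow>
      M (m (pb + k * n + r)) k \<le> M (m (pb + k * n + r')) k)"

lemma n_le_sq: "n \<le> nn"
  using n_pos mult_right_mono[of 1 n n] by (simp add: nn_def)

lemma index_bound:
  assumes "0 \<le> i" "i < n" "0 \<le> k" "k < n"
  shows "0 \<le> i * n" "i * n + k < nn" "i * n \<le> nn"
proof -
  have "(i + 1) * n \<le> nn" unfolding nn_def using assms n_pos by (intro mult_right_mono) auto
  then show "i * n + k < nn" using assms by (simp add: algebra_simps)
  then show "i * n \<le> nn" using assms by linarith
  show "0 \<le> i * n" using assms n_pos by simp
qed

lemma index_inj:
  assumes "0 \<le> r" "r < n" "0 \<le> r'" "r' < n" "k * n + r = k' * n + r'"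
  shows "k = k' \<and> r = r'"
proof -
  have "(k * n + r) mod n = r" "(k' * n + r') mod n = r'" using assms(1-4) by simp_all
  then have "r = r'" using assms(5) by metis
  then show ?thesis using assms n_pos by simp
qed

lemma small_word: "0 \<le> x \<Longrightarrow> x < 10 * nn \<Longrightarrow> x \<in> words b"
  using S_ge S_fits by (intro in_words_nonneg) (auto simp: nn_def)

lemma bit_word: "of_bool P \<in> words b"
  using n_pos n_le_sq by (intro small_word) (auto simp: of_bool_def)

lemma const_word: "0 \<le> c \<Longrightarrow> c \<le> 5 \<Longrightarrow> c \<in> words b"
  using n_pos n_le_sq by (intro small_word) auto

lemma b_pos: "1 \<le> b"
proof (rule ccontr)
  assume "\<not> 1 \<le> b"
  then have "b = 0" by simp
  then show False using S_ge S_fits n_le_sq n_pos unfolding nn_def by simp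
qed

lemma n_less_word: "n < 2 ^ b"
  using S_ge S_fits n_le_sq n_pos unfolding nn_def by linarith

definition tree_ok :: "imem \<Rightarrow> bool" where
  "tree_ok m \<longleftrightarrow> (\<forall>y. 1 \<le> y \<and> y < 2 * n \<longrightarrow> 0 \<le> m (tb + y) \<and> m (tb + y) \<le> n)"

text \<open>The tournament condition may fail only at the parent of the current node, and each
  iteration moves this defect one level up. At the root the parent would be node 0, so no defect
  remains. \<open>D\<close> bounds the height, and each level costs at most 60 steps.\<close>

lemma wp_sift_up:
  assumes env: "V vN = n" "V vTB = tb" "V vK = k" "0 \<le> k" "k < n"
    and x: "1 \<le> V vX" "V vX < 2 * n" "V vX < 2 ^ Suc D"
    and mem: "has_matrix m" "tree_ok m"
    and tour: "\<And>y. 1 \<le> y \<Longrightarrow> y < n \<Longrightarrow> y \<noteq> V vX div 2 \<Longrightarrow>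
      tournament_at (\<lambda>i. M i k) (\<lambda>x. m (tb + x)) y"
  shows "wp b sift_up (\<lambda>t' V' m'. agree_off {vX, vF, vT} V V' \<and>
    agree_off {tb + 1..<tb + n} m m' \<and> tree_ok m' \<and>
    (\<forall>y. 1 \<le> y \<and> y < n \<longrightarrow> tournament_at (\<lambda>i. M i k) (\<lambda>x. m' (tb + x)) y) \<and>
    t' \<le> t + 60 * int D + 5) t V m"
  unfolding sift_up_def
proof (rule wp_loop[where f = "\<lambda>V' m'. nat (V' vX)" and I = "\<lambda>t' V' m'. agree_off {vX, vF, vT} V V' \<and>
    agree_off {tb + 1..<tb + n} m m' \<and> tree_ok m' \<and> 1 \<le> V' vX \<and> V' vX < 2 * n \<and>
    (\<forall>y. 1 \<le> y \<and> y < n \<and> y \<noteq> V' vX div 2 \<longrightarrow> tournament_at (\<lambda>i. M i k) (\<lambda>x. m' (tb + x)) y) \<and>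
    (\<exists>d. V' vX < 2 ^ Suc d \<and> t' + 60 * int d \<le> t + 60 * int D)"], goal_cases)
  case 1
  show ?case using x mem tour by (auto simp: agree_off_refl)
next
  case (2 t V m)
  then show ?case by (auto intro!: const_word bit_word)
next
  case (3 t1 V1 m1)
  then have fr: "agree_off {vX, vF, vT} V V1" "agree_off {tb + 1..<tb + n} m m1" "tree_ok m1"
    "1 \<le> V1 vX" "V1 vX < 2 * n" and
    tr: "\<And>y. 1 \<le> y \<Longrightarrow> y < n \<Longrightarrow> y \<noteq> V1 vX div 2 \<Longrightarrow>
      tournament_at (\<lambda>i. M i k) (\<lambda>x. m1 (tb + x)) y" by auto
  from 3 obtain d where d: "V1 vX < 2 ^ Suc d" "t1 + 60 * int d \<le> t + 60 * int D" by blast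
  have gt: "1 < V1 vX" using 3(2) by (simp split: if_splits)
  \<comment> \<open>Above the root the remaining height is positive; one unit of it pays for this
    iteration.\<close>
  then obtain d' where d': "d = Suc d'" using d(1) by (cases d) auto
  define x where "x = V1 vX div 2"
  define F where "F = m1 (tb + 2 * x)"
  define T where "T = m1 (tb + 2 * x + 1)"
  have xb: "1 \<le> x" "x < n" "x < V1 vX" "x < 2 ^ Suc d'"
    using gt fr(5) d(1) d' by (auto simp: x_def)
  have ev: "V1 vN = n" "V1 vTB = tb" "V1 vK = k"
    using agree_offD[OF fr(1)] env by auto
  have FT: "0 \<le> F" "F \<le> n" "0 \<le> T" "T \<le> n"
    using fr(3)[unfolded tree_ok_def, rule_format, of "2 * x"]
      fr(3)[unfolded tree_ok_def, rule_format, of "2 * x + 1"] xb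
    unfolding F_def T_def by (auto simp: algebra_simps)
  have mat: "m1 (i * n + k) = M i k" if "0 \<le> i" "i < n" for i
    using that env(4,5) mem(1) index_bound[OF that env(4,5)] agree_offD[OF fr(2), of "i * n + k"]
      n_pos n_le_sq unfolding has_matrix_def by simp
  define y where "y = better (\<lambda>i. M i k) F T"
  have y: "0 \<le> y" "y \<le> n" using FT by (auto simp: y_def better_def)
  let ?V = "V1(vX := x, vF := F, vT := T)" and ?m = "m1(tb + x := y)"
  have post: "(agree_off {vX, vF, vT} V ?V \<and>
    agree_off {tb + 1..<tb + n} m ?m \<and> tree_ok ?m \<and> 1 \<le> ?V vX \<and> ?V vX < 2 * n \<and>
    (\<forall>y. 1 \<le> y \<and> y < n \<and> y \<noteq> ?V vX div 2 \<longrightarrow> tournament_at (\<lambda>i. M i k) (\<lambda>x. ?m (tb + x)) y) \<and>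
    (\<exists>d. ?V vX < 2 ^ Suc d \<and> t' + 60 * int d \<le> t + 60 * int D)) \<and> nat (?V vX) < nat (V1 vX)"
    if "t' \<le> t1 + 60" for t'
  proof -
    have "tournament_at (\<lambda>i. M i k) (\<lambda>x. ?m (tb + x)) z"
      if z: "1 \<le> z" "z < n" "z \<noteq> x div 2" for z
    proof (cases "z = x")
      case True
      then show ?thesis using xb by (simp add: tournament_at_def y_def F_def T_def algebra_simps)
    next
      case False
      \<comment> \<open>A new value at node x can matter only at x and at its parent, and z is
        neither.\<close>
      moreover have "2 * z \<noteq> x" "2 * z + 1 \<noteq> x" using z by auto
      ultimately show ?thesis using tr[of z] z by (simp add: tournament_at_def x_def)
    qed
    moreover have "t' + 60 * int d' \<le> t + 60 * int D" using d(2) d' that by simp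
    moreover have "tree_ok ?m" using fr(3) y unfolding tree_ok_def by auto
    moreover have "agree_off {tb + 1..<tb + n} m ?m"
      using fr(2) xb by (intro agree_off_upd) auto
    moreover have "agree_off {vX, vF, vT} V ?V" by (intro agree_off_upd fr(1)) auto
    ultimately show ?thesis using xb by auto
  qed
  have w: "tb + (x + x) + 1 \<in> words b" "x \<in> words b" "x + x \<in> words b" "tb + (x + x) \<in> words b"
    "tb + x \<in> words b" "1 \<in> words b" "0 \<in> words b" "2 \<in> words b"
    using xb n_le_sq n_pos by (auto intro!: small_word)
  have kw: "(F - 1) * n + k \<in> words b" "(F - 1) * n \<in> words b" "F - 1 \<in> words b"
    "0 \<le> (F - 1) * n + k" "m1 ((F - 1) * n + k) = M (F - 1) k" if "F \<noteq> 0"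
    using index_bound[of "F - 1" k] FT that env(4,5) n_le_sq mat[of "F - 1"]
    by (auto intro!: small_word)
  have kw': "(T - 1) * n + k \<in> words b" "(T - 1) * n \<in> words b" "T - 1 \<in> words b"
    "0 \<le> (T - 1) * n + k" "m1 ((T - 1) * n + k) = M (T - 1) k" if "T \<noteq> 0"
    using index_bound[of "T - 1" k] FT that env(4,5) n_le_sq mat[of "T - 1"]
    by (auto intro!: small_word)
  have nn: "0 \<le> tb + x" "0 \<le> tb + (x + x)" "0 \<le> tb + (x + x) + 1" using xb n_le_sq n_pos by auto
  have c: "cost (EConst 1 <\<^sub>e EVar vX) = 3" by simp
  define Q where "Q = (\<lambda>t' V' m'. (agree_off {vX, vF, vT} V V' \<and>
    agree_off {tb + 1..<tb + n} m m' \<and> tree_ok m' \<and> 1 \<le> V' vX \<and> V' vX < 2 * n \<and>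
    (\<forall>y. 1 \<le> y \<and> y < n \<and> y \<noteq> V' vX div 2 \<longrightarrow> tournament_at (\<lambda>i. M i k) (\<lambda>x. m' (tb + x)) y) \<and>
    (\<exists>d. V' vX < 2 ^ Suc d \<and> t' + 60 * int d \<le> t + 60 * int D)) \<and> nat (V' vX) < nat (V1 vX))"
  have post': "Q t' ?V ?m" if "t' \<le> t1 + 60" for t' unfolding Q_def by (rule post[OF that])
  have st: "wp b (store (EVar vTB +\<^sub>e EVar vX) (EVar v)) Q t' ?V m1"
    if "?V v = y" "v < nvars" "t' \<le> t1 + 55" for v t'
  proof (rule wp_store, goal_cases)
    case 4
    have "val (EVar vTB +\<^sub>e EVar vX) ?V m1 = tb + x" "val (EVar v) ?V m1 = y"
      using ev that(1) by auto
    then show ?case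
      using post'[of "t' + int (cost (EVar vTB +\<^sub>e EVar vX) + cost (EVar v) + 1)"] that(3) by simp
  qed (use ev w nn that in auto)
  have c1: "wp b (cond (EVar vF =\<^sub>e EConst 0)
        (store (EVar vTB +\<^sub>e EVar vX) (EVar vT))
        (cond (EVar vT =\<^sub>e EConst 0)
          (store (EVar vTB +\<^sub>e EVar vX) (EVar vF))
          (cond (matrix_entry (EVar vT -\<^sub>e EConst 1) <\<^sub>e matrix_entry (EVar vF -\<^sub>e EConst 1))
            (store (EVar vTB +\<^sub>e EVar vX) (EVar vT))
            (store (EVar vTB +\<^sub>e EVar vX) (EVar vF))))) Q t' ?V m1" if "t' \<le> t1 + 25" for t'
    using that ev w kw kw'
    by (intro wp_cond st) (auto simp: bit_word y_def better_def matrix_entry_def split: if_splits)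
  show ?case unfolding Q_def[symmetric]
    by (intro wp_Seq wp_assign; (use w nn ev c1 in \<open>simp add: x_def[symmetric] F_def[symmetric] T_def[symmetric]\<close>)?)
qed (use n_le_sq in \<open>auto split: if_splits\<close>)


definition tree_leaves :: "imem \<Rightarrow> int set \<Rightarrow> bool" where
  "tree_leaves m U \<longleftrightarrow> (\<forall>y. 0 \<le> y \<and> y < n \<longrightarrow> m (tb + (n + y)) = (if y \<in> U then y + 1 else 0))"

definition tournament :: "imem \<Rightarrow> int \<Rightarrow> bool" where
  "tournament m k \<longleftrightarrow>
    (\<forall>y. 1 \<le> y \<and> y < n \<longrightarrow> tournament_at (\<lambda>i. M i k) (\<lambda>x. m (tb + x)) y)"

lemma tournament_root:
  assumes "tournament m k" "tree_leaves m U" "U \<subseteq> {0..<n}" "u \<in> U"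
  shows "m (tb + 1) - 1 \<in> U" "M (m (tb + 1) - 1) k \<le> M u k"
proof -
  let ?f = "\<lambda>x. m (tb + x)"
  have t: "\<And>x. 1 \<le> x \<Longrightarrow> x < n \<Longrightarrow> tournament_at (\<lambda>i. M i k) ?f x"
    using assms(1) by (simp add: tournament_def)
  have u: "?f (n + u) = u + 1" "0 \<le> u" "u < n" using assms unfolding tree_leaves_def by auto
  have r: "?f 1 \<noteq> 0" "M (?f 1 - 1) k \<le> M u k"
    using tournament_root_le[of n "\<lambda>i. M i k" ?f "n + u", OF t] u n_pos by auto
  then show "M (m (tb + 1) - 1) k \<le> M u k" by simp
  obtain y where y: "n \<le> y" "y < 2 * n" "?f y = ?f 1"
    using tournament_root_leaf[of n "\<lambda>i. M i k" ?f 1, OF t] r n_pos by auto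
  with assms(2)[unfolded tree_leaves_def, rule_format, of "y - n"] r(1)
  show "m (tb + 1) - 1 \<in> U" by (auto split: if_splits)
qed

text \<open>Once all rows have been drawn, the whole tree is zero again, so the next column can use
  it without clearing.\<close>

lemma tournament_zero:
  assumes "tournament m k" "tree_leaves m {}" "1 \<le> y" "y < 2 * n"
  shows "m (tb + y) = 0"
proof (rule ccontr)
  let ?f = "\<lambda>x. m (tb + x)"
  assume "m (tb + y) \<noteq> 0"
  then obtain z where z: "n \<le> z" "z < 2 * n" "?f z = ?f y"
    using tournament_root_leaf[of n "\<lambda>i. M i k" ?f y] assms unfolding tournament_def by auto
  with assms(2)[unfolded tree_leaves_def, rule_format, of "z - n"] \<open>m (tb + y) \<noteq> 0\<close>
  show False by auto
qed

text \<open>The flag \<open>P\<close> treats insertion and removal of a leaf at once: both change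
  one leaf and repair the path above it.\<close>

lemma wp_set_leaf:
  assumes env: "V vN = n" "V vTB = tb" "V vK = k" "0 \<le> k" "k < n" "V vX = n + i" "0 \<le> i" "i < n"
    and D: "n \<le> 2 ^ D" and mem: "has_matrix m" "tree_ok m" "tournament m k" "tree_leaves m U"
    and e: "safe b e V m" "val e V m = (if P then i + 1 else 0)" "cost e \<le> 3"
    and U': "U' = (if P then insert i U else U - {i})"
  shows "wp b (Seq (store (EVar vTB +\<^sub>e EVar vX) e) sift_up) (\<lambda>t' V' m'.
    agree_off {vX, vF, vT} V V' \<and> agree_off {tb + 1..<tb + 2 * n} m m' \<and> tree_ok m' \<and>
    tournament m' k \<and> tree_leaves m' U' \<and> t' \<le> t + 60 * int D + 12) t V m" (is "wp b _ ?Post _ _ _")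
proof -
  define y where "y = (if P then i + 1 else 0)"
  define m1 where "m1 = m(tb + (n + i) := y)"
  have 1: "has_matrix m1"
    unfolding has_matrix_def
  proof (intro allI impI)
    fix a c assume ac: "0 \<le> a \<and> a < n \<and> 0 \<le> c \<and> c < n"
    then have "a * n + c < nn" using index_bound by auto
    then have "m1 (a * n + c) = m (a * n + c)" using n_pos env n_le_sq unfolding m1_def by simp
    then show "m1 (a * n + c) = M a c" using ac mem(1) unfolding has_matrix_def by simp
  qed
  have 2: "tree_ok m1" using mem(2) env unfolding tree_ok_def m1_def y_def by auto
  have 3: "tournament_at (\<lambda>i. M i k) (\<lambda>x. m1 (tb + x)) z"
    if "1 \<le> z" "z < n" "z \<noteq> V vX div 2" for z
  proof -
    have "2 * z \<noteq> n + i" "2 * z + 1 \<noteq> n + i" using that env(6) by auto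
    then show ?thesis using that mem(3) env unfolding tournament_def tournament_at_def m1_def by auto
  qed
  have 4: "tree_leaves m' U'" if "agree_off {tb + 1..<tb + n} m1 m'" for m'
    unfolding tree_leaves_def
  proof (intro allI impI)
    fix z assume z: "0 \<le> z \<and> z < n"
    have "m' (tb + (n + z)) = m1 (tb + (n + z))" using that z by (intro agree_offD) auto
    then show "m' (tb + (n + z)) = (if z \<in> U' then z + 1 else 0)"
      using mem(4) z unfolding tree_leaves_def m1_def y_def U' by auto
  qed
  have x: "V vX < 2 ^ Suc D" using env D by simp
  have "wp b sift_up ?Post
    (t + int (cost (EVar vTB +\<^sub>e EVar vX) + cost e + 1)) V m1"
  proof (rule wp_mono[OF wp_sift_up[where k = k and D = D]], goal_cases)
    case (12 t' V' m')
    moreover have "agree_off {tb + 1..<tb + 2 * n} m m1"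
      unfolding m1_def using env by (intro agree_off_upd agree_off_refl) auto
    moreover have "{tb + 1..<tb + 2 * n} \<union> {tb + 1..<tb + n} \<subseteq> {tb + 1..<tb + 2 * n}"
      using n_pos by auto
    ultimately show ?case using 4[of m'] e(3) agree_off_trans[of _ m m1 _ m']
      unfolding tournament_def by auto
  qed (use env x 1 2 3 in simp_all)
  moreover have "tb + (n + i) \<in> words b" "0 \<le> tb + (n + i)"
    using env n_le_sq n_pos by (auto intro!: small_word)
  ultimately show ?thesis
    using e env by (intro wp_Seq wp_store) (auto simp: m1_def y_def)
qed

text \<open>Each row climbs the tree twice, when it is inserted and when it is drawn; hence the
  factor 120 = 2 * 60 at the height \<open>D\<close>. The zero tree in the conclusion is the
  precondition for the next column.\<close>

lemma wp_sort_column: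
  assumes env: "V vN = n" "V vTB = tb" "V vPB = pb" "V vK = k" "0 \<le> k" "k < n"
    and D: "n \<le> 2 ^ D" and mem: "has_matrix m" "\<And>y. 1 \<le> y \<Longrightarrow> y < 2 * n \<Longrightarrow> m (tb + y) = 0"
  shows "wp b sort_column (\<lambda>t' V' m'. agree_off {vX, vF, vT, vI, vR} V V' \<and>
    agree_off ({tb + 1..<tb + 2 * n} \<union> {pb + k * n..<pb + k * n + n}) m m' \<and>
    (\<forall>y. 1 \<le> y \<and> y < 2 * n \<longrightarrow> m' (tb + y) = 0) \<and> sorted_col m' k \<and>
    t' \<le> t + n * (120 * int D + 100) + 20) t V m" (is "wp b _ ?Post _ _ _")
proof -
  let ?pb = "Seq (store (EVar vTB +\<^sub>e EVar vX) (EVar vI +\<^sub>e EConst 1)) sift_up"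
  let ?pa = "Seq (assign vI (ELoad (EVar vTB +\<^sub>e EConst 1) -\<^sub>e EConst 1)) (Seq (store (EVar
    vPB +\<^sub>e EVar vK *\<^sub>e EVar vN +\<^sub>e EVar vR) (EVar vI)) (Seq (assign vX (EVar
    vN +\<^sub>e EVar vI)) (Seq (store (EVar vTB +\<^sub>e EVar vX) (EConst 0)) sift_up)))"
  define R where "R = ?Post"
  define I1 where "I1 = (\<lambda>i t' V' m'. agree_off {vX, vF, vT, vI, vR} V V' \<and>
    agree_off {tb + 1..<tb + 2 * n} m m' \<and> tree_ok m' \<and> tournament m' k \<and>
    tree_leaves m' {0..<i} \<and> t' \<le> t + 1 + i * (60 * int D + 30))"
  define E where "E = (\<lambda>r t' V' m' U. agree_off {vX, vF, vT, vI, vR} V V' \<and>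
    agree_off ({tb + 1..<tb + 2 * n} \<union> {pb + k * n..<pb + k * n + n}) m m' \<and>
    tree_ok m' \<and> tournament m' k \<and> tree_leaves m' U \<and>
    extracted n (\<lambda>i. M i k) U (\<lambda>r. m' (pb + k * n + r)) r \<and>
    t' \<le> t + 6 + n * (60 * int D + 30) + r * (60 * int D + 50))"
  have kb: "0 \<le> k * n" "k * n + n \<le> nn"
    using index_bound(1)[of k 0] index_bound(2)[of k "n - 1"] env n_pos by auto
  have hm: "has_matrix m'"
    if "agree_off ({tb + 1..<tb + 2 * n} \<union> {pb + k * n..<pb + k * n + n}) m m'" for m'
    unfolding has_matrix_def
  proof (intro allI impI)
    fix i j assume ij: "0 \<le> i \<and> i < n \<and> 0 \<le> j \<and> j < n"
    then have "i * n + j < nn" "0 \<le> i * n" using index_bound by auto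
    then have "m' (i * n + j) = m (i * n + j)" using that kb n_pos by (intro agree_offD) auto
    then show "m' (i * n + j) = M i j" using ij mem(1) unfolding has_matrix_def by auto
  qed
  have w: "(0::int) \<in> words b" "(1::int) \<in> words b" "k * n \<in> words b" "tb + 1 \<in> words b"
    using kb n_le_sq n_pos by (auto intro!: small_word)
  have ex: "wp b (for_below vR vN
        ?pa) R t1 V1 m1"
    if init: "E 0 t1 V1 m1 {0..<n}" "V1 vR = 0" for t1 V1 m1
  proof (rule wp_for_below[where I = "\<lambda>r t' V' m'. \<exists>U. E r t' V' m' U"])
    have "V1 vN = n" using init(1) env agree_offD[of _ V V1 vN] unfolding E_def by auto
    then show "V1 vR \<le> V1 vN" "V1 vN < 2 ^ b" using init(2) n_pos n_less_word by simp_all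
    show "\<exists>U. E (V1 vR) t1 V1 m1 U" using init by auto
  next
    fix r t' V' m'
    assume "V1 vR \<le> r" "r < V1 vN" "V' vR = r" "V' vN = V1 vN" "\<exists>U. E r t' V' m' U"
    moreover have "V1 vN = n" using init(1) env agree_offD[of _ V V1 vN] unfolding E_def by auto
    ultimately obtain U where U: "E r t' V' m' U" "0 \<le> r" "r < n" "V' vR = r"
      using init(2) by auto
    have ag: "agree_off {vX, vF, vT, vI, vR} V V'"
      "agree_off ({tb + 1..<tb + 2 * n} \<union> {pb + k * n..<pb + k * n + n}) m m'"
      and tr: "tree_ok m'" "tournament m' k" "tree_leaves m' U"
      and ext: "extracted n (\<lambda>i. M i k) U (\<lambda>r. m' (pb + k * n + r)) r"
      and tm: "t' \<le> t + 6 + n * (60 * int D + 30) + r * (60 * int D + 50)"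
      using U(1) unfolding E_def by auto
    have ev: "V' vN = n" "V' vTB = tb" "V' vPB = pb" "V' vK = k"
      using agree_offD[OF ag(1)] env by auto
    have Us: "U \<subseteq> {0..<n}" using ext by (simp add: extracted_def)
    have "card U > 0" using extracted_card[OF ext] U n_pos by auto
    then obtain u where "u \<in> U" by (metis card_gt_0_iff ex_in_conv)
    define i where "i = m' (tb + 1) - 1"
    have i: "i \<in> U" "\<And>u. u \<in> U \<Longrightarrow> M i k \<le> M u k"
      using tournament_root[OF tr(2,3) Us] \<open>u \<in> U\<close> unfolding i_def by blast+
    have ib: "0 \<le> i" "i < n" using i(1) Us by auto
    let ?V = "V'(vI := i, vX := n + i)" and ?m = "m'(pb + k * n + r := i)"
    have rb: "0 \<le> k * n + r" "k * n + r < nn" using kb U by auto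
    have 1: "tree_ok ?m" "tournament ?m k" "tree_leaves ?m U"
    proof -
      have "tree_ok m2 \<and> tournament m2 k \<and> tree_leaves m2 U"
        if eq: "\<And>x. 0 \<le> x \<Longrightarrow> m2 (tb + x) = m' (tb + x)" for m2
      proof -
        have "m2 (tb + (n + y)) = m' (tb + (n + y))" if "0 \<le> y" for y
          using eq[of "n + y"] that n_pos by simp
        then show ?thesis using tr n_pos eq
          unfolding tree_ok_def tournament_def tournament_at_def tree_leaves_def by simp
      qed
      moreover have "?m (tb + x) = m' (tb + x)" if "0 \<le> x" for x using rb that by simp
      ultimately show "tree_ok ?m" "tournament ?m k" "tree_leaves ?m U" by blast+
    qed
    have ag2: "agree_off ({tb + 1..<tb + 2 * n} \<union> {pb + k * n..<pb + k * n + n}) m ?m"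
      using U by (intro agree_off_upd ag) auto
    have "wp b (Seq (store (EVar vTB +\<^sub>e EVar vX) (EConst 0)) sift_up)
        (\<lambda>t'' V'' m''. V'' vR = r \<and> V'' vN = V1 vN \<and> (\<exists>U. E (r + 1) (t'' + 3) (V''(vR := r + 1)) m'' U))
        s ?V ?m" if "s \<le> t' + 27" for s
    proof (rule wp_mono[OF wp_set_leaf[where P = False and U = U and U' = "U - {i}" and i = i and D = D and k = k]],
        goal_cases)
      case (18 s' V'' m'')
      then have p: "agree_off {vX, vF, vT} ?V V''" "agree_off {tb + 1..<tb + 2 * n} ?m m''"
        "tree_ok m''" "tournament m'' k" "tree_leaves m'' (U - {i})" "s' \<le> s + 60 * int D + 12" by auto
      have "extracted n (\<lambda>i. M i k) (U - {i}) (\<lambda>r. m'' (pb + k * n + r)) (r + 1)"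
      proof (rule extracted_step[OF ext i U(2)])
        show "m'' (pb + k * n + a) = m' (pb + k * n + a)" if "0 \<le> a" "a < r" for a
          using agree_offD[OF p(2), of "pb + k * n + a"] that U kb by auto
        show "m'' (pb + k * n + r) = i"
          using agree_offD[OF p(2), of "pb + k * n + r"] rb by auto
      qed
      moreover have "agree_off {vX, vF, vT, vI, vR} V (V''(vR := r + 1))"
      proof (intro agree_off_upd)
        have "agree_off {vX, vF, vT, vI, vR} V ?V" by (intro agree_off_upd ag) auto
        from agree_off_trans[OF this p(1)] show "agree_off {vX, vF, vT, vI, vR} V V''" by auto
      qed auto
      moreover have "agree_off ({tb + 1..<tb + 2 * n} \<union> {pb + k * n..<pb + k * n + n}) m m''"
        using agree_off_trans[OF ag2 p(2)] by auto
      moreover have "s' + 3 \<le> t + 6 + n * (60 * int D + 30) + (r + 1) * (60 * int D + 50)"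
        using p(6) that tm by (simp add: algebra_simps)
      moreover have "V'' vR = r" "V'' vN = V1 vN"
        using agree_offD[OF p(1)] U(4) \<open>V' vN = V1 vN\<close> by auto
      ultimately show ?case using p unfolding E_def by auto
    qed (use ev env ib D 1 w hm[OF ag2] in auto)
    moreover have "i \<in> words b" "n + i \<in> words b" "pb + k * n + r \<in> words b" "pb + k * n \<in> words b"
      "0 \<le> pb + k * n + r"
      using ib rb kb n_le_sq n_pos by (auto intro!: small_word)
    ultimately show "wp b
       ?pa
        (\<lambda>t'' V'' m''. V'' vR = r \<and> V'' vN = V1 vN \<and> (\<exists>U. E (r + 1) (t'' + 3) (V''(vR := r + 1)) m'' U))
        (t' + 4) V' m'"
      using w ev n_pos n_le_sq U(4)
      by (intro wp_Seq[of _ "assign _ _"] wp_Seq[of _ "store (_ +\<^sub>e _ +\<^sub>e _) _"] wp_assign wp_store)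
        (simp_all add: i_def[symmetric])
  next
    fix t' V' m'
    assume a: "V' vR = V1 vN" "V' vN = V1 vN" "\<exists>U. E (V1 vN) t' V' m' U"
    moreover have "V1 vN = n" using init(1) env agree_offD[of _ V V1 vN] unfolding E_def by auto
    ultimately obtain U where U: "E n t' V' m' U" by auto
    then have "int (card U) = 0" "finite U"
      using extracted_card[of n "\<lambda>i. M i k" U _ n] n_pos unfolding E_def
      by (auto simp: extracted_def intro: finite_subset)
    then have "U = {}" by auto
    then show "R (t' + 4) V' m'" using U tournament_zero[of m' k] n_pos
      unfolding R_def E_def sorted_col_def extracted_def by (auto simp: algebra_simps)
  qed (use init b_pos in auto)
  have fl: "wp b (for_below vI vN
      (Seq (assign vX (EVar vN +\<^sub>e EVar vI))
      ?pb))
    (\<lambda>t' V' m'. E 0 (t' + 1) (V'(vR := 0)) m' {0..<n}) (t + 1) (V(vI := 0)) m"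
  proof (rule wp_for_below[where I = I1], goal_cases)
    case 8
    have "tree_ok m" "tournament m k"
      using mem(2) n_pos unfolding tree_ok_def tournament_def tournament_at_def better_def by simp_all
    moreover have "tree_leaves m {0..<0}"
      unfolding tree_leaves_def 
    proof (intro allI impI)
      fix y assume "0 \<le> y \<and> y < n"
      then show "m (tb + (n + y)) = (if y \<in> {0..<0} then y + 1 else 0)"
        using mem(2)[of "n + y"] n_pos by simp
    qed
    ultimately show ?case unfolding I1_def by (simp add: agree_off_upd agree_off_refl)
  next
    case (9 i t' V' m')
    then have i: "0 \<le> i" "i < n" "V' vI = i" "V' vN = n" and I: "I1 i t' V' m'" using env by simp_all
    have ag: "agree_off {vX, vF, vT, vI, vR} V V'" "agree_off {tb + 1..<tb + 2 * n} m m'"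
      and tr: "tree_ok m'" "tournament m' k" "tree_leaves m' {0..<i}"
      and tm: "t' \<le> t + 1 + i * (60 * int D + 30)"
      using I unfolding I1_def by auto
    have ev: "V' vN = n" "V' vTB = tb" "V' vK = k"
      using agree_offD[OF ag(1)] env by auto
    have hm1: "has_matrix m'" using ag(2) by (intro hm) (auto simp: agree_off_def)
    let ?V = "V'(vX := n + i)"
    have w1: "n + i \<in> words b" "i + 1 \<in> words b" using i n_le_sq by (auto intro!: small_word)
    have "wp b ?pb
      (\<lambda>t'' V'' m''. V'' vI = i \<and> V'' vN = (V(vI := 0)) vN \<and> I1 (i + 1) (t'' + 3) (V''(vI := i + 1)) m'')
      (t' + 7) ?V m'"
    proof (rule wp_mono[OF wp_set_leaf[where P = True and U = "{0..<i}" and U' = "{0..<i + 1}"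
            and i = i and D = D and k = k]], goal_cases)
      case (18 s' V'' m'')
      then have p: "agree_off {vX, vF, vT} ?V V''" "agree_off {tb + 1..<tb + 2 * n} m' m''"
        "tree_ok m''" "tournament m'' k" "tree_leaves m'' {0..<i + 1}"
        "s' \<le> t' + 7 + 60 * int D + 12" by auto
      have "agree_off {vX, vF, vT, vI, vR} V ?V" by (intro agree_off_upd ag) auto
      from agree_off_trans[OF this p(1)] have "agree_off {vX, vF, vT, vI, vR} V V''" by auto
      then have "agree_off {vX, vF, vT, vI, vR} V (V''(vI := i + 1))" by (intro agree_off_upd) auto
      moreover have "agree_off {tb + 1..<tb + 2 * n} m m''"
        using agree_off_trans[OF ag(2) p(2)] by auto
      moreover have "s' + 3 \<le> t + 1 + (i + 1) * (60 * int D + 30)"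
        using p(6) tm by (simp add: algebra_simps)
      moreover have "V'' vI = i" "V'' vN = (V(vI := 0)) vN"
        using agree_offD[OF p(1)] i env by auto
      ultimately show ?case using p unfolding I1_def by simp
    next
      case 17
      then show ?case using i by auto
    qed (use ev env i D tr w w1 hm1 in simp_all)
    then show ?case using w1 ev i
      by (intro wp_Seq[of _ "assign _ _"] wp_assign) (simp_all add: add.commute)
  next
    case (10 t' V' m')
    then have I: "I1 n t' V' m'" using env by simp
    have "extracted n (\<lambda>i. M i k) {0..<n} p 0" for p
      by (auto simp: extracted_def bij_betw_def)
    moreover have "agree_off {vX, vF, vT, vI, vR} V (V'(vR := 0))"
      using I unfolding I1_def by (intro agree_off_upd) auto
    moreover have "agree_off ({tb + 1..<tb + 2 * n} \<union> {pb + k * n..<pb + k * n + n}) m m'"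
      using I unfolding I1_def by (auto simp: agree_off_def)
    ultimately show ?case using I unfolding I1_def E_def by simp
  qed (use env n_pos n_less_word b_pos in simp_all)
  have rest: "wp b (Seq (assign vR (EConst 0)) (for_below vR vN
        ?pa)) R t1 V1 m1"
    if "E 0 (t1 + 1) (V1(vR := 0)) m1 {0..<n}" for t1 V1 m1
    using ex[OF that] w by (intro wp_Seq[of _ "assign vR _"] wp_assign) simp_all
  show ?thesis unfolding R_def[symmetric] sort_column_def
    using wp_mono[OF fl rest] w
    by (intro wp_Seq[of _ "assign vI (EConst _)"] wp_Seq[of _ "for_below vI vN _"] wp_assign) simp_all
qed

lemma wp_sort_columns:
  assumes env: "static_env V"
    and D: "n \<le> 2 ^ D" and mem: "has_matrix m" "\<And>y. 1 \<le> y \<Longrightarrow> y < 2 * n \<Longrightarrow> m (tb + y) = 0"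
  shows "wp b sort_columns (\<lambda>t' V' m'. agree_off {vX, vF, vT, vI, vR, vK} V V' \<and>
    agree_off {pb..<tb + 2 * n} m m' \<and> (\<forall>k. 0 \<le> k \<and> k < n \<longrightarrow> sorted_col m' k) \<and>
    t' \<le> t + nn * (120 * int D + 200)) t V m" (is "wp b _ ?Post _ _ _")
proof -
  define I where "I = (\<lambda>k t' V' m'. agree_off {vX, vF, vT, vI, vR, vK} V V' \<and>
    agree_off {pb..<tb + 2 * n} m m' \<and> (\<forall>j. 0 \<le> j \<and> j < k \<longrightarrow> sorted_col m' j) \<and>
    (\<forall>y. 1 \<le> y \<and> y < 2 * n \<longrightarrow> m' (tb + y) = 0) \<and>
    t' \<le> t + 1 + k * (n * (120 * int D + 100) + 30))"
  have "wp b (for_below vK vN sort_column) ?Post (t + 1) (V(vK := 0)) m"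
  proof (rule wp_for_below[where I = I], goal_cases)
    case 8
    show ?case unfolding I_def using mem by (auto simp: agree_off_upd agree_off_refl)
  next
    case (9 k t' V' m')
    then have k: "0 \<le> k" "k < n" "V' vK = k" and Ik: "I k t' V' m'"
      using env by (simp_all add: static_env_def)
    have ag: "agree_off {vX, vF, vT, vI, vR, vK} V V'" "agree_off {pb..<tb + 2 * n} m m'"
      and so: "\<And>j. 0 \<le> j \<Longrightarrow> j < k \<Longrightarrow> sorted_col m' j"
      and z: "\<And>y. 1 \<le> y \<Longrightarrow> y < 2 * n \<Longrightarrow> m' (tb + y) = 0"
      and tm: "t' \<le> t + 1 + k * (n * (120 * int D + 100) + 30)"
      using Ik unfolding I_def by auto
    have ev: "V' vN = n" "V' vTB = tb" "V' vPB = pb"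
      using agree_offD[OF ag(1)] env by (simp_all add: static_env_def)
    have hm: "has_matrix m'" unfolding has_matrix_def
    proof (intro allI impI)
      fix i j assume ij: "0 \<le> i \<and> i < n \<and> 0 \<le> j \<and> j < n"
      then have "i * n + j < nn" "0 \<le> i * n" using index_bound by auto
      then have "m' (i * n + j) = m (i * n + j)" using n_pos by (intro agree_offD[OF ag(2)]) auto
      then show "m' (i * n + j) = M i j" using ij mem(1) unfolding has_matrix_def by simp
    qed
    have kb: "0 \<le> j * n" "j * n + n \<le> nn" if "0 \<le> j" "j < n" for j
      using index_bound(1)[of j 0] index_bound(2)[of j "n - 1"] that n_pos by auto
    show ?case
    proof (rule wp_mono[OF wp_sort_column[where k = k and D = D]], goal_cases)
      case (10 s V'' m'')
      then have p: "agree_off {vX, vF, vT, vI, vR} V' V''"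
        "agree_off ({tb + 1..<tb + 2 * n} \<union> {pb + k * n..<pb + k * n + n}) m' m''"
        "\<And>y. 1 \<le> y \<Longrightarrow> y < 2 * n \<Longrightarrow> m'' (tb + y) = 0" "sorted_col m'' k"
        "s \<le> t' + 4 + n * (120 * int D + 100) + 20" by auto
      have "sorted_col m'' j" if "0 \<le> j" "j < k + 1" for j
      proof (cases "j = k")
        case False
        have "m'' (pb + j * n + r) = m' (pb + j * n + r)" if r: "0 \<le> r" "r < n" for r
        proof (rule agree_offD[OF p(2)])
          have "(j + 1) * n \<le> k * n" using False \<open>j < k + 1\<close> n_pos by (intro mult_right_mono) auto
          then show "pb + j * n + r \<notin> {tb + 1..<tb + 2 * n} \<union> {pb + k * n..<pb + k * n + n}"
            using r kb[of k] k by (simp add: algebra_simps)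
        qed
        then show ?thesis using so[of j] that False
          unfolding sorted_col_def
          by (subst bij_betw_cong[of _ _ "\<lambda>r. m' (pb + j * n + r)"]) auto
      qed (use p in simp)
      moreover have "agree_off {pb..<tb + 2 * n} m m''"
      proof (rule agree_off_trans[OF ag(2) p(2)])
        show "{pb..<tb + 2 * n} \<union> ({tb + 1..<tb + 2 * n} \<union> {pb + k * n..<pb + k * n + n}) \<subseteq> {pb..<tb + 2 * n}"
          using kb[OF k(1,2)] n_le_sq n_pos by auto
      qed
      moreover have "agree_off {vX, vF, vT, vI, vR, vK} V (V''(vK := k + 1))"
        using agree_off_trans[OF ag(1) p(1)] by (intro agree_off_upd) auto
      moreover have "s + 3 \<le> t + 1 + (k + 1) * (n * (120 * int D + 100) + 30)"
        using tm p(5) by (simp add: algebra_simps)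
      moreover have "V'' vK = k" "V'' vN = (V(vK := 0)) vN"
        using agree_offD[OF p(1)] k ev env by (simp_all add: static_env_def)
      ultimately show ?case using p(3) unfolding I_def by simp
    qed (use ev k D hm z in simp_all)
  next
    case (10 t' V' m')
    then have I: "I n t' V' m'" using env by (simp add: static_env_def)
    have "t' + 4 \<le> t + nn * (120 * int D + 200)"
    proof -
      have "t' \<le> t + 1 + (nn * (120 * int D + 100) + 30 * n)"
        using I unfolding I_def nn_def by (simp add: algebra_simps)
      then show ?thesis using n_le_sq n_pos by (simp add: algebra_simps)
    qed
    then show ?case using I unfolding I_def by simp
  qed (use env n_pos n_less_word b_pos in \<open>simp_all add: static_env_def\<close>)
  then show ?thesis unfolding sort_columns_def
    by (intro wp_Seq wp_assign) (simp_all add: const_word)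
qed

end

section \<open>One level of buckets\<close>

definition perm_entry :: "exp \<Rightarrow> exp" where
  "perm_entry e = ELoad (EVar vPB +\<^sub>e EVar vK *\<^sub>e EVar vN +\<^sub>e e)"

definition set_end :: com where
  "set_end = Seq (assign vE (EVar vA +\<^sub>e EVar vG))
    (cond (EVar vN <\<^sub>e EVar vE) (assign vE (EVar vN +\<^sub>e EConst 0)) Skip)"

definition load_level :: "nat \<Rightarrow> com" where
  "load_level K = Seq set_end
    (Seq (assign vR (EVar vA +\<^sub>e EConst 0))
    (Seq (for_below vR vE (Seq (assign vK (EConst 0))
       (for_below vK vN
         (store (mcell K (perm_entry (EVar vR) *\<^sub>e EVar vN +\<^sub>e EVar vK)) (EConst 1)))))
      (store (rcell 0) (EVar vN))))"

definition scan :: com where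
  "scan = Seq (assign vR (EVar vA +\<^sub>e EConst 0))
    (for_below vR vE (Seq (assign vI (perm_entry (EVar vR)))
      (cond (matrix_entry (EVar vI) =\<^sub>e EVar vQ) (store (EVar vAB +\<^sub>e EVar vI) (EConst 1)) Skip)))"

definition feed_bucket :: "nat \<Rightarrow> com" where
  "feed_bucket K =
    Seq (assign vF (matrix_entry (perm_entry (EVar vA))))
    (Seq (assign vT (matrix_entry (perm_entry (EVar vE -\<^sub>e EConst 1))))
    (Seq (assign vQ (ELoad (EVar vNN +\<^sub>e EVar vK)))
    (cond (EVar vF =\<^sub>e EVar vT)
      (store (mcell K (EVar vNN +\<^sub>e EVar vK)) (EVar vF =\<^sub>e EVar vQ))
      (Seq (store (mcell K (EVar vNN +\<^sub>e EVar vK)) (EConst 0))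
        (cond (EVar vQ <\<^sub>e EVar vF) Skip (cond (EVar vT <\<^sub>e EVar vQ) Skip scan))))))"

definition feed :: "nat \<Rightarrow> com" where
  "feed K = Seq (assign vK (EConst 0)) (for_below vK vN (feed_bucket K))"

definition collect :: "nat \<Rightarrow> com" where
  "collect K = Seq (assign vI (EConst 0)) (for_below vI vN
    (cond (ELoad (mcell K (EVar vAB +\<^sub>e EVar vI))) (store (EVar vAB +\<^sub>e EVar vI) (EConst 1)) Skip))"

definition query_level :: "nat \<Rightarrow> com \<Rightarrow> com" where
  "query_level K p = Seq set_end (Seq (feed K) (Seq (sim K p) (Seq (collect K)
    (assign vC (EVar vC +\<^sub>e EVar vN)))))"

text \<open>\<sigma> k r is the row holding the entry of rank r in column k.
  \<open>addr_fits\<close> makes the prescribed input and output cells of a Boolean instance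
  addressable with its word length, and \<open>K_pos\<close> provides register 0 for the
  dimension.\<close>

locale buckets = layout n S b M + lanes K b0 b S
  for n S b M K b0 +
  fixes \<sigma> :: "int \<Rightarrow> int \<Rightarrow> int"
  assumes K_pos: "1 \<le> K" and addr_fits: "nn + 2 * n \<le> 2 ^ b0"
    and perm_bij: "\<And>k. 0 \<le> k \<Longrightarrow> k < n \<Longrightarrow> bij_betw (\<sigma> k) {0..<n} {0..<n}"
    and perm_sorted: "\<And>k r r'. 0 \<le> k \<Longrightarrow> k < n \<Longrightarrow> 0 \<le> r \<Longrightarrow> r \<le> r' \<Longrightarrow> r' < n \<Longrightarrow>
      M (\<sigma> k r) k \<le> M (\<sigma> k r') k"
begin

abbreviation N :: nat where "N \<equiv> nat n"

definition has_perm :: "imem \<Rightarrow> bool" where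
  "has_perm m \<longleftrightarrow> (\<forall>k r. 0 \<le> k \<and> k < n \<and> 0 \<le> r \<and> r < n \<longrightarrow> m (pb + k * n + r) = \<sigma> k r)"

text \<open>As a set, a lane can be united with other regions in \<open>agree_off\<close>, which
  \<open>off_lane\<close> does not allow.\<close>

definition Lane :: "int \<Rightarrow> int set" where
  "Lane l = {x. \<exists>v\<ge>0. x = cell S l v}"

abbreviation Ans :: "int set" where "Ans \<equiv> {ab..<ab + n}"

lemma off_lane_iff: "off_lane S l m m' \<longleftrightarrow> agree_off (Lane l) m m'"
  unfolding off_lane_def agree_off_def Lane_def by auto

lemma Lane_ge: "x \<in> Lane l \<Longrightarrow> 0 \<le> l \<Longrightarrow> S \<le> x"
  unfolding Lane_def using cell_ge S_pos by auto

lemma Lane_disjoint: "0 \<le> l \<Longrightarrow> l < S \<Longrightarrow> 0 \<le> l' \<Longrightarrow> l' < S \<Longrightarrow> l \<noteq> l' \<Longrightarrow> cell S l v \<notin> Lane l'"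
  unfolding Lane_def by (auto simp: cell_eq_iff)

lemma own_less_S: "x < tb + 2 * n \<Longrightarrow> x < S"
  using S_ge n_le_sq n_pos unfolding nn_def by linarith

lemma own_notin_Lane: "x < tb + 2 * n \<Longrightarrow> 0 \<le> l \<Longrightarrow> x \<notin> Lane l"
  using Lane_ge own_less_S by fastforce

lemma perm_range: "0 \<le> k \<Longrightarrow> k < n \<Longrightarrow> 0 \<le> r \<Longrightarrow> r < n \<Longrightarrow> 0 \<le> \<sigma> k r \<and> \<sigma> k r < n"
  using bij_betwE[OF perm_bij] by auto

lemma lane_cong:
  assumes "lane l m s" "\<And>v. 0 \<le> v \<Longrightarrow> m' (cell S l v) = m (cell S l v)"
  shows "lane l m' s"
  using assms unfolding lane_def by auto

lemma has_matrix_cong: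
  assumes "has_matrix m" "\<And>x. 0 \<le> x \<Longrightarrow> x < nn \<Longrightarrow> m' x = m x"
  shows "has_matrix m'"
  using assms index_bound unfolding has_matrix_def by simp

lemma perm_index:
  assumes "0 \<le> k" "k < n" "0 \<le> r" "r < n"
  shows "pb \<le> pb + k * n + r" "pb + k * n + r < tb" "pb \<le> pb + k * n" "pb + k * n < tb"
  using index_bound[OF assms] assms by simp_all

lemma has_perm_cong:
  assumes "has_perm m" "\<And>x. pb \<le> x \<Longrightarrow> x < tb \<Longrightarrow> m' x = m x"
  shows "has_perm m'"
  using assms perm_index unfolding has_perm_def by simp

text \<open>The part of the program's memory that is never changed after sorting.\<close>

definition static_mem :: "imem \<Rightarrow> bool" where
  "static_mem m \<longleftrightarrow> has_matrix m \<and> has_perm m"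

lemma static_mem_agree:
  assumes "static_mem m" "agree_off X m m'" "\<And>x. x \<in> X \<Longrightarrow> (nn \<le> x \<and> x < pb) \<or> tb \<le> x"
  shows "static_mem m'"
proof -
  have "m' x = m x" if "\<not> ((nn \<le> x \<and> x < pb) \<or> tb \<le> x)" for x
    using agree_offD[OF assms(2), of x] assms(3)[of x] that by blast
  then show ?thesis
    using assms(1) has_matrix_cong[of m m'] has_perm_cong[of m m'] n_pos n_le_sq
    unfolding static_mem_def by simp
qed

lemma static_mem_level:
  assumes "static_mem m" "agree_off (Ans \<union> Lane l) m m'" "0 \<le> l"
  shows "static_mem m'"
proof (rule static_mem_agree[OF assms(1,2)])
  fix x assume "x \<in> Ans \<union> Lane l"
  then show "(nn \<le> x \<and> x < pb) \<or> tb \<le> x"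
    using Lane_ge[of x l] own_less_S[of x] assms(3) n_pos by fastforce
qed

lemma safe_perm_entry:
  assumes "static_env V" "static_mem m" "V vK = k" "0 \<le> k" "k < n"
    and "safe b e V m" "val e V m = r" "0 \<le> r" "r < n"
  shows "safe b (perm_entry e) V m" "val (perm_entry e) V m = \<sigma> k r" "cost (perm_entry e) = cost e + 7"
proof -
  have "k * n \<in> words b" "pb + k * n \<in> words b" "pb + k * n + r \<in> words b"
    using perm_index[of k r] index_bound[of k r] assms n_le_sq n_pos by (auto intro!: small_word)
  then show "safe b (perm_entry e) V m" "val (perm_entry e) V m = \<sigma> k r"
    using assms perm_index[of k r] n_le_sq n_pos
    by (simp_all add: perm_entry_def static_env_def static_mem_def has_perm_def)
qed (simp add: perm_entry_def)

lemma safe_matrix_entry: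
  assumes "static_env V" "static_mem m" "V vK = k" "0 \<le> k" "k < n"
    and "safe b e V m" "val e V m = i" "0 \<le> i" "i < n"
  shows "safe b (matrix_entry e) V m" "val (matrix_entry e) V m = M i k" "cost (matrix_entry e) = cost e + 5"
proof -
  have "i * n \<in> words b" "i * n + k \<in> words b"
    using index_bound[of i k] assms n_le_sq n_pos by (auto intro!: small_word)
  then show "safe b (matrix_entry e) V m" "val (matrix_entry e) V m = M i k"
    using assms index_bound[of i k]
    by (simp_all add: matrix_entry_def static_env_def static_mem_def has_matrix_def)
qed (simp add: matrix_entry_def)

lemma safe_mcell_int:
  assumes "safe b e V m" "val e V m = a" "0 \<le> a" "a < pb"
    and "V vS = S" "V vL = l" "0 \<le> l" "l < S"
  shows "safe b (mcell K e) V m" "val (mcell K e) V m = cell S l (int K + a)"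
    "0 \<le> cell S l (int K + a)"
  using safe_mcell[of e V m "nat a" l] assms addr_fits cell_ge[of "int K + a" S l] S_pos by simp_all

lemma wp_set_end:
  assumes "static_env V" "V vA = a" "V vG = g" "0 \<le> a" "a < n" "0 \<le> g" "n + g \<le> S"
    and "\<And>t'. t' \<le> t + 10 \<Longrightarrow> Q t' (V(vE := min (a + g) n)) m"
  shows "wp b set_end Q t V m"
proof -
  have "a + g \<in> words b" "n \<in> words b" "0 \<in> words b"
    using assms S_fits n_less_word n_pos by (auto intro!: in_words_nonneg)
  moreover have "wp b (cond (EVar vN <\<^sub>e EVar vE) (assign vE (EVar vN +\<^sub>e EConst 0)) Skip) Q
      (t + 3) (V(vE := a + g)) m"
    using assms calculation
    by (intro wp_cond wp_assign wp_Skip)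
      (simp_all add: bit_word static_env_def min_def fun_upd_def cong: if_cong split: if_splits)
  ultimately show ?thesis
    unfolding set_end_def using assms
    by (intro wp_Seq[of _ "assign _ _"] wp_assign) (simp_all add: add.commute)
qed

text \<open>What the ranks from a to e - 1 of column k contribute to row i of the answer. The
  disjunction over all buckets and columns is the full answer.\<close>

definition hit :: "(int \<Rightarrow> int) \<Rightarrow> int \<Rightarrow> int \<Rightarrow> int \<Rightarrow> int \<Rightarrow> bool" where
  "hit q a e k i \<longleftrightarrow> (\<exists>r. a \<le> r \<and> r < e \<and> \<sigma> k r = i \<and> M i k = q k)"

lemma hit_empty: "\<not> hit q a a k i"
  by (auto simp: hit_def)

lemma wp_scan:
  assumes env: "static_env V" "V vA = a" "V vE = e" "0 \<le> a" "a \<le> e" "e \<le> n" "V vQ = q k"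
    "V vK = k" "0 \<le> k" "k < n" and mem: "static_mem m"
  shows "wp b scan (\<lambda>t' V' m'. agree_off {vR, vI} V V' \<and> agree_off Ans m m' \<and>
    (\<forall>i. 0 \<le> i \<and> i < n \<longrightarrow> m' (ab + i) = (if hit q a e k i then 1 else m (ab + i))) \<and>
    t' \<le> t + 40 * (e - a) + 10) t V m" (is "wp b _ ?Post _ _ _")
proof -
  let ?pa = "cond (matrix_entry (EVar vI) =\<^sub>e EVar vQ) (store (EVar vAB +\<^sub>e EVar vI) (EConst
    1)) Skip"
  define I where "I = (\<lambda>r t' V' m'. agree_off {vR, vI} V V' \<and> agree_off Ans m m' \<and>
    (\<forall>i. 0 \<le> i \<and> i < n \<longrightarrow> m' (ab + i) = (if hit q a r k i then 1 else m (ab + i))) \<and>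
    t' \<le> t + 3 + 40 * (r - a))"
  have w: "(0::int) \<in> words b" "(1::int) \<in> words b" "a \<in> words b"
    using env n_le_sq n_pos by (auto intro!: small_word)
  have "wp b (for_below vR vE (Seq (assign vI (perm_entry (EVar vR)))
      ?pa))
     ?Post (t + 3) (V(vR := a)) m"
  proof (rule wp_for_below[where I = I], goal_cases)
    case 8
    show ?case unfolding I_def using env by (simp add: hit_empty agree_off_upd agree_off_refl)
  next
    case (9 r t' V' m')
    then have r: "a \<le> r" "r < e" "V' vR = r" "V' vE = e" and Ir: "I r t' V' m'" using env by simp_all
    have ag: "agree_off {vR, vI} V V'" "agree_off Ans m m'"
      and an: "\<And>i. 0 \<le> i \<Longrightarrow> i < n \<Longrightarrow> m' (ab + i) = (if hit q a r k i then 1 else m (ab + i))"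
      and tm: "t' \<le> t + 3 + 40 * (r - a)"
      using Ir unfolding I_def by auto
    have rb: "0 \<le> r" "r < n" using r env by simp_all
    define i where "i = \<sigma> k r"
    have i: "0 \<le> i" "i < n" using perm_range rb env unfolding i_def by simp_all
    have st: "static_mem m'" using ag(2) n_pos by (intro static_mem_agree[OF mem ag(2)]) simp
    have ev: "static_env V'" "V' vK = k" "V' vQ = q k"
      using env agree_offD[OF ag(1)] unfolding static_env_def by simp_all
    have sp: "safe b (perm_entry (EVar vR)) V' m'" "val (perm_entry (EVar vR)) V' m' = i"
      "cost (perm_entry (EVar vR)) = 8"
      using safe_perm_entry[of V' m' k "EVar vR" r] ev st env rb r i_def by simp_all
    let ?V = "V'(vI := i)"
    have ev2: "static_env ?V" "?V vK = k" using ev by (simp_all add: static_env_def)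
    have sm: "safe b (matrix_entry (EVar vI)) ?V m'" "val (matrix_entry (EVar vI)) ?V m' = M i k"
      "cost (matrix_entry (EVar vI)) = 6"
      using safe_matrix_entry[of ?V m' k "EVar vI" i] ev2 st env i by simp_all
    define Q where "Q = (\<lambda>t' V' m'. V' vR = r \<and> V' vE = (V(vR := a)) vE \<and>
      I (r + 1) (t' + 3) (V'(vR := r + 1)) m')"
    have hs: "hit q a (r + 1) k j \<longleftrightarrow> hit q a r k j \<or> (j = i \<and> M i k = q k)" for j
      unfolding hit_def i_def using r by (auto simp: less_le)
    have agV: "agree_off {vR, vI} V (?V(vR := r + 1))" by (intro agree_off_upd ag) simp_all
    have 1: "Q s ?V (m'(ab + i := 1))" if "s \<le> t' + 30" "M i k = q k" for s
    proof -
      have "agree_off Ans m (m'(ab + i := 1))" using i by (intro agree_off_upd ag) simp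
      then show ?thesis unfolding Q_def I_def using agV an hs that tm r env by simp
    qed
    have 2: "Q s ?V m'" if "s \<le> t' + 30" "M i k \<noteq> q k" for s
      unfolding Q_def I_def using agV ag an hs that tm r env by simp
    have abw: "ab + i \<in> words b" "0 \<le> ab + i" using i n_le_sq n_pos by (auto intro!: small_word)
    have "wp b ?pa
      Q (t' + 12) ?V m'"
      using ev2 ev sm w abw 1 2
      by (intro wp_cond wp_store wp_Skip) (simp_all add: bit_word static_env_def split: if_splits)
    then show ?case unfolding Q_def[symmetric] using sp
      by (intro wp_Seq wp_assign) (simp_all add: perm_entry_def add.commute)
  next
    case (10 t' V' m')
    then have "I e t' V' m'" using env by simp
    then show ?case unfolding I_def by simp
  qed (use env n_pos n_less_word b_pos in simp_all)
  then show ?thesis unfolding scan_def using w env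
    by (intro wp_Seq[of _ "assign _ _"] wp_assign) simp_all
qed

text \<open>In a sorted column, equal ends make the bucket constant. This is a constant-time
  test.\<close>

definition uniform :: "int \<Rightarrow> int \<Rightarrow> int \<Rightarrow> bool" where
  "uniform a e k \<longleftrightarrow> M (\<sigma> k a) k = M (\<sigma> k (e - 1)) k"

definition query_bit :: "(int \<Rightarrow> int) \<Rightarrow> int \<Rightarrow> int \<Rightarrow> int \<Rightarrow> int" where
  "query_bit q a e k = of_bool (uniform a e k \<and> M (\<sigma> k a) k = q k)"

text \<open>Only these buckets have to be scanned: by \<open>hit_between\<close>, a bucket whose
  range misses the query value contains no hit, and a uniform bucket is left to the Boolean
  instance.\<close>

definition straddles :: "(int \<Rightarrow> int) \<Rightarrow> int \<Rightarrow> int \<Rightarrow> int \<Rightarrow> bool" where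
  "straddles q a e k \<longleftrightarrow>
    \<not> uniform a e k \<and> M (\<sigma> k a) k \<le> q k \<and> q k \<le> M (\<sigma> k (e - 1)) k"

lemma hit_between:
  assumes "hit q a e k i" "0 \<le> k" "k < n" "0 \<le> a" "e \<le> n"
  shows "M (\<sigma> k a) k \<le> q k" "q k \<le> M (\<sigma> k (e - 1)) k"
proof -
  obtain r where r: "a \<le> r" "r < e" "\<sigma> k r = i" "M i k = q k" using assms(1) hit_def by blast
  then show "M (\<sigma> k a) k \<le> q k" "q k \<le> M (\<sigma> k (e - 1)) k"
    using perm_sorted[of k a r] perm_sorted[of k r "e - 1"] assms by simp_all
qed

text \<open>The Boolean matrix also marks the non-uniform buckets. Query bit 0 silences them there,
  and their hits, if any, are recorded at once by the scan. The clause about the answer covers all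
  non-uniform buckets since those that do not straddle have no hits.\<close>

lemma wp_feed_bucket:
  assumes env: "static_env V" "V vA = a" "V vE = e" "0 \<le> a" "a < e" "e \<le> n"
    "V vK = k" "0 \<le> k" "k < n" "V vL = l" "0 \<le> l" "l < S"
    and mem: "static_mem m" "m (nn + k) = q k"
  shows "wp b (feed_bucket K) (\<lambda>t' V' m'. agree_off {vR..vQ} V V' \<and>
    agree_off (Ans \<union> {cell S l (int K + (nn + k))}) m m' \<and>
    m' (cell S l (int K + (nn + k))) = query_bit q a e k \<and>
    (\<forall>i. 0 \<le> i \<and> i < n \<longrightarrow>
      m' (ab + i) = (if \<not> uniform a e k \<and> hit q a e k i then 1 else m (ab + i))) \<and>
    t' \<le> t + 90 + (if straddles q a e k then 40 * (e - a) + 10 else 0)) t V m" (is "wp b _ ?Post _ _ _")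
proof -
  define Q where "Q = ?Post"
  let ?c = "cell S l (int K + (nn + k))"
  define F where "F = M (\<sigma> k a) k"
  define T where "T = M (\<sigma> k (e - 1)) k"
  let ?V1 = "V(vF := F)" and ?V2 = "V(vF := F, vT := T)" and ?V = "V(vF := F, vT := T, vQ := q k)"
  have w: "(0::int) \<in> words b" "(1::int) \<in> words b" "e - 1 \<in> words b" "nn + k \<in> words b" "0 \<le> nn + k"
    using env n_le_sq n_pos by (auto intro!: small_word)
  have vS: "V vS = S" "V vNN = nn" "V vAB = ab" using env(1) by (simp_all add: static_env_def)
  have ev: "static_env ?V1" "static_env ?V2" "static_env ?V" using env(1) by (simp_all add: static_env_def)
  have pr: "0 \<le> \<sigma> k a" "\<sigma> k a < n" "0 \<le> \<sigma> k (e - 1)" "\<sigma> k (e - 1) < n"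
    using perm_range[of k a] perm_range[of k "e - 1"] env by simp_all
  have pa: "safe b (perm_entry (EVar vA)) V m" "val (perm_entry (EVar vA)) V m = \<sigma> k a"
    "cost (perm_entry (EVar vA)) = 8"
    using safe_perm_entry[of V m k "EVar vA" a] env mem by simp_all
  have ma: "safe b (matrix_entry (perm_entry (EVar vA))) V m"
    "val (matrix_entry (perm_entry (EVar vA))) V m = F" "cost (matrix_entry (perm_entry (EVar vA))) = 13"
    using safe_matrix_entry[of V m k "perm_entry (EVar vA)" "\<sigma> k a"] pa env mem pr
    by (simp_all add: F_def)
  have pe: "safe b (perm_entry (EVar vE -\<^sub>e EConst 1)) ?V1 m"
    "val (perm_entry (EVar vE -\<^sub>e EConst 1)) ?V1 m = \<sigma> k (e - 1)"
    "cost (perm_entry (EVar vE -\<^sub>e EConst 1)) = 10"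
    using safe_perm_entry[of ?V1 m k "EVar vE -\<^sub>e EConst 1" "e - 1"] ev env mem w by simp_all
  have me: "safe b (matrix_entry (perm_entry (EVar vE -\<^sub>e EConst 1))) ?V1 m"
    "val (matrix_entry (perm_entry (EVar vE -\<^sub>e EConst 1))) ?V1 m = T"
    "cost (matrix_entry (perm_entry (EVar vE -\<^sub>e EConst 1))) = 15"
    using safe_matrix_entry[of ?V1 m k "perm_entry (EVar vE -\<^sub>e EConst 1)" "\<sigma> k (e - 1)"] pe ev env mem pr
    by (simp_all add: T_def)
  have mc: "safe b (mcell K (EVar vNN +\<^sub>e EVar vK)) ?V m"
    "val (mcell K (EVar vNN +\<^sub>e EVar vK)) ?V m = ?c" "0 \<le> ?c"
    "cost (mcell K (EVar vNN +\<^sub>e EVar vK)) = 9"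
    using safe_mcell_int[of "EVar vNN +\<^sub>e EVar vK" ?V m "nn + k" l] vS env w n_pos
    by (simp_all add: mcell_def)
  have own: "ab + i \<noteq> ?c" if "0 \<le> i" "i < n" for i
    using cell_ge[of "int K + (nn + k)" S l] own_less_S[of "ab + i"] that env w S_pos n_le_sq by simp
  have agV: "agree_off {vR..vQ} V ?V" by (intro agree_off_upd agree_off_refl) simp_all
  have A: "Q s ?V (m(?c := of_bool (F = q k)))" if "F = T" "s \<le> t + 90" for s
    unfolding Q_def using that own agV env
    by (simp add: query_bit_def uniform_def F_def T_def agree_off_upd agree_off_refl)
  have B: "Q s ?V (m(?c := 0))" if "F \<noteq> T" "q k < F \<or> T < q k" "s \<le> t + 90" for s
  proof -
    have "\<not> hit q a e k i" for i
      using hit_between[of q a e k i] that env by (auto simp: F_def T_def)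
    then show ?thesis
      unfolding Q_def using that own agV env
      by (simp add: query_bit_def uniform_def F_def T_def agree_off_upd agree_off_refl)
  qed
  have C: "wp b scan Q s ?V (m(?c := 0))" if "F \<noteq> T" "F \<le> q k" "q k \<le> T" "s \<le> t + 90" for s
  proof (rule wp_mono[OF wp_scan[where a = a and e = e and q = q and k = k]], goal_cases)
    case 11
    have "agree_off {?c} m (m(?c := 0))" by (intro agree_off_upd agree_off_refl) simp
    then show ?case
      using cell_ge[of "int K + (nn + k)" S l] own_less_S[of tb] env w S_pos n_pos
      by (intro static_mem_agree[OF mem(1)]) auto
  next
    case (12 t' V' m')
    then have p: "agree_off {vR, vI} ?V V'" "agree_off Ans (m(?c := 0)) m'"
      "\<And>i. 0 \<le> i \<Longrightarrow> i < n \<Longrightarrow> m' (ab + i) = (if hit q a e k i then 1 else (m(?c := 0)) (ab + i))"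
      "t' \<le> s + 40 * (e - a) + 10" by auto
    have "agree_off {vR..vQ} V V'" using agree_off_trans[OF agV p(1)] by simp
    moreover have "agree_off (Ans \<union> {?c}) m m'"
    proof (rule agree_off_trans[OF _ p(2)])
      show "agree_off {?c} m (m(?c := 0))" by (intro agree_off_upd agree_off_refl) simp
    qed simp
    moreover have "m' ?c = 0"
    proof -
      have "?c \<notin> Ans" using own[of "?c - ab"] by auto
      then show ?thesis using agree_offD[OF p(2), of ?c] by simp
    qed
    ultimately show ?case unfolding Q_def using p(3,4) own that
      by (simp add: query_bit_def uniform_def F_def T_def straddles_def)
  qed (use ev env in simp_all)
  have D: "wp b (cond (EVar vF =\<^sub>e EVar vT)
      (store (mcell K (EVar vNN +\<^sub>e EVar vK)) (EVar vF =\<^sub>e EVar vQ))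
      (Seq (store (mcell K (EVar vNN +\<^sub>e EVar vK)) (EConst 0))
        (cond (EVar vQ <\<^sub>e EVar vF) Skip (cond (EVar vT <\<^sub>e EVar vQ) Skip scan)))) Q (32 + t) ?V m"
    by (intro wp_cond wp_Seq wp_store wp_Skip)
      (use A B C mc w in \<open>simp_all add: bit_word split: if_splits\<close>)
  show ?thesis unfolding Q_def[symmetric] feed_bucket_def
    using D ma me w vS env mem
    by (intro wp_Seq[of _ "assign _ _"] wp_assign) (simp_all add: matrix_entry_def split del: if_split)
qed

definition query_cells :: "int \<Rightarrow> int set" where
  "query_cells l = {x. \<exists>k. 0 \<le> k \<and> k < n \<and> x = cell S l (int K + (nn + k))}"

lemma query_cells_Lane: "query_cells l \<subseteq> Lane l"
proof
  fix x assume "x \<in> query_cells l"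
  then obtain k where "0 \<le> k" "x = cell S l (int K + (nn + k))" unfolding query_cells_def by auto
  then show "x \<in> Lane l" unfolding Lane_def using n_le_sq n_pos
    by (intro CollectI exI[of _ "int K + (nn + k)"]) simp
qed

definition straddle_count :: "(int \<Rightarrow> int) \<Rightarrow> int \<Rightarrow> int \<Rightarrow> int" where
  "straddle_count q a e = int (card {k. 0 \<le> k \<and> k < n \<and> straddles q a e k})"

text \<open>A scan takes at most 40 g + 10 \<le> 50 g steps. The number of scans is kept as
  \<open>straddle_count\<close> because a single level may need n of them; only their sum over all
  levels is small.\<close>

lemma wp_feed:
  assumes env: "static_env V" "V vA = a" "V vE = e" "0 \<le> a" "a < e" "e \<le> n" "e \<le> a + g"
    "V vL = l" "0 \<le> l" "l < S"
    and mem: "static_mem m" "\<And>k. 0 \<le> k \<Longrightarrow> k < n \<Longrightarrow> m (nn + k) = q k"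
  shows "wp b (feed K) (\<lambda>t' V' m'. agree_off {vK..vQ} V V' \<and>
    agree_off (Ans \<union> query_cells l) m m' \<and>
    (\<forall>k. 0 \<le> k \<and> k < n \<longrightarrow> m' (cell S l (int K + (nn + k))) = query_bit q a e k) \<and>
    (\<forall>i. 0 \<le> i \<and> i < n \<longrightarrow> m' (ab + i) =
      (if \<exists>k. 0 \<le> k \<and> k < n \<and> \<not> uniform a e k \<and> hit q a e k i then 1 else m (ab + i))) \<and>
    t' \<le> t + 100 * n + 5 + 50 * g * straddle_count q a e) t V m" (is "wp b _ ?Post _ _ _")
proof -
  define B where "B = (\<lambda>k. int (card {k'. 0 \<le> k' \<and> k' < k \<and> straddles q a e k'}))"
  define I where "I = (\<lambda>k t' V' m'. agree_off {vK..vQ} V V' \<and>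
    agree_off (Ans \<union> query_cells l) m m' \<and>
    (\<forall>j. 0 \<le> j \<and> j < k \<longrightarrow> m' (cell S l (int K + (nn + j))) = query_bit q a e j) \<and>
    (\<forall>i. 0 \<le> i \<and> i < n \<longrightarrow> m' (ab + i) =
      (if \<exists>j. 0 \<le> j \<and> j < k \<and> \<not> uniform a e j \<and> hit q a e j i then 1 else m (ab + i))) \<and>
    t' \<le> t + 1 + 100 * k + 50 * g * B k)"
  have vN: "V vN = n" using env(1) by (simp add: static_env_def)
  have Bs: "B (k + 1) = B k + of_bool (straddles q a e k)" if "0 \<le> k" for k
  proof -
    have "{k'. 0 \<le> k' \<and> k' < k + 1 \<and> straddles q a e k'} =
      {k'. 0 \<le> k' \<and> k' < k \<and> straddles q a e k'} \<union> (if straddles q a e k then {k} else {})"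
      using that by (auto simp: less_le)
    moreover have "finite {k'. 0 \<le> k' \<and> k' < k \<and> straddles q a e k'}"
      by (rule finite_subset[of _ "{0..<k}"]) auto
    ultimately show ?thesis unfolding B_def by simp
  qed
  have "wp b (for_below vK vN (feed_bucket K)) ?Post (t + 1) (V(vK := 0)) m"
  proof (rule wp_for_below[where I = I], goal_cases)
    case 8
    have "{k'. 0 \<le> k' \<and> k' < 0 \<and> straddles q a e k'} = {}" by auto
    then have "B 0 = 0" unfolding B_def by (metis card.empty of_nat_0)
    then show ?case unfolding I_def by (auto simp: agree_off_upd agree_off_refl)
  next
    case (9 k t' V' m')
    then have k: "0 \<le> k" "k < n" "V' vK = k" and Ik: "I k t' V' m'" using vN by simp_all
    have ag: "agree_off {vK..vQ} V V'" "agree_off (Ans \<union> query_cells l) m m'"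
      and qb: "\<And>j. 0 \<le> j \<Longrightarrow> j < k \<Longrightarrow> m' (cell S l (int K + (nn + j))) = query_bit q a e j"
      and an: "\<And>i. 0 \<le> i \<Longrightarrow> i < n \<Longrightarrow> m' (ab + i) =
        (if \<exists>j. 0 \<le> j \<and> j < k \<and> \<not> uniform a e j \<and> hit q a e j i then 1 else m (ab + i))"
      and tm: "t' \<le> t + 1 + 100 * k + 50 * g * B k"
      using Ik unfolding I_def by auto
    have ev: "static_env V'" "V' vA = a" "V' vE = e" "V' vL = l"
      using env agree_offD[OF ag(1)] unfolding static_env_def by simp_all
    have agL: "agree_off (Ans \<union> Lane l) m m'"
      using ag(2) query_cells_Lane unfolding agree_off_def by blast
    have st: "static_mem m'" by (rule static_mem_level[OF mem(1) agL env(9)])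
    have qk: "m' (nn + k) = q k"
    proof -
      have "nn + k \<notin> Ans \<union> Lane l" using own_notin_Lane[of "nn + k" l] k env n_le_sq by simp
      then show ?thesis using agree_offD[OF agL] mem(2) k by simp
    qed
    show ?case
    proof (rule wp_mono[OF wp_feed_bucket[where a = a and e = e and k = k and l = l and q = q]], goal_cases)
      case (15 s V'' m'')
      then have p: "agree_off {vR..vQ} V' V''"
        "agree_off (Ans \<union> {cell S l (int K + (nn + k))}) m' m''"
        "m'' (cell S l (int K + (nn + k))) = query_bit q a e k"
        "\<And>i. 0 \<le> i \<Longrightarrow> i < n \<Longrightarrow>
          m'' (ab + i) = (if \<not> uniform a e k \<and> hit q a e k i then 1 else m' (ab + i))"
        "s \<le> t' + 4 + 90 + (if straddles q a e k then 40 * (e - a) + 10 else 0)" by auto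
      have "agree_off {vK..vQ} V (V''(vK := k + 1))"
        using agree_off_trans[OF ag(1) p(1)] by (intro agree_off_upd) simp_all
      moreover have "agree_off (Ans \<union> query_cells l) m m''"
        by (rule agree_off_trans[OF ag(2) p(2)]) (use k in \<open>auto simp: query_cells_def\<close>)
      moreover have "m'' (cell S l (int K + (nn + j))) = query_bit q a e j"
        if "0 \<le> j" "j < k + 1" for j
      proof (cases "j = k")
        case False
        have "cell S l (int K + (nn + j)) \<notin> Ans \<union> {cell S l (int K + (nn + k))}"
          using cell_ge[of "int K + (nn + j)" S l] own_less_S[of "ab + n - 1"] that env S_pos n_le_sq n_pos False
          by (simp add: cell_eq_iff)
        then show ?thesis using agree_offD[OF p(2)] qb[of j] that False by simp
      qed (use p in simp)
      moreover have "m'' (ab + i) = (if \<exists>j. 0 \<le> j \<and> j < k + 1 \<and> \<not> uniform a e j \<and> hit q a e j i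
          then 1 else m (ab + i))" if "0 \<le> i" "i < n" for i
      proof -
        have "(\<exists>j. 0 \<le> j \<and> j < k + 1 \<and> \<not> uniform a e j \<and> hit q a e j i) \<longleftrightarrow>
          (\<exists>j. 0 \<le> j \<and> j < k \<and> \<not> uniform a e j \<and> hit q a e j i) \<or> (\<not> uniform a e k \<and> hit q a e k i)"
          using k by (auto simp: less_le)
        then show ?thesis using p(4) an that by auto
      qed
      moreover have "s + 3 \<le> t + 1 + 100 * (k + 1) + 50 * g * B (k + 1)"
        using tm p(5) Bs[OF k(1)] env by (cases "straddles q a e k") (simp_all add: algebra_simps)
      moreover have "V'' vK = k" "V'' vN = (V(vK := 0)) vN"
        using agree_offD[OF p(1)] k ev vN by (simp_all add: static_env_def)
      ultimately show ?case unfolding I_def by simp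
    qed (use ev env k st qk in simp_all)
  next
    case (10 t' V' m')
    then have "I n t' V' m'" using vN by simp
    then show ?case unfolding I_def B_def straddle_count_def by simp
  qed (use vN n_pos n_less_word b_pos in simp_all)
  then show ?thesis unfolding feed_def
    by (intro wp_Seq wp_assign) (simp_all add: const_word)
qed

lemma wp_collect:
  assumes env: "static_env V" "V vL = l" "0 \<le> l" "l < S"
    and mem: "lane l m s"
  shows "wp b (collect K) (\<lambda>t' V' m'. agree_off {vI} V V' \<and> agree_off Ans m m' \<and>
    (\<forall>i. 0 \<le> i \<and> i < n \<longrightarrow>
      m' (ab + i) = (if snd s (nat (ab + i)) \<noteq> 0 then 1 else m (ab + i))) \<and>
    t' \<le> t + 40 * n + 5) t V m" (is "wp b _ ?Post _ _ _")
proof -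
  define I where "I = (\<lambda>j t' V' m'. agree_off {vI} V V' \<and> agree_off Ans m m' \<and>
    (\<forall>i. 0 \<le> i \<and> i < n \<longrightarrow>
      m' (ab + i) = (if i < j \<and> snd s (nat (ab + i)) \<noteq> 0 then 1 else m (ab + i))) \<and>
    t' \<le> t + 1 + 40 * j)"
  have vN: "V vN = n" using env(1) by (simp add: static_env_def)
  have "wp b (for_below vI vN
    (cond (ELoad (mcell K (EVar vAB +\<^sub>e EVar vI))) (store (EVar vAB +\<^sub>e EVar vI) (EConst 1)) Skip))
    ?Post (t + 1) (V(vI := 0)) m"
  proof (rule wp_for_below[where I = I], goal_cases)
    case 8
    show ?case unfolding I_def by (simp add: agree_off_upd agree_off_refl)
  next
    case (9 i t' V' m')
    then have i: "0 \<le> i" "i < n" "V' vI = i" and Ii: "I i t' V' m'" using vN by simp_all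
    have ag: "agree_off {vI} V V'" "agree_off Ans m m'"
      and an: "\<And>j. 0 \<le> j \<Longrightarrow> j < n \<Longrightarrow>
        m' (ab + j) = (if j < i \<and> snd s (nat (ab + j)) \<noteq> 0 then 1 else m (ab + j))"
      and tm: "t' \<le> t + 1 + 40 * i"
      using Ii unfolding I_def by auto
    have ev: "V' vAB = ab" "V' vS = S" "V' vL = l" "V' vN = n"
      using env agree_offD[OF ag(1)] unfolding static_env_def by simp_all
    let ?x = "cell S l (int K + (ab + i))"
    have w: "ab + i \<in> words b" "0 \<le> ab + i" "1 \<in> words b"
      using i n_le_sq n_pos by (auto intro!: small_word)
    have mc: "safe b (mcell K (EVar vAB +\<^sub>e EVar vI)) V' m'"
      "val (mcell K (EVar vAB +\<^sub>e EVar vI)) V' m' = ?x" "0 \<le> ?x"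
      "cost (mcell K (EVar vAB +\<^sub>e EVar vI)) = 9"
      using safe_mcell_int[of "EVar vAB +\<^sub>e EVar vI" V' m' "ab + i" l] ev env w i
      by (simp_all add: mcell_def)
    have "?x \<notin> Ans"
      using cell_ge[of "int K + (ab + i)" S l] own_less_S[of "ab + n - 1"] env S_pos w n_le_sq n_pos by simp
    then have "m' ?x = m ?x" using agree_offD[OF ag(2)] by blast
    also have "\<dots> = snd s (nat (ab + i))" using lane_mem[OF mem, of "nat (ab + i)"] w by simp
    finally have ld: "m' ?x = snd s (nat (ab + i))" .
    define Q where "Q = (\<lambda>t' V' m'. V' vI = i \<and> V' vN = (V(vI := 0)) vN \<and>
      I (i + 1) (t' + 3) (V'(vI := i + 1)) m')"
    have agV: "agree_off {vI} V (V'(vI := i + 1))" by (intro agree_off_upd ag) simp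
    have 1: "Q u V' (m'(ab + i := 1))" if "snd s (nat (ab + i)) \<noteq> 0" "u \<le> t' + 30" for u
    proof -
      have "agree_off Ans m (m'(ab + i := 1))" using i by (intro agree_off_upd ag) simp
      then show ?thesis unfolding Q_def I_def using agV an that tm i ev vN by auto
    qed
    have 2: "Q u V' m'" if "snd s (nat (ab + i)) = 0" "u \<le> t' + 30" for u
    proof -
      have "j < i + 1 \<and> snd s (nat (ab + j)) \<noteq> 0 \<longleftrightarrow> j < i \<and> snd s (nat (ab + j)) \<noteq> 0" for j
        using that(1) by (cases "j = i") auto
      then show ?thesis unfolding Q_def I_def using agV ag an that tm i ev vN by simp
    qed
    show ?case unfolding Q_def[symmetric]
      by (intro wp_cond wp_store wp_Skip) (use mc ev i w 1 2 ld in simp_all)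
  next
    case (10 t' V' m')
    then have "I n t' V' m'" using vN by simp
    then show ?case unfolding I_def by simp
  qed (use vN n_pos n_less_word b_pos in simp_all)
  then show ?thesis unfolding collect_def
    by (intro wp_Seq wp_assign) (simp_all add: const_word)
qed

section \<open>Correctness of one level: scans combined with the Boolean answer\<close>

definition bucket_matrix :: "int \<Rightarrow> int \<Rightarrow> int mat" where
  "bucket_matrix a e =
    mat N N (\<lambda>(i, k). of_bool (\<exists>r. a \<le> r \<and> r < e \<and> \<sigma> (int k) r = int i))"

definition query_vec :: "(int \<Rightarrow> int) \<Rightarrow> int \<Rightarrow> int \<Rightarrow> int vec" where
  "query_vec q a e = vec N (\<lambda>k. query_bit q a e (int k))"

lemma int_N: "int N = n" "int (N * N) = nn"
  using n_pos by (simp_all add: nn_def)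

lemma bits_b0: "(0::int) \<in> words b0" "(1::int) \<in> words b0" "n \<in> words b0"
  using addr_fits n_le_sq n_pos by (auto intro!: in_words_nonneg)

text \<open>The model places a query vector into memory by itself; for a simulated instance the
  program has to write it, bit by bit. Both lead to the same simulated state.\<close>

lemma lane_put_query:
  assumes "lane l m s" "0 \<le> l" "l < S" "agree_off (Ans \<union> query_cells l) m m'"
    and "\<And>k. 0 \<le> k \<Longrightarrow> k < n \<Longrightarrow> m' (cell S l (int K + (nn + k))) = query_bit q a e k"
  shows "lane l m' (put_query N (query_vec q a e) s)"
proof -
  have off: "m' (cell S l v) = m (cell S l v)" if "0 \<le> v" "\<not> (int K + nn \<le> v \<and> v < int K + nn + n)" for v
  proof (rule agree_offD[OF assms(4)])
    have "cell S l v \<notin> Ans"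
      using cell_ge[of v S l] own_less_S[of "ab + n - 1"] that assms S_pos n_le_sq n_pos by simp
    moreover have "cell S l v \<notin> query_cells l"
      using that assms(2,3) by (auto simp: query_cells_def cell_eq_iff)
    ultimately show "cell S l v \<notin> Ans \<union> query_cells l" by simp
  qed
  have "m' (cell S l (int K + int x)) = snd (put_query N (query_vec q a e) s) x \<and>
    snd (put_query N (query_vec q a e) s) x \<in> words b0" for x
  proof (cases "x \<in> {N * N..<N * N + N}")
    case True
    then have "int (N * N) \<le> int x" "int x < int (N * N + N)"
      by (simp_all only: of_nat_le_iff of_nat_less_iff atLeastLessThan_iff)
    then have "nn \<le> int x" "int x < nn + n" unfolding of_nat_add int_N .
    moreover have "x - N * N < N" using True by auto
    moreover have "int (x - N * N) = int x - nn"
      using True int_N(2) by (simp only: of_nat_diff atLeastLessThan_iff)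
    ultimately show ?thesis using assms(5)[of "int x - nn"] True bits_b0
      by (simp add: put_query_def query_vec_def query_bit_def)
  next
    case False
    then have "\<not> (int (N * N) \<le> int x \<and> int x < int (N * N + N))"
      by (simp only: of_nat_le_iff of_nat_less_iff atLeastLessThan_iff not_False_eq_True)
    then have "\<not> (nn \<le> int x \<and> int x < nn + n)" unfolding of_nat_add int_N .
    then show ?thesis using off[of "int K + int x"] lane_mem[OF assms(1), of x] False
      by (auto simp: put_query_def)
  qed
  moreover have "m' (cell S l (int r)) = fst s r \<and> fst s r \<in> words b0" if "r < K" for r
    using off[of "int r"] lane_reg[OF assms(1) that] that n_le_sq n_pos by simp
  ultimately show ?thesis unfolding lane_def by (simp add: put_query_def)
qed

text \<open>Inside a uniform bucket every entry is squeezed to the same value. So the row's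
  membership in the bucket and the match with the query become two separate conditions, a matrix bit
  and a vector bit, as a Boolean product needs.\<close>

lemma uniform_hit:
  assumes "0 \<le> k" "k < n" "0 \<le> a" "e \<le> n"
  shows "uniform a e k \<and> hit q a e k i \<longleftrightarrow>
    query_bit q a e k = 1 \<and> (\<exists>r. a \<le> r \<and> r < e \<and> \<sigma> k r = i)"
proof -
  have "M (\<sigma> k r) k = M (\<sigma> k a) k" if "uniform a e k" "a \<le> r" "r < e" for r
    using perm_sorted[of k a r] perm_sorted[of k r "e - 1"] that assms by (simp add: uniform_def)
  then have "hit q a e k i \<longleftrightarrow> M (\<sigma> k a) k = q k \<and> (\<exists>r. a \<le> r \<and> r < e \<and> \<sigma> k r = i)"
    if "uniform a e k" unfolding hit_def using that by metis
  then show ?thesis by (cases "uniform a e k") (simp_all add: query_bit_def)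
qed

lemma boolean_answer_bucket:
  assumes "read_answer N s' = boolean_answer (bucket_matrix a e) (query_vec q a e)"
    and "0 \<le> i" "i < n" "0 \<le> a" "e \<le> n"
  shows "snd s' (nat (ab + i)) \<noteq> 0 \<longleftrightarrow> (\<exists>k. 0 \<le> k \<and> k < n \<and> uniform a e k \<and> hit q a e k i)"
proof -
  have i: "nat i < N" "nat (ab + i) = N * N + N + nat i"
    using assms(2,3) int_N n_pos by (simp_all add: nat_add_distrib nn_def nat_mult_distrib)
  have "snd s' (nat (ab + i)) = read_answer N s' $ nat i"
    using i by (simp add: read_answer_def)
  also have "\<dots> = (if \<exists>k < N. (\<exists>r. a \<le> r \<and> r < e \<and> \<sigma> (int k) r = i) \<and> query_bit q a e (int k) = 1
      then 1 else 0)"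
    unfolding assms(1) boolean_answer_def using i(1) assms(2)
    by (simp add: bucket_matrix_def query_vec_def cong: conj_cong)
  finally have "snd s' (nat (ab + i)) \<noteq> 0 \<longleftrightarrow>
    (\<exists>k < N. (\<exists>r. a \<le> r \<and> r < e \<and> \<sigma> (int k) r = i) \<and> query_bit q a e (int k) = 1)" by simp
  also have "\<dots> \<longleftrightarrow> (\<exists>k < N. uniform a e (int k) \<and> hit q a e (int k) i)"
    using uniform_hit assms(4,5) by (metis int_N(1) of_nat_0_le_iff of_nat_less_iff)
  also have "\<dots> \<longleftrightarrow> (\<exists>k. 0 \<le> k \<and> k < n \<and> uniform a e k \<and> hit q a e k i)"
    by (metis int_N(1) nat_0_le of_nat_0_le_iff of_nat_less_iff)
  finally show ?thesis .
qed

lemma wp_query_level: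
  assumes env: "static_env V" "V vA = a" "V vG = g" "0 \<le> a" "a < n" "1 \<le> g" "n + g \<le> S"
    "V vL = l" "0 \<le> l" "l < S" "0 \<le> V vC" "V vC + int u + n < 2 ^ b"
    and e: "e = min (a + g) n"
    and mem: "static_mem m" "\<And>k. 0 \<le> k \<Longrightarrow> k < n \<Longrightarrow> m (nn + k) = q k" "lane l m s"
    and ex: "exec b0 p (put_query N (query_vec q a e) s) u s'" "regs_below K p"
    and ra: "read_answer N s' = boolean_answer (bucket_matrix a e) (query_vec q a e)"
  shows "wp b (query_level K p) (\<lambda>t' V' m'. agree_off {vC, vE, vK, vR, vX, vI, vF, vT, vQ} V V' \<and>
    V' vC = V vC + int u + n \<and> agree_off (Ans \<union> Lane l) m m' \<and> lane l m' s' \<and>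
    (\<forall>i. 0 \<le> i \<and> i < n \<longrightarrow> m' (ab + i) =
      (if \<exists>k. 0 \<le> k \<and> k < n \<and> hit q a e k i then 1 else m (ab + i))) \<and>
    t' \<le> t + 22 * int u + 200 * n + 50 * g * straddle_count q a e) t V m"
proof -
  let ?X = "{vC, vE, vK, vR, vX, vI, vF, vT, vQ}"
  define Q where "Q = (\<lambda>t' V' m'. agree_off ?X V V' \<and>
    V' vC = V vC + int u + n \<and> agree_off (Ans \<union> Lane l) m m' \<and> lane l m' s' \<and>
    (\<forall>i. 0 \<le> i \<and> i < n \<longrightarrow> m' (ab + i) =
      (if \<exists>k. 0 \<le> k \<and> k < n \<and> hit q a e k i then 1 else m (ab + i))) \<and>
    t' \<le> t + 22 * int u + 200 * n + 50 * g * straddle_count q a e)"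
  have eb: "a < e" "e \<le> n" "e \<le> a + g" using env e by simp_all
  have X: "{vK..vQ} \<subseteq> ?X" by auto
  have "wp b (Seq (feed K) (Seq (sim K p) (Seq (collect K) (assign vC (EVar vC +\<^sub>e EVar vN))))) Q
      t1 (V(vE := e)) m" if t1: "t1 \<le> t + 10" for t1
  proof (rule wp_Seq, rule wp_mono[OF wp_feed[where a = a and e = e and l = l and q = q and g = g]], goal_cases)
    case (13 t2 V2 m2)
    then have 2: "agree_off {vK..vQ} (V(vE := e)) V2" "agree_off (Ans \<union> query_cells l) m m2"
      "\<And>k. 0 \<le> k \<Longrightarrow> k < n \<Longrightarrow> m2 (cell S l (int K + (nn + k))) = query_bit q a e k"
      "\<And>i. 0 \<le> i \<Longrightarrow> i < n \<Longrightarrow> m2 (ab + i) =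
        (if \<exists>k. 0 \<le> k \<and> k < n \<and> \<not> uniform a e k \<and> hit q a e k i then 1 else m (ab + i))"
      "t2 \<le> t1 + 100 * n + 5 + 50 * g * straddle_count q a e" by auto
    have ln: "lane l m2 (put_query N (query_vec q a e) s)"
      by (rule lane_put_query[OF mem(3) env(9,10) 2(2,3)])
    have V2: "V2 vS = S" "V2 vL = l" "V2 vC = V vC"
      using agree_offD[OF 2(1)] env by (simp_all add: static_env_def)
    show ?case
    proof (rule wp_Seq, rule wp_sim[where l = l, OF ex ln], goal_cases)
      case (7 t3 m3)
      let ?V3 = "V2(vC := V2 vC + int u)"
      have ag3: "agree_off (Lane l) m2 m3" using 7(2) by (simp add: off_lane_iff)
      have ev3: "static_env ?V3" "?V3 vL = l" "?V3 vN = n"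
        using agree_offD[OF 2(1)] env by (simp_all add: static_env_def)
      show ?case
      proof (rule wp_Seq, rule wp_mono[OF wp_collect[where l = l and s = s']], goal_cases)
        case (6 t4 V4 m4)
        then have 4: "agree_off {vI} ?V3 V4" "agree_off Ans m3 m4"
          "\<And>i. 0 \<le> i \<Longrightarrow> i < n \<Longrightarrow>
            m4 (ab + i) = (if snd s' (nat (ab + i)) \<noteq> 0 then 1 else m3 (ab + i))"
          "t4 \<le> t3 + 40 * n + 5" by auto
        have V4: "V4 vC = V vC + int u" "V4 vN = n"
          using agree_offD[OF 4(1)] V2 ev3(3) by simp_all
        have "agree_off ?X V (V(vE := e))" by (intro agree_off_upd agree_off_refl) simp
        from agree_off_trans[OF this 2(1), of ?X] X have "agree_off ?X V V2" by auto
        then have "agree_off ?X V ?V3" by (intro agree_off_upd) simp_all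
        from agree_off_trans[OF this 4(1), of ?X] have "agree_off ?X V V4" by auto
        then have agV: "agree_off ?X V (V4(vC := V4 vC + n))" by (intro agree_off_upd) simp_all
        have agm: "agree_off (Ans \<union> Lane l) m m4"
        proof (rule agree_off_trans[OF 2(2) agree_off_trans[OF ag3 4(2) order_refl]])
          show "Ans \<union> query_cells l \<union> (Lane l \<union> Ans) \<subseteq> Ans \<union> Lane l"
            using query_cells_Lane by auto
        qed
        have ln4: "lane l m4 s'"
        proof (rule lane_cong[OF 7(1)])
          fix v :: int assume "0 \<le> v"
          then have "cell S l v \<notin> Ans"
            using cell_ge[of v S l] own_less_S[of "ab + n - 1"] env S_pos n_le_sq n_pos by simp
          then show "m4 (cell S l v) = m3 (cell S l v)" using agree_offD[OF 4(2)] by blast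
        qed
        \<comment> \<open>Hits in non-uniform buckets come from the scans, hits in uniform ones from
          the Boolean answer.\<close>
        have an: "m4 (ab + i) = (if \<exists>k. 0 \<le> k \<and> k < n \<and> hit q a e k i then 1 else m (ab + i))"
          if i: "0 \<le> i" "i < n" for i
        proof -
          have "ab + i \<notin> Lane l" using own_notin_Lane[of "ab + i" l] i env n_le_sq by simp
          then have "m3 (ab + i) = m2 (ab + i)" using agree_offD[OF ag3] by blast
          then show ?thesis
            using 4(3)[OF i] 2(4)[OF i] boolean_answer_bucket[OF ra i env(4) eb(2)] by auto
        qed
        have tm: "t4 + 3 \<le> t + 22 * int u + 200 * n + 50 * g * straddle_count q a e"
          using 4(4) 7(3) 2(5) t1 n_pos by simp
        have w: "V4 vC + V4 vN \<in> words b"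
          using V4 env n_pos by (intro in_words_nonneg) simp_all
        show ?case
          by (intro wp_assign) (use w V4 agV agm ln4 an tm in \<open>simp_all add: Q_def\<close>)
      qed (use ev3 env 7 in simp_all)
    qed (use V2 env n_pos in simp_all)
  qed (use env eb mem in \<open>simp_all add: static_env_def\<close>)
  then show ?thesis unfolding Q_def[symmetric] query_level_def
    using env e
    by (intro wp_Seq[of _ set_end] wp_set_end[where a = a and g = g]) simp_all
qed

section \<open>Loading the Boolean matrix of one level\<close>

definition loaded :: "int \<Rightarrow> int set \<Rightarrow> imem \<Rightarrow> bool" where
  "loaded l T m \<longleftrightarrow> (\<forall>v\<ge>0. m (cell S l v) = of_bool (v - int K \<in> T))"

definition bucket_cells :: "int \<Rightarrow> int \<Rightarrow> int set" where
  "bucket_cells a e = {x. \<exists>k r. 0 \<le> k \<and> k < n \<and> a \<le> r \<and> r < e \<and> x = \<sigma> k r * n + k}"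

lemma loaded_init_state:
  assumes "loaded l (bucket_cells a e) m" "0 \<le> a" "e \<le> n" "0 \<le> l" "l < S"
  shows "lane l (m(cell S l 0 := n)) (init_state N (bucket_matrix a e))"
proof -
  have rng: "0 \<le> x \<and> x < nn" if x: "x \<in> bucket_cells a e" for x
  proof -
    obtain k r where kr: "0 \<le> k" "k < n" "a \<le> r" "r < e" "x = \<sigma> k r * n + k"
      using x unfolding bucket_cells_def by auto
    then show ?thesis using index_bound[of "\<sigma> k r" k] perm_range[of k r] assms by simp
  qed
  have "m (cell S l (int K + int x)) = snd (init_state N (bucket_matrix a e)) x \<and>
    snd (init_state N (bucket_matrix a e)) x \<in> words b0" for x
  proof (cases "x < N * N")
    case True
    then have N: "0 < N" by (cases N) auto
    have i: "x div N < N" "x mod N < N" using True N by (simp_all add: less_mult_imp_div_less)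
    have xe: "int x = int (x div N) * n + int (x mod N)"
      using int_N(1) by (metis div_mult_mod_eq of_nat_add of_nat_mult)
    have "int x \<in> bucket_cells a e \<longleftrightarrow>
      (\<exists>r. a \<le> r \<and> r < e \<and> \<sigma> (int (x mod N)) r = int (x div N))"
    proof
      assume "int x \<in> bucket_cells a e"
      then obtain k r where kr: "0 \<le> k" "k < n" "a \<le> r" "r < e" "int x = \<sigma> k r * n + k"
        unfolding bucket_cells_def by auto
      then have "\<sigma> k r = int (x div N) \<and> k = int (x mod N)"
        using index_inj[of k "int (x mod N)" "\<sigma> k r" "int (x div N)"] xe i int_N(1) by simp
      then show "\<exists>r. a \<le> r \<and> r < e \<and> \<sigma> (int (x mod N)) r = int (x div N)" using kr by auto
    next
      assume "\<exists>r. a \<le> r \<and> r < e \<and> \<sigma> (int (x mod N)) r = int (x div N)"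
      then obtain r where "a \<le> r" "r < e" "\<sigma> (int (x mod N)) r = int (x div N)" by blast
      moreover have "int (x mod N) < n" using i(2) int_N(1) by linarith
      ultimately have "0 \<le> int (x mod N) \<and> int (x mod N) < n \<and> a \<le> r \<and> r < e \<and>
        int x = \<sigma> (int (x mod N)) r * n + int (x mod N)"
        using xe by (simp only: of_nat_0_le_iff simp_thms)
      then show "int x \<in> bucket_cells a e" unfolding bucket_cells_def by blast
    qed
    then show ?thesis using assms(1) True i bits_b0
      by (simp add: loaded_def init_state_def bucket_matrix_def)
  next
    case False
    then have "int (N * N) \<le> int x" by (simp only: of_nat_le_iff not_less)
    then have "int x \<notin> bucket_cells a e" using rng[of "int x"] unfolding int_N(2) by auto
    then show ?thesis using assms(1) False bits_b0 by (simp add: loaded_def init_state_def)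
  qed
  moreover have "m (cell S l (int r)) = 0" if "r < K" for r
  proof -
    have "int r - int K \<notin> bucket_cells a e" using rng[of "int r - int K"] that by auto
    then show ?thesis using assms(1) by (simp add: loaded_def)
  qed
  moreover have "cell S l (int K + int x) \<noteq> cell S l 0" "cell S l (int r) = cell S l 0 \<longleftrightarrow> r = 0" for x r
    using K_pos assms by (simp_all add: cell_eq_iff)
  ultimately show ?thesis
    unfolding lane_def using bits_b0 int_N by (auto simp: init_state_def)
qed

text \<open>Only ones are written, at most g in each column, since an untouched lane already holds
  the zeros. Thus a level costs O(g n) instead of n^2 steps, and all n / g levels together take
  O(n^2) when g \<le> n.\<close>

lemma wp_load_level:
  assumes env: "static_env V" "V vA = a" "V vG = g" "0 \<le> a" "a < n" "1 \<le> g" "n + g \<le> S"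
    "V vL = l" "0 \<le> l" "l < S"
    and e: "e = min (a + g) n"
    and mem: "static_mem m" "\<And>v. 0 \<le> v \<Longrightarrow> m (cell S l v) = 0"
  shows "wp b (load_level K) (\<lambda>t' V' m'. agree_off {vE, vR, vK} V V' \<and>
    agree_off (Lane l) m m' \<and> lane l m' (init_state N (bucket_matrix a e)) \<and>
    t' \<le> t + 80 * (g * n)) t V m" (is "wp b _ ?Post _ _ _")
proof -
  let ?pa = "for_below vK vN (store (mcell K (perm_entry (EVar vR) *\<^sub>e EVar vN +\<^sub>e EVar vK))
    (EConst 1))"
  define Q where "Q = ?Post"
  define I where "I = (\<lambda>r t' V' m'. agree_off {vE, vR, vK} V V' \<and> V' vE = e \<and>
    agree_off (Lane l) m m' \<and> loaded l (bucket_cells a r) m' \<and>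
    t' \<le> t + 13 + (r - a) * (35 * n + 20))"
  define J where "J = (\<lambda>r t0 k t' V' m'. agree_off {vE, vR, vK} V V' \<and> V' vE = e \<and> V' vR = r \<and>
    agree_off (Lane l) m m' \<and>
    loaded l (bucket_cells a r \<union> {x. \<exists>k'. 0 \<le> k' \<and> k' < k \<and> x = \<sigma> k' r * n + k'}) m' \<and>
    t' \<le> t0 + 35 * k)"
  have eb: "a < e" "e \<le> n" "e \<le> a + g" using env e by simp_all
  have w: "(0::int) \<in> words b" "(1::int) \<in> words b" "a \<in> words b"
    using env n_le_sq n_pos by (auto intro!: small_word)
  have fr: "V' vN = n \<and> static_env V' \<and> V' vL = l" if "agree_off {vE, vR, vK} V V'" for V'
    using agree_offD[OF that] env by (simp add: static_env_def)
  have stm: "static_mem m'" if "agree_off (Lane l) m m'" for m'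
  proof (rule static_mem_level[OF mem(1) _ env(9)])
    show "agree_off (Ans \<union> Lane l) m m'" using that by (auto simp: agree_off_def)
  qed
  have inner: "wp b ?pa
      (\<lambda>t' V' m'. J r t0 n (t' - 4) V' m') t0 V1 m1"
    if pre: "J r t0 0 t0 V1 m1" "V1 vK = 0" "a \<le> r" "r < e" for r t0 V1 m1
  proof (rule wp_for_below[where I = "J r t0"], goal_cases)
    case (9 k t' V' m')
    have ag: "agree_off {vE, vR, vK} V V'" "V' vE = e" "V' vR = r" "agree_off (Lane l) m m'"
      and ld: "loaded l (bucket_cells a r \<union> {x. \<exists>k'. 0 \<le> k' \<and> k' < k \<and> x = \<sigma> k' r * n + k'}) m'"
      and tm: "t' \<le> t0 + 35 * k"
      using 9(5) unfolding J_def by auto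
    have vN: "V1 vN = n" using fr[of V1] pre(1) unfolding J_def by simp
    then have k: "0 \<le> k" "k < n" "V' vK = k" using 9 pre(2) by simp_all
    have ev: "V' vN = n" "static_env V'" "V' vL = l" "V' vS = S"
      using fr[OF ag(1)] by (simp_all add: static_env_def)
    have rb: "0 \<le> r" "r < n" using pre eb env by simp_all
    let ?x = "\<sigma> k r * n + k"
    have i: "0 \<le> \<sigma> k r" "\<sigma> k r < n" using perm_range k rb by simp_all
    have x: "0 \<le> ?x" "?x < nn" "\<sigma> k r * n \<in> words b" "?x \<in> words b"
      using index_bound[OF i k(1,2)] k n_pos n_le_sq by (auto intro!: small_word)
    have sp: "safe b (perm_entry (EVar vR)) V' m'" "val (perm_entry (EVar vR)) V' m' = \<sigma> k r"
      "cost (perm_entry (EVar vR)) = 8"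
      using safe_perm_entry[of V' m' k "EVar vR" r] ev stm[OF ag(4)] k rb ag by simp_all
    have mc: "safe b (mcell K (perm_entry (EVar vR) *\<^sub>e EVar vN +\<^sub>e EVar vK)) V' m'"
      "val (mcell K (perm_entry (EVar vR) *\<^sub>e EVar vN +\<^sub>e EVar vK)) V' m' = cell S l (int K + ?x)"
      "0 \<le> cell S l (int K + ?x)"
      "cost (mcell K (perm_entry (EVar vR) *\<^sub>e EVar vN +\<^sub>e EVar vK)) = 18"
      using safe_mcell_int[of "perm_entry (EVar vR) *\<^sub>e EVar vN +\<^sub>e EVar vK" V' m' ?x l] sp ev x k env n_pos
      by (simp_all add: mcell_def)
    let ?m = "m'(cell S l (int K + ?x) := 1)"
    have "cell S l (int K + ?x) \<in> Lane l" unfolding Lane_def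
      using x by (intro CollectI exI[of _ "int K + ?x"]) simp
    then have agm: "agree_off (Lane l) m ?m" by (intro agree_off_upd ag)
    have "loaded l (insert ?x T) ?m" if "loaded l T m'" for T
      using that env(9,10) unfolding loaded_def by (simp add: cell_eq_iff)
    note ld' = this[OF ld]
    have T: "insert ?x (bucket_cells a r \<union> {x. \<exists>k'. 0 \<le> k' \<and> k' < k \<and> x = \<sigma> k' r * n + k'}) =
        bucket_cells a r \<union> {x. \<exists>k'. 0 \<le> k' \<and> k' < k + 1 \<and> x = \<sigma> k' r * n + k'}"
      using k by (auto simp: less_le)
    have agV: "agree_off {vE, vR, vK} V (V'(vK := k + 1))" by (intro agree_off_upd ag) simp
    have "V' vK = k \<and> V' vN = V1 vN \<and> J r t0 (k + 1) (t' + 24 + 3) (V'(vK := k + 1)) ?m"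
      unfolding J_def using agV agm ld'[unfolded T] tm ag k ev vN by simp
    then show ?case
      by (intro wp_store) (use mc w in \<open>simp_all add: add.commute\<close>)
  next
    case (10 t' V' m')
    then show ?case using fr[of V1] pre(1) unfolding J_def by simp
  qed (use pre fr[of V1] n_pos n_less_word b_pos in \<open>simp_all add: J_def\<close>)
  have outer: "wp b (for_below vR vE (Seq (assign vK (EConst 0))
       ?pa))
      (\<lambda>t V m. wp b (store (rcell 0) (EVar vN)) Q t V m) t1 (V(vE := e, vR := a)) m"
    if t1: "t1 \<le> t + 13" for t1
  proof (rule wp_for_below[where I = I], goal_cases)
    case 8
    have "bucket_cells a a = {}" unfolding bucket_cells_def by auto
    then have "loaded l (bucket_cells a a) m" using mem(2) unfolding loaded_def by simp
    moreover have "agree_off {vE, vR, vK} V (V(vE := e, vR := a))"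
      by (intro agree_off_upd agree_off_refl) simp_all
    ultimately show ?case using t1 by (simp add: I_def agree_off_refl)
  next
    case (9 r t' V' m')
    then have r: "a \<le> r" "r < e" "V' vR = r" and Ir: "I r t' V' m'" by simp_all
    have "bucket_cells a r \<union> {x. \<exists>k'. 0 \<le> k' \<and> k' < n \<and> x = \<sigma> k' r * n + k'} = bucket_cells a (r + 1)"
    proof -
      have "r' < r + 1 \<longleftrightarrow> r' < r \<or> r' = r" for r' by auto
      then show ?thesis using r(1) unfolding bucket_cells_def by blast
    qed
    note T = this
    have "bucket_cells a r \<union> {x. \<exists>k'. 0 \<le> k' \<and> k' < 0 \<and> x = \<sigma> k' r * n + k'} = bucket_cells a r"
      by auto
    moreover have "agree_off {vE, vR, vK} V (V'(vK := 0))"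
      using Ir unfolding I_def by (intro agree_off_upd) simp_all
    ultimately have "J r (t' + 5) 0 (t' + 5) (V'(vK := 0)) m'"
      using Ir r unfolding J_def I_def by (simp only: fun_upd_apply) simp
    from inner[OF this _ r(1,2)]
    have "wp b ?pa
      (\<lambda>s V'' m''. V'' vR = r \<and> V'' vE = (V(vE := e, vR := a)) vE \<and>
         I (r + 1) (s + 3) (V''(vR := r + 1)) m'') (t' + 5) (V'(vK := 0)) m'"
    proof (rule wp_mono, goal_cases)
      case 1
      then show ?case by simp
    next
      case (2 s V'' m'')
      then have p: "agree_off {vE, vR, vK} V V''" "V'' vE = e" "V'' vR = r" "agree_off (Lane l) m m''"
        "loaded l (bucket_cells a (r + 1)) m''" "s - 4 \<le> t' + 5 + 35 * n"
        unfolding J_def T by auto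
      have "agree_off {vE, vR, vK} V (V''(vR := r + 1))" by (intro agree_off_upd p) simp
      moreover have "s + 3 \<le> t + 13 + (r + 1 - a) * (35 * n + 20)"
        using p(6) Ir unfolding I_def by (simp add: algebra_simps)
      ultimately show ?case unfolding I_def using p by simp
    qed
    then show ?case
      by (intro wp_Seq wp_assign) (use w in \<open>simp_all add: add.commute\<close>)
  next
    case (10 t' V' m')
    then have p: "agree_off {vE, vR, vK} V V'" "agree_off (Lane l) m m'"
      "loaded l (bucket_cells a e) m'" "t' \<le> t + 13 + (e - a) * (35 * n + 20)"
      unfolding I_def by auto
    have ev: "V' vN = n" "V' vL = l" "V' vS = S"
      using fr[OF p(1)] by (simp_all add: static_env_def)
    have rc: "safe b (rcell 0) V' m'" "val (rcell 0) V' m' = cell S l 0" "cost (rcell 0) = 5"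
      using safe_rcell(1,2)[of 0 V' l m'] K_pos ev env by (simp_all add: rcell_def)
    have c0: "0 \<le> cell S l 0" "cell S l 0 \<in> Lane l"
      using cell_ge[of 0 S l] env S_pos unfolding Lane_def by auto
    \<comment> \<open>The last bucket may be shorter than g, so its length is only bounded by g; 20
      g is absorbed by g n.\<close>
    have "(e - a) * (35 * n + 20) \<le> g * (35 * n + 20)" using eb n_pos by (intro mult_right_mono) simp_all
    moreover have "g \<le> g * n" using env(6) n_pos mult_left_mono[of 1 n g] by simp
    moreover have "g * (35 * n + 20) = 35 * (g * n) + 20 * g" by (simp add: algebra_simps)
    ultimately have tm: "t' + 11 \<le> t + 80 * (g * n)" using p(4) env(6) by linarith
    have "Q (t' + 11) V' (m'(cell S l 0 := n))"
      unfolding Q_def using p(1) tm agree_off_upd[OF p(2) c0(2)]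
        loaded_init_state[OF p(3) env(4) eb(2) env(9,10)] by simp
    then show ?case
      by (intro wp_store) (use rc ev c0 in \<open>simp_all add: add.commute\<close>)
  qed (use env eb n_pos n_less_word b_pos in simp_all)
  have "wp b (Seq (assign vR (EVar vA +\<^sub>e EConst 0))
    (Seq (for_below vR vE (Seq (assign vK (EConst 0))
       ?pa))
      (store (rcell 0) (EVar vN)))) Q t1 (V(vE := e)) m" if "t1 \<le> t + 10" for t1
    by (intro wp_Seq[of _ "assign vR _"] wp_Seq[of _ "for_below vR _ _"] wp_assign)
      (use outer that env w in simp_all)
  then show ?thesis unfolding Q_def[symmetric] load_level_def
    using env e
    by (intro wp_Seq[of _ set_end] wp_set_end[where a = a and g = g]) simp_all
qed

end

section \<open>Phases of doubling bucket size\<close>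

definition levels_left :: exp where
  "levels_left = (EVar vA <\<^sub>e EVar vN) *\<^sub>e (EVar vC <\<^sub>e EVar vG *\<^sub>e EVar vNN)"

definition next_level :: com where
  "next_level = Seq (assign vA (EVar vA +\<^sub>e EVar vG)) (assign vL (EVar vL +\<^sub>e EConst 1))"

text \<open>The lanes of the phase with bucket size g start at n * g. A phase has at most n levels,
  and n * g + n \<le> 2 * n * g, so the phase with size 2 g starts behind them in untouched memory,
  without any allocator state.\<close>

definition build :: "nat \<Rightarrow> com \<Rightarrow> com" where
  "build K p = Seq (assign vC (EConst 0)) (Seq (assign vL (EVar vN *\<^sub>e EVar vG))
    (Seq (assign vA (EConst 0)) (loop levels_left
      (Seq (load_level K) (Seq (sim K p) next_level)))))"

definition clear_answer :: com where
  "clear_answer = Seq (assign vI (EConst 0))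
    (for_below vI vN (store (EVar vAB +\<^sub>e EVar vI) (EConst 0)))"

definition brute_force :: com where
  "brute_force = Seq (assign vI (EConst 0))
    (for_below vI vN
      (Seq (store (EVar vAB +\<^sub>e EVar vI) (EConst 0)) (Seq (assign vK (EConst 0))
        (for_below vK vN
          (cond (matrix_entry (EVar vI) =\<^sub>e ELoad (EVar vNN +\<^sub>e EVar vK))
            (store (EVar vAB +\<^sub>e EVar vI) (EConst 1)) Skip)))))"

text \<open>Leaving the loop with levels still open means that the count has reached its limit,
  possibly already during \<open>build\<close>, in which case the loop is not entered.
  \<open>brute_force\<close> overwrites whatever partial answer is there.\<close>

definition eq_query :: "nat \<Rightarrow> com \<Rightarrow> com \<Rightarrow> com" where
  "eq_query K p q = Seq clear_answer
    (Seq (assign vL (EVar vN *\<^sub>e EVar vG)) (Seq (assign vA (EConst 0))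
    (Seq (loop levels_left (Seq (query_level K q) next_level))
      (cond (EVar vA <\<^sub>e EVar vN)
        (Seq brute_force (Seq (assign vG (EVar vG +\<^sub>e EVar vG)) (build K p)))
        Skip))))"

definition boolean_vec :: "nat \<Rightarrow> int vec \<Rightarrow> bool" where
  "boolean_vec N v \<longleftrightarrow> v \<in> carrier_vec N \<and> vec_set v \<subseteq> {0, 1}"

text \<open>\<open>G\<close> bounds all bucket sizes that occur; it belongs to the analysis and is
  not an input of the program. The premise of \<open>abort_bound\<close> is what abandoning g
  entails (\<open>exhausted_bound\<close>), so its conclusion allows one more doubling.\<close>

locale reduction = buckets n S b M K b0 \<sigma>
  for n S b M K b0 \<sigma> +
  fixes p q :: com and TB :: nat and G :: int
  assumes regs: "regs_below K p" "regs_below K q"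
    and solves: "\<And>A vs. A \<in> carrier_mat (nat n) (nat n) \<Longrightarrow> elements_mat A \<subseteq> {0, 1} \<Longrightarrow>
      length vs = nat n \<Longrightarrow> \<forall>v \<in> set vs. boolean_vec (nat n) v \<Longrightarrow>
      \<exists>t0 s t. exec b0 p (init_state (nat n) A) t0 s \<and>
        serves b0 q (nat n) (boolean_answer A) s vs t \<and> t0 + t \<le> TB"
    and G_ge: "1 \<le> G" and lanes_fit: "n * G + n < S"
    and abort_bound: "\<And>g. 1 \<le> g \<Longrightarrow> g * (g * (n * n)) \<le> (n + g) * (int TB + n * n) \<Longrightarrow> 2 * g \<le> G"
    and count_fits: "G * (n * n) + int TB + n * n + n < 2 ^ b"
begin

text \<open>The budget of one instance: at most \<open>TB\<close> simulated steps, and n for each of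
  its n queries.\<close>

definition X :: int where "X = int TB + nn"

lemma X_ge: "nn \<le> X" "0 \<le> X" "n \<le> X"
  using n_le_sq n_pos by (simp_all add: X_def)

text \<open>
  Charging \<open>n\<close> for a query, on top of its simulated steps, pays for feeding it to the instance and
  for collecting the answer.
\<close>

definition good :: "int mat \<Rightarrow> nat \<Rightarrow> state \<Rightarrow> int \<Rightarrow> bool" where
  "good A k s t \<longleftrightarrow> 0 \<le> t \<and> (\<forall>vs. length vs = k \<and> (\<forall>v \<in> set vs. boolean_vec N v) \<longrightarrow>
    (\<exists>t'. serves b0 q N (boolean_answer A) s vs t' \<and> t + int t' + n * int k \<le> X))"

lemma zero_boolean: "boolean_vec N (0\<^sub>v N)"
  unfolding boolean_vec_def vec_set_def by auto

text \<open>A run of the preprocessing is only available together with some query sequence, so zero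
  vectors are used to obtain one. By determinism every other sequence starts from the same state,
  and this single state is good for all of them.\<close>

lemma good_init:
  assumes "A \<in> carrier_mat N N" "elements_mat A \<subseteq> {0, 1}"
  shows "\<exists>t0 s. exec b0 p (init_state N A) t0 s \<and> good A N s (int t0)"
proof -
  have "\<forall>v \<in> set (replicate N (0\<^sub>v N)). boolean_vec N v" using zero_boolean by simp
  then obtain t0 s where ex: "exec b0 p (init_state N A) t0 s"
    using solves[OF assms, of "replicate N (0\<^sub>v N)"] by auto
  have "good A N s (int t0)" unfolding good_def
  proof (intro conjI allI impI)
    fix vs assume vs: "length vs = N \<and> (\<forall>v \<in> set vs. boolean_vec N v)"
    then obtain t0' s' t where t: "exec b0 p (init_state N A) t0' s'"
      "serves b0 q N (boolean_answer A) s' vs t" "t0' + t \<le> TB"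
      using solves[OF assms, of vs] by blast
    have "t0' = t0" "s' = s" using exec_deterministic[OF ex t(1)] by simp_all
    then have "int t0 + int t + n * int N \<le> X" using t(3) int_N n_pos by (simp add: X_def nn_def)
    then show "\<exists>t'. serves b0 q N (boolean_answer A) s vs t' \<and> int t0 + int t' + n * int N \<le> X"
      using t(2) \<open>s' = s\<close> by blast
  qed simp
  then show ?thesis using ex by blast
qed

text \<open>The online requirement: the run on v must be fixed before the remaining queries are
  known. One continuation yields a run, and determinism identifies it with the first step of every
  other continuation.\<close>

lemma good_step:
  assumes "good A (Suc k) s t" "boolean_vec N v"
  shows "\<exists>u s'. exec b0 q (put_query N v s) u s' \<and> read_answer N s' = boolean_answer A v \<and>
    good A k s' (t + int u + n)"
proof -
  have srv: "\<exists>u s'. exec b0 q (put_query N v s) u s' \<and> read_answer N s' = boolean_answer A v \<and>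
      (\<exists>t'. serves b0 q N (boolean_answer A) s' vs t' \<and> t + int u + n + int t' + n * int k \<le> X)"
    if vs: "length vs = k" "\<forall>v \<in> set vs. boolean_vec N v" for vs
  proof -
    obtain t' where t': "serves b0 q N (boolean_answer A) s (v # vs) t'"
      "t + int t' + n * int (Suc k) \<le> X"
      using assms vs unfolding good_def by (metis length_Cons set_ConsD)
    from t'(1) obtain u s' t'' where "exec b0 q (put_query N v s) u s'"
      "read_answer N s' = boolean_answer A v" "serves b0 q N (boolean_answer A) s' vs t''"
      "t' = u + t''" by cases auto
    moreover from this have "t + int u + n + int t'' + n * int k \<le> X"
      using t'(2) by (simp add: algebra_simps)
    ultimately show ?thesis by blast
  qed
  have "\<forall>v \<in> set (replicate k (0\<^sub>v N)). boolean_vec N v" using zero_boolean by simp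
  then obtain u s' where us: "exec b0 q (put_query N v s) u s'" "read_answer N s' = boolean_answer A v"
    using srv[of "replicate k (0\<^sub>v N)"] by auto
  have "good A k s' (t + int u + n)" unfolding good_def
  proof (intro conjI allI impI)
    show "0 \<le> t + int u + n" using assms(1) n_pos unfolding good_def by simp
  next
    fix vs assume "length vs = k \<and> (\<forall>v \<in> set vs. boolean_vec N v)"
    then obtain u' s'' t' where "exec b0 q (put_query N v s) u' s''"
      "serves b0 q N (boolean_answer A) s'' vs t'" "t + int u' + n + int t' + n * int k \<le> X"
      using srv[of vs] by blast
    then show "\<exists>t'. serves b0 q N (boolean_answer A) s' vs t' \<and> t + int u + n + int t' + n * int k \<le> X"
      using exec_deterministic[OF us(1)] by blast
  qed
  then show ?thesis using us by blast
qed

lemma good_le: "good A k s t \<Longrightarrow> t \<le> X"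
proof -
  assume g: "good A k s t"
  have "\<forall>v \<in> set (replicate k (0\<^sub>v N)). boolean_vec N v" using zero_boolean by simp
  then obtain t' where "t + int t' + n * int k \<le> X" using g unfolding good_def
    by (metis length_replicate)
  moreover have "0 \<le> n * int k" using n_pos by simp
  ultimately show ?thesis by linarith
qed

lemma boolean_query_vec: "boolean_vec N (query_vec f a e)"
  unfolding boolean_vec_def query_vec_def vec_set_def query_bit_def by auto

lemma boolean_bucket_matrix:
  "bucket_matrix a e \<in> carrier_mat N N" "elements_mat (bucket_matrix a e) \<subseteq> {0, 1}"
  unfolding bucket_matrix_def elements_mat_def by (auto simp: of_bool_def)

text \<open>The ceiling of n / g: the last bucket may be shorter.\<close>

definition levels :: "int \<Rightarrow> nat" where
  "levels g = nat ((n + g - 1) div g)"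

lemma less_levels_iff:
  assumes "1 \<le> g"
  shows "j < levels g \<longleftrightarrow> int j * g < n"
proof -
  have "j < levels g \<longleftrightarrow> int j + 1 \<le> (n + g - 1) div g" unfolding levels_def by linarith
  also have "\<dots> \<longleftrightarrow> (int j + 1) * g \<le> n + g - 1"
  proof
    have d: "(n + g - 1) div g * g + (n + g - 1) mod g = n + g - 1"
      "0 \<le> (n + g - 1) mod g" "(n + g - 1) mod g < g" using assms by simp_all
    show "(int j + 1) * g \<le> n + g - 1" if "int j + 1 \<le> (n + g - 1) div g"
      using mult_right_mono[OF that, of g] assms d by linarith
    show "int j + 1 \<le> (n + g - 1) div g" if le: "(int j + 1) * g \<le> n + g - 1"
    proof (rule ccontr)
      assume "\<not> int j + 1 \<le> (n + g - 1) div g"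
      then have "(n + g - 1) div g * g \<le> int j * g" using assms by (intro mult_right_mono) simp_all
      moreover have "(int j + 1) * g = int j * g + g" by (simp add: algebra_simps)
      ultimately show False using d le by linarith
    qed
  qed
  also have "\<dots> \<longleftrightarrow> int j * g < n" by (simp add: algebra_simps) linarith
  finally show ?thesis .
qed

lemma levels_mult_le:
  assumes "1 \<le> g"
  shows "int (levels g) * g \<le> n + g - 1"
proof -
  have "0 \<le> (n + g - 1) div g" using assms n_pos by (simp add: pos_imp_zdiv_nonneg_iff)
  then have "int (levels g) = (n + g - 1) div g" by (simp add: levels_def)
  moreover have "0 \<le> (n + g - 1) mod g" using assms by simp
  then have "(n + g - 1) div g * g \<le> n + g - 1" using div_mult_mod_eq[of "n + g - 1" g] by linarith
  ultimately show ?thesis by simp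
qed

lemma levels_le: "1 \<le> g \<Longrightarrow> int (levels g) \<le> n"
proof (rule ccontr)
  assume g: "1 \<le> g" "\<not> int (levels g) \<le> n"
  then have "nat n < levels g" using n_pos by linarith
  then have "n * g < n" using less_levels_iff[OF g(1), of "nat n"] n_pos by simp
  moreover have "n * 1 \<le> n * g" using g n_pos by (intro mult_left_mono) simp_all
  ultimately show False by simp
qed

section \<open>The state of a phase: live, exhausted and untouched lanes\<close>

definition bucket_end :: "int \<Rightarrow> nat \<Rightarrow> int" where
  "bucket_end g j = min (int j * g + g) n"

definition level_matrix :: "int \<Rightarrow> nat \<Rightarrow> int mat" where
  "level_matrix g j = bucket_matrix (int j * g) (bucket_end g j)"

definition level_ok :: "int \<Rightarrow> imem \<Rightarrow> nat \<Rightarrow> nat \<Rightarrow> state \<Rightarrow> int \<Rightarrow> bool" where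
  "level_ok g m j k s t \<longleftrightarrow> lane (n * g + int j) m s \<and> good (level_matrix g j) k s t"

text \<open>Between queries all instances of a phase have the same number k of queries left. The
  count is the sum of their charges, each of which is at most X.\<close>

definition alive :: "int \<Rightarrow> nat \<Rightarrow> int \<Rightarrow> imem \<Rightarrow> bool" where
  "alive g k c m \<longleftrightarrow> (\<exists>st tm. (\<forall>j < levels g. level_ok g m j k (st j) (tm j)) \<and>
    c = (\<Sum>j < levels g. tm j))"

text \<open>The lower bound is the limit, the upper bound the total budget of all levels. It says
  nothing about the instances, which may be missing or out of step when a phase is
  abandoned.\<close>

definition exhausted :: "int \<Rightarrow> int \<Rightarrow> bool" where
  "exhausted g c \<longleftrightarrow> g * nn \<le> c \<and> c \<le> int (levels g) * X"

definition fresh_from :: "int \<Rightarrow> imem \<Rightarrow> bool" where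
  "fresh_from l0 m \<longleftrightarrow> (\<forall>l v. l0 \<le> l \<and> l < S \<and> 0 \<le> v \<longrightarrow> m (cell S l v) = 0)"

text \<open>Each phase reserves n lanes, enough by \<open>levels_le\<close>.\<close>

definition phase_lanes :: "int \<Rightarrow> int set" where
  "phase_lanes g = {x. \<exists>l v. n * g \<le> l \<and> l < n * g + n \<and> 0 \<le> v \<and> x = cell S l v}"

text \<open>Multiplying \<open>g * nn \<le> levels g * X\<close> by g and using levels g * g \<le> n
  + g yields the premise of \<open>abort_bound\<close>.\<close>

lemma exhausted_bound:
  assumes "exhausted g c" "1 \<le> g"
  shows "2 * g \<le> G"
proof (rule abort_bound[OF assms(2)])
  have "g * (g * nn) \<le> g * (int (levels g) * X)"
    using assms unfolding exhausted_def by (intro mult_left_mono) auto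
  also have "\<dots> = (int (levels g) * g) * X" by simp
  also have "\<dots> \<le> (n + g) * X"
    using levels_mult_le[OF assms(2)] X_ge by (intro mult_right_mono) simp_all
  finally show "g * (g * (n * n)) \<le> (n + g) * (int TB + n * n)" by (simp add: X_def nn_def)
qed

lemma g_facts:
  assumes "1 \<le> g" "g \<le> G"
  shows "n * g + n < S" "n + g < S" "g * nn + X + n < 2 ^ b" "n * g + n \<le> 2 * (n * g)" "g * nn \<in> words b"
    "0 \<le> n * g" "nn \<le> g * nn" "n \<le> n * g"
proof -
  have "n * g \<le> n * G" using assms n_pos by (intro mult_left_mono) simp_all
  then show 1: "n * g + n < S" using lanes_fit by simp
  have "1 * g \<le> n * g" using assms n_pos by (intro mult_right_mono) simp_all
  then show "n + g < S" using 1 by simp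
  have "g * nn \<le> G * nn" using assms n_le_sq n_pos by (intro mult_right_mono) simp_all
  then show 2: "g * nn + X + n < 2 ^ b" using count_fits by (simp add: X_def nn_def)
  have "n * 1 \<le> n * g" using assms n_pos by (intro mult_left_mono) simp_all
  then show "n * g + n \<le> 2 * (n * g)" "n \<le> n * g" by linarith+
  have "1 * nn \<le> g * nn" using assms n_pos n_le_sq by (intro mult_right_mono) simp_all
  then show "nn \<le> g * nn" by simp
  then show "g * nn \<in> words b" using 2 X_ge n_pos n_le_sq by (intro in_words_nonneg) simp_all
  show "0 \<le> n * g" using assms n_pos by simp
qed

lemma safe_levels_left:
  assumes "static_env V" "V vG = g" "1 \<le> g" "g \<le> G"
  shows "safe b levels_left V m" "val levels_left V m \<noteq> 0 \<longleftrightarrow> V vA < n \<and> V vC < g * nn"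
    "cost levels_left = 9"
  using assms g_facts[OF assms(3,4)] bit_word bit_word[of "V vA < n \<and> V vC < g * nn"]
  by (simp_all add: levels_left_def static_env_def flip: of_bool_conj)

lemma wp_next_level:
  assumes "V vA = a" "V vG = g" "V vL = l" "0 \<le> a" "a < n" "1 \<le> g" "g \<le> G" "0 \<le> l" "l < S - 1"
    and "Q (t + 6) (V(vA := a + g, vL := l + 1)) m"
  shows "wp b next_level Q t V m"
proof -
  have "a + g \<in> words b" "l + 1 \<in> words b"
    using assms g_facts[of g] S_fits n_pos by (simp_all add: in_words_nonneg)
  moreover have "1 \<in> words b" by (simp add: const_word)
  ultimately show ?thesis unfolding next_level_def using assms
    by (intro wp_Seq wp_assign) (simp_all add: add.commute)
qed

text \<open>The loads cost O(g n) each on levels g levels; as levels g * g \<le> n + g, they stay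
  within O(g n^2) even when g exceeds n. Simulated preprocessing is paid through
  \<open>vC\<close>.\<close>

lemma wp_build:
  assumes env: "static_env V" "V vG = g" "1 \<le> g" "g \<le> G"
    and mem: "static_mem m" "fresh_from (n * g) m"
  shows "wp b (build K p) (\<lambda>t' V' m'. agree_off {vC, vL, vA, vE, vR, vK} V V' \<and>
    agree_off (phase_lanes g) m m' \<and> 0 \<le> V' vC \<and> V' vC \<le> g * nn + X \<and>
    (alive g N (V' vC) m' \<or> exhausted g (V' vC)) \<and> t' \<le> t + 220 * (g * nn) + 22 * V' vC) t V m"
proof -
  let ?W = "{vC, vL, vA, vE, vR, vK}"
  define R where "R = (\<lambda>t' V' m'. agree_off ?W V V' \<and>
    agree_off (phase_lanes g) m m' \<and> 0 \<le> V' vC \<and> V' vC \<le> g * nn + X \<and>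
    (alive g N (V' vC) m' \<or> exhausted g (V' vC)) \<and> t' \<le> t + 220 * (g * nn) + 22 * V' vC)"
  define I where "I = (\<lambda>t' V' m'. \<exists>j st tm. j \<le> levels g \<and> agree_off ?W V V' \<and>
    agree_off (phase_lanes g) m m' \<and> V' vA = int j * g \<and> V' vL = n * g + int j \<and>
    fresh_from (n * g + int j) m' \<and>
    (\<forall>i < j. level_ok g m' i N (st i) (tm i)) \<and> V' vC = (\<Sum>i < j. tm i) \<and>
    0 \<le> V' vC \<and> V' vC \<le> g * nn + X \<and>
    t' \<le> t + 5 + int j * (80 * (g * n) + 20) + 22 * V' vC)"
  note gf = g_facts[OF env(3,4)]
  have fr: "static_env V' \<and> V' vG = g" if "agree_off ?W V V'" for V'
    using agree_offD[OF that] env by (simp add: static_env_def)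
  have stm: "static_mem m'" if "agree_off (phase_lanes g) m m'" for m'
  proof (rule static_mem_agree[OF mem(1) that])
    fix x assume "x \<in> phase_lanes g"
    then obtain l v where "n * g \<le> l" "0 \<le> v" "x = cell S l v" unfolding phase_lanes_def by auto
    then have "S \<le> x" using cell_ge[of v S l] S_pos gf by simp
    then show "nn \<le> x \<and> x < pb \<or> tb \<le> x" using own_less_S[of x] n_pos by linarith
  qed
  have jle: "int j * g \<le> n + g" if "j \<le> levels g" for j
  proof -
    have "int j * g \<le> int (levels g) * g" using that env by (intro mult_right_mono) simp_all
    then show ?thesis using levels_mult_le[OF env(3)] by simp
  qed
  have lp: "wp b (loop levels_left (Seq (load_level K) (Seq (sim K p) next_level))) R t1 V1 m1"
    if "I t1 V1 m1" for t1 V1 m1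
  proof (rule wp_loop[where I = I and f = "\<lambda>V' m'. nat (n - V' vA)", OF that], goal_cases)
    case (1 t' V' m')
    then show ?case using safe_levels_left(1)[of V' g m'] fr env unfolding I_def by auto
  next
    case (2 t' V' m')
    then obtain j st tm where j: "j \<le> levels g" and ag: "agree_off ?W V V'" "agree_off (phase_lanes g) m m'"
      and v: "V' vA = int j * g" "V' vL = n * g + int j" and frs: "fresh_from (n * g + int j) m'"
      and ok: "\<And>i. i < j \<Longrightarrow> level_ok g m' i N (st i) (tm i)"
      and c: "V' vC = (\<Sum>i < j. tm i)" "0 \<le> V' vC"
      and tm: "t' \<le> t + 5 + int j * (80 * (g * n) + 20) + 22 * V' vC"
      unfolding I_def by blast
    have ev: "static_env V'" "V' vG = g" using fr[OF ag(1)] by simp_all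
    have lt: "int j * g < n" "V' vC < g * nn"
      using 2(2) safe_levels_left(2)[OF ev env(3,4), of m'] v by simp_all
    have jJ: "j < levels g" using less_levels_iff[OF env(3)] lt by simp
    then have jn: "int j < n" using levels_le[OF env(3)] by simp
    define l where "l = n * g + int j"
    have l: "n * g \<le> l" "0 \<le> l" "l < S - 1" "l < n * g + n" using gf jn by (simp_all add: l_def)
    let ?a = "int j * g" and ?e = "bucket_end g j"
    obtain u s' where u: "exec b0 p (init_state N (level_matrix g j)) u s'" "good (level_matrix g j) N s' (int u)"
      using good_init boolean_bucket_matrix unfolding level_matrix_def by blast
    have uX: "int u \<le> X" using good_le[OF u(2)] .
    define Q where "Q = (\<lambda>t'' V'' m''. I t'' V'' m'' \<and> nat (n - V'' vA) < nat (n - V' vA))"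
    have "wp b (load_level K) (\<lambda>t V m. wp b (Seq (sim K p) next_level) Q t V m) (t' + 10) V' m'"
    proof (rule wp_mono[OF wp_load_level[where a = ?a and g = g and l = l and e = ?e]], goal_cases)
      case (14 t2 V2 m2)
      then have 2: "agree_off {vE, vR, vK} V' V2" "agree_off (Lane l) m' m2"
        "lane l m2 (init_state N (level_matrix g j))" "t2 \<le> t' + 10 + 80 * (g * n)"
        unfolding level_matrix_def by auto
      have V2: "V2 vS = S" "V2 vL = l" "V2 vC = V' vC" "V2 vA = ?a" "V2 vG = g"
        using agree_offD[OF 2(1)] ev v by (simp_all add: static_env_def l_def)
      show ?case
      proof (rule wp_Seq, rule wp_sim[where l = l, OF u(1) regs(1) 2(3)], goal_cases)
        case (7 t3 m3)
        let ?V3 = "V2(vC := V2 vC + int u)"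
        let ?V4 = "?V3(vA := ?a + g, vL := l + 1)"
        have ag3: "agree_off (Lane l) m' m3"
          using agree_off_trans[OF 2(2), of "Lane l" m3 "Lane l"] 7(2) by (simp add: off_lane_iff)
        have cells: "m3 (cell S l' v) = m' (cell S l' v)" if "0 \<le> l'" "l' < S" "l' \<noteq> l" for l' v
          using agree_offD[OF ag3 Lane_disjoint[of l' l v]] that l by simp
        have "I (t3 + 6) ?V4 m3" unfolding I_def
        proof (intro exI[of _ "Suc j"] exI[of _ "st(j := s')"] exI[of _ "tm(j := int u)"] conjI)
          show "Suc j \<le> levels g" using jJ by simp
          have "agree_off ?W V V2" by (rule agree_off_trans[OF ag(1) 2(1)]) auto
          then show "agree_off ?W V ?V4" by (intro agree_off_upd) simp_all
          have "Lane l \<subseteq> phase_lanes g" unfolding Lane_def phase_lanes_def using l by auto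
          then show "agree_off (phase_lanes g) m m3"
            by (intro agree_off_trans[OF ag(2) ag3]) simp
          show "fresh_from (n * g + int (Suc j)) m3"
            using frs cells l unfolding fresh_from_def by (simp add: l_def)
          show "\<forall>i < Suc j. level_ok g m3 i N ((st(j := s')) i) ((tm(j := int u)) i)"
          proof (intro allI impI)
            fix i assume i: "i < Suc j"
            show "level_ok g m3 i N ((st(j := s')) i) ((tm(j := int u)) i)"
            proof (cases "i = j")
              case True
              then show ?thesis using 7(1) u(2) by (simp add: level_ok_def l_def)
            next
              case False
              have "m3 (cell S (n * g + int i) v) = m' (cell S (n * g + int i) v)" for v
                by (rule cells) (use i False l gf in \<open>simp_all add: l_def\<close>)
              then have "lane (n * g + int i) m3 (st i)"
                using ok[of i] i False lane_cong[of "n * g + int i" m' "st i" m3]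
                unfolding level_ok_def by simp
              then show ?thesis using ok[of i] i False by (simp add: level_ok_def)
            qed
          qed
          show "?V4 vC = (\<Sum>i < Suc j. (tm(j := int u)) i)" using c(1) V2 by simp
          \<comment> \<open>The test before this level found the count below \<open>g * nn\<close>,
            and one instance adds at most X.\<close>
          show "?V4 vC \<le> g * nn + X" using V2 lt(2) uX by simp
          show "t3 + 6 \<le> t + 5 + int (Suc j) * (80 * (g * n) + 20) + 22 * ?V4 vC"
            using 7(3) 2(4) tm V2 by (simp add: algebra_simps)
        qed (use V2 c(2) in \<open>simp_all add: l_def algebra_simps\<close>)
        then have "Q (t3 + 6) ?V4 m3" unfolding Q_def using v lt env by simp
        then show ?case
          using V2 lt env l by (intro wp_next_level[where a = ?a and g = g and l = l]) simp_all
      qed (use V2 c(2) lt(2) uX gf l n_pos in simp_all)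
    next
      case (13 x)
      then show ?case using frs l gf by (simp add: fresh_from_def l_def)
    qed (use ev env v lt l gf stm[OF ag(2)] in \<open>simp_all add: l_def bucket_end_def\<close>)
    then show ?case unfolding Q_def[symmetric]
      using safe_levels_left(3)[OF ev env(3,4)] by (intro wp_Seq) (simp add: add.commute)
  next
    case (3 t' V' m')
    then obtain j st tm where j: "j \<le> levels g" and ag: "agree_off ?W V V'" "agree_off (phase_lanes g) m m'"
      and v: "V' vA = int j * g"
      and ok: "\<And>i. i < j \<Longrightarrow> level_ok g m' i N (st i) (tm i)"
      and c: "V' vC = (\<Sum>i < j. tm i)" "0 \<le> V' vC" "V' vC \<le> g * nn + X"
      and tm: "t' \<le> t + 5 + int j * (80 * (g * n) + 20) + 22 * V' vC"
      unfolding I_def by blast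
    have ev: "static_env V'" "V' vG = g" using fr[OF ag(1)] by simp_all
    have "\<not> (int j * g < n \<and> V' vC < g * nn)"
      using 3(2) safe_levels_left(2)[OF ev env(3,4), of m'] v by simp
    then have "alive g N (V' vC) m' \<or> exhausted g (V' vC)"
    proof (cases "int j * g < n")
      case False
      then have "j = levels g" using less_levels_iff[OF env(3), of j] j by simp
      then show ?thesis using ok c(1) unfolding alive_def by blast
    next
      case True
      \<comment> \<open>Only some levels have been built, but each of them keeps to its budget,
        which is all that \<open>exhausted\<close> asks.\<close>
      have "(\<Sum>i < j. tm i) \<le> (\<Sum>i < j. X)"
        using ok good_le unfolding level_ok_def by (intro sum_mono) blast
      also have "\<dots> = int j * X" by simp
      also have "\<dots> \<le> int (levels g) * X" using j X_ge by (intro mult_right_mono) simp_all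
      finally show ?thesis using True \<open>\<not> (int j * g < n \<and> V' vC < g * nn)\<close> c(1)
        unfolding exhausted_def by simp
    qed
    moreover have "t' + 10 \<le> t + 220 * (g * nn) + 22 * V' vC"
    proof -
      have "(int j * g) * n \<le> (n + g) * n" using jle[OF j] n_pos by (intro mult_right_mono) simp_all
      moreover have "(n + g) * n = nn + n * g" by (simp add: nn_def algebra_simps)
      moreover have "n * g \<le> nn * g" using n_le_sq env by (intro mult_right_mono) simp_all
      moreover have "int j \<le> n" using j levels_le[OF env(3)] by simp
      moreover have "int j * (80 * (g * n) + 20) = 80 * ((int j * g) * n) + 20 * int j"
        by (simp add: algebra_simps)
      moreover have "nn * g = g * nn" by simp
      ultimately show ?thesis using tm gf(7) n_le_sq n_pos by linarith
    qed
    ultimately show ?case unfolding R_def safe_levels_left(3)[OF ev env(3,4)]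
      using ag c by (simp add: add.commute)
  qed
  have w: "n * g \<in> words b" using gf S_fits n_pos by (intro in_words_nonneg) simp_all
  let ?V1 = "V(vC := 0, vL := n * g, vA := 0)"
  have "I (t + 5) ?V1 m" unfolding I_def
  proof (intro exI[of _ "0::nat"] exI[of _ "\<lambda>_. undefined"] exI[of _ "\<lambda>_. 0"] conjI)
    show "agree_off ?W V ?V1" by (intro agree_off_upd agree_off_refl) simp_all
  qed (use mem gf X_ge n_le_sq n_pos in \<open>simp_all add: agree_off_refl\<close>)
  from lp[OF this] show ?thesis unfolding R_def[symmetric] build_def
    using w env
    by (intro wp_Seq[of _ "assign _ _"] wp_assign) (simp_all add: const_word static_env_def add.commute)
qed

text \<open>Scans and collections only ever write ones, so that the levels combine by disjunction;
  this requires starting from zero.\<close>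

lemma wp_clear_answer:
  assumes env: "static_env V"
  shows "wp b clear_answer (\<lambda>t' V' m'. agree_off {vI} V V' \<and> agree_off Ans m m' \<and>
    (\<forall>i. 0 \<le> i \<and> i < n \<longrightarrow> m' (ab + i) = 0) \<and> t' \<le> t + 20 * n) t V m" (is "wp b _ ?Post _ _ _")
proof -
  define I where "I = (\<lambda>j t' V' m'. agree_off {vI} V V' \<and> agree_off Ans m m' \<and>
    (\<forall>i. 0 \<le> i \<and> i < j \<longrightarrow> m' (ab + i) = 0) \<and> t' \<le> t + 1 + 12 * j)"
  have vN: "V vN = n" using env by (simp add: static_env_def)
  have "wp b (for_below vI vN (store (EVar vAB +\<^sub>e EVar vI) (EConst 0)))
    ?Post (t + 1) (V(vI := 0)) m"
  proof (rule wp_for_below[where I = I], goal_cases)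
    case 8
    show ?case unfolding I_def by (auto simp: agree_off_upd agree_off_refl)
  next
    case (9 j t' V' m')
    then have j: "0 \<le> j" "j < n" "V' vI = j" and Ij: "I j t' V' m'" using vN by simp_all
    have ag: "agree_off {vI} V V'" "agree_off Ans m m'"
      and z: "\<And>i. 0 \<le> i \<Longrightarrow> i < j \<Longrightarrow> m' (ab + i) = 0" and tm: "t' \<le> t + 1 + 12 * j"
      using Ij unfolding I_def by auto
    have ev: "V' vAB = ab" "V' vN = n"
      using env agree_offD[OF ag(1)] unfolding static_env_def by simp_all
    have w: "ab + j \<in> words b" "0 \<le> ab + j" "0 \<in> words b"
      using j n_le_sq n_pos by (auto intro!: small_word)
    have "agree_off Ans m (m'(ab + j := 0))" using j by (intro agree_off_upd ag) simp
    moreover have "agree_off {vI} V (V'(vI := j + 1))" by (intro agree_off_upd ag) simp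
    moreover have "(m'(ab + j := 0)) (ab + i) = 0" if "0 \<le> i" "i < j + 1" for i using z that by simp
    moreover define Q where "Q = (\<lambda>t' V' m'. V' vI = j \<and> V' vN = (V(vI := 0)) vN \<and>
        I (j + 1) (t' + 3) (V'(vI := j + 1)) m')"
    ultimately have "Q (9 + t') V' (m'(ab + j := 0))"
      unfolding Q_def I_def using tm j ev vN by simp
    then show ?case unfolding Q_def[symmetric] by (intro wp_store) (use ev j w in simp_all)
  next
    case (10 t' V' m')
    then have "I n t' V' m'" using vN by simp
    then show ?case unfolding I_def using n_pos by simp
  qed (use vN n_pos n_less_word b_pos in simp_all)
  then show ?thesis unfolding clear_answer_def
    by (intro wp_Seq wp_assign) (simp_all add: const_word)
qed

section \<open>Answering one query by brute force\<close>

definition matches :: "(int \<Rightarrow> int) \<Rightarrow> int \<Rightarrow> int \<Rightarrow> bool" where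
  "matches f k i \<longleftrightarrow> (\<exists>k'. 0 \<le> k' \<and> k' < k \<and> M i k' = f k')"

lemma matches_step: "0 \<le> k \<Longrightarrow> matches f (k + 1) i \<longleftrightarrow> matches f k i \<or> M i k = f k"
proof -
  have "k' < k + 1 \<longleftrightarrow> k' < k \<or> k' = k" for k' by auto
  then show "0 \<le> k \<Longrightarrow> ?thesis" unfolding matches_def by auto
qed

lemma matches_zero: "\<not> matches f 0 i"
  unfolding matches_def by auto

lemma wp_brute_force:
  assumes env: "static_env V" and mem: "static_mem m" "\<And>k. 0 \<le> k \<Longrightarrow> k < n \<Longrightarrow> m (nn + k) = f k"
  shows "wp b brute_force (\<lambda>t' V' m'. agree_off {vI, vK} V V' \<and> agree_off Ans m m' \<and>
    (\<forall>i. 0 \<le> i \<and> i < n \<longrightarrow> m' (ab + i) = of_bool (matches f n i)) \<and> t' \<le> t + 60 * nn) t V m" (is "wp b _ ?Post _ _ _")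
proof -
  let ?pa = "for_below vK vN (cond (matrix_entry (EVar vI) =\<^sub>e ELoad (EVar vNN +\<^sub>e EVar vK))
    (store (EVar vAB +\<^sub>e EVar vI) (EConst 1)) Skip)"
  define I where "I = (\<lambda>j t' V' m'. agree_off {vI, vK} V V' \<and> agree_off Ans m m' \<and>
    (\<forall>i. 0 \<le> i \<and> i < j \<longrightarrow> m' (ab + i) = of_bool (matches f n i)) \<and> t' \<le> t + 1 + j * (25 * n + 20))"
  define J where "J = (\<lambda>j t0 k t' V' m'. agree_off {vI, vK} V V' \<and> V' vI = j \<and> agree_off Ans m m' \<and>
    (\<forall>i. 0 \<le> i \<and> i < j \<longrightarrow> m' (ab + i) = of_bool (matches f n i)) \<and>
    m' (ab + j) = of_bool (matches f k j) \<and> t' \<le> t0 + 25 * k)"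
  have vN: "V vN = n" using env by (simp add: static_env_def)
  have fr: "static_env V' \<and> V' vN = n" if "agree_off {vI, vK} V V'" for V'
    using agree_offD[OF that] env by (simp add: static_env_def)
  have stm: "static_mem m'" "\<And>k. 0 \<le> k \<Longrightarrow> k < n \<Longrightarrow> m' (nn + k) = f k" if "agree_off Ans m m'" for m'
  proof -
    show "static_mem m'" using n_pos by (intro static_mem_agree[OF mem(1) that]) simp
    show "m' (nn + k) = f k" if "0 \<le> k" "k < n" for k
      using agree_offD[OF \<open>agree_off Ans m m'\<close>, of "nn + k"] mem(2) that by simp
  qed
  have inner: "wp b ?pa
      (\<lambda>t' V' m'. J j t0 n (t' - 4) V' m') t0 V1 m1"
    if pre: "J j t0 0 t0 V1 m1" "V1 vK = 0" "0 \<le> j" "j < n" for j t0 V1 m1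
  proof (rule wp_for_below[where I = "J j t0"], goal_cases)
    case (9 k t' V' m')
    have ag: "agree_off {vI, vK} V V'" "V' vI = j" "agree_off Ans m m'"
      and an: "\<And>i. 0 \<le> i \<Longrightarrow> i < j \<Longrightarrow> m' (ab + i) = of_bool (matches f n i)"
        "m' (ab + j) = of_bool (matches f k j)" and tm: "t' \<le> t0 + 25 * k"
      using 9(5) unfolding J_def by auto
    have v1: "V1 vN = n" using fr[of V1] pre(1) unfolding J_def by simp
    then have k: "0 \<le> k" "k < n" "V' vK = k" using 9 pre(2) by simp_all
    have ev: "static_env V'" "V' vN = n" "V' vNN = nn" "V' vAB = ab"
      using fr[OF ag(1)] by (simp_all add: static_env_def)
    have me: "safe b (matrix_entry (EVar vI)) V' m'" "val (matrix_entry (EVar vI)) V' m' = M j k"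
      "cost (matrix_entry (EVar vI)) = 6"
      using safe_matrix_entry(1,2)[of V' m' k "EVar vI" j] ev stm(1)[OF ag(3)] k pre ag
      by (simp_all add: matrix_entry_def)
    have w: "nn + k \<in> words b" "0 \<le> nn + k" "ab + j \<in> words b" "0 \<le> ab + j" "1 \<in> words b"
      using k pre n_le_sq n_pos by (auto intro!: small_word)
    define Q where "Q = (\<lambda>t' V' m'. V' vK = k \<and> V' vN = V1 vN \<and>
      J j t0 (k + 1) (t' + 3) (V'(vK := k + 1)) m')"
    have agV: "agree_off {vI, vK} V (V'(vK := k + 1))" by (intro agree_off_upd ag) simp
    have agm: "agree_off Ans m (m'(ab + j := 1))" using pre by (intro agree_off_upd ag) simp
    have 1: "Q s V' (m'(ab + j := 1))" if "s \<le> t' + 21" "M j k = f k" for s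
      unfolding Q_def J_def using agV agm an tm k ev v1 ag matches_step[OF k(1)] that by simp
    have 2: "Q s V' m'" if "s \<le> t' + 21" "M j k \<noteq> f k" for s
      unfolding Q_def J_def using agV an tm k ev v1 ag matches_step[OF k(1)] that by simp
    show ?case unfolding Q_def[symmetric]
      by (intro wp_cond wp_store wp_Skip)
        (use me ev w k ag stm(2)[OF ag(3)] 1 2 in \<open>simp_all add: bit_word\<close>)
  next
    case (10 t' V' m')
    then show ?case using fr[of V1] pre(1) unfolding J_def by simp
  qed (use pre fr[of V1] n_pos n_less_word b_pos in \<open>simp_all add: J_def\<close>)
  have "wp b (for_below vI vN
      (Seq (store (EVar vAB +\<^sub>e EVar vI) (EConst 0)) (Seq (assign vK (EConst 0))
        ?pa)))
    ?Post
    (t + 1) (V(vI := 0)) m"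
  proof (rule wp_for_below[where I = I], goal_cases)
    case 8
    show ?case unfolding I_def by (auto simp: agree_off_upd agree_off_refl)
  next
    case (9 j t' V' m')
    then have j: "0 \<le> j" "j < n" "V' vI = j" and Ij: "I j t' V' m'" using vN by simp_all
    have ag: "agree_off {vI, vK} V V'" "agree_off Ans m m'"
      and an: "\<And>i. 0 \<le> i \<Longrightarrow> i < j \<Longrightarrow> m' (ab + i) = of_bool (matches f n i)"
      and tm: "t' \<le> t + 1 + j * (25 * n + 20)"
      using Ij unfolding I_def by auto
    have ev: "V' vAB = ab" using fr[OF ag(1)] by (simp add: static_env_def)
    have w: "ab + j \<in> words b" "0 \<le> ab + j" "0 \<in> words b"
      using j n_le_sq n_pos by (auto intro!: small_word)
    have "agree_off Ans m (m'(ab + j := 0))" using j by (intro agree_off_upd ag) simp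
    moreover have "agree_off {vI, vK} V (V'(vK := 0))" by (intro agree_off_upd ag) simp
    ultimately have "J j (t' + 10) 0 (t' + 10) (V'(vK := 0)) (m'(ab + j := 0))"
      unfolding J_def using an j by (simp add: matches_zero)
    from inner[OF this _ j(1,2)]
    have "wp b ?pa
      (\<lambda>s V'' m''. V'' vI = j \<and> V'' vN = (V(vI := 0)) vN \<and>
         I (j + 1) (s + 3) (V''(vI := j + 1)) m'') (t' + 10) (V'(vK := 0)) (m'(ab + j := 0))"
    proof (rule wp_mono, goal_cases)
      case (2 s V'' m'')
      then have p: "agree_off {vI, vK} V V''" "V'' vI = j" "agree_off Ans m m''"
        "\<And>i. 0 \<le> i \<Longrightarrow> i < j \<Longrightarrow> m'' (ab + i) = of_bool (matches f n i)"
        "m'' (ab + j) = of_bool (matches f n j)" "s - 4 \<le> t' + 10 + 25 * n"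
        unfolding J_def by auto
      have "agree_off {vI, vK} V (V''(vI := j + 1))" by (intro agree_off_upd p) simp
      moreover have "m'' (ab + i) = of_bool (matches f n i)" if "0 \<le> i" "i < j + 1" for i
        using p(4)[of i] p(5) that by (cases "i = j") simp_all
      moreover have "s + 3 \<le> t + 1 + (j + 1) * (25 * n + 20)"
        using p(6) tm by (simp add: algebra_simps)
      ultimately show ?case unfolding I_def using p fr[OF p(1)] vN by simp
    qed simp
    then show ?case
      by (intro wp_Seq[of _ "store _ _"] wp_Seq[of _ "assign _ _"] wp_assign wp_store)
        (use w ev j in \<open>simp_all add: add.commute\<close>)
  next
    case (10 t' V' m')
    then have In: "I n t' V' m'" using vN by simp
    have "n * (25 * n + 20) = 25 * nn + 20 * n" by (simp add: nn_def algebra_simps)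
    then have "t' + 4 \<le> t + 60 * nn" using In n_le_sq n_pos unfolding I_def by simp
    then show ?case using In unfolding I_def by simp
  qed (use vN n_pos n_less_word b_pos in simp_all)
  then show ?thesis unfolding brute_force_def
    by (intro wp_Seq[of _ "assign vI _"] wp_assign) (simp_all add: const_word)
qed

text \<open>If buckets x < j < y all straddled the value f k, then f k \<le> top of x \<le> bottom
  of j \<le> top of j \<le> bottom of y \<le> f k. This makes bucket j constant, a contradiction, so
  only the least and the greatest straddling bucket remain.\<close>

lemma straddles_at_most_twice:
  assumes g: "1 \<le> g" and k: "0 \<le> k" "k < n"
  shows "card {j. j < levels g \<and> straddles f (int j * g) (bucket_end g j) k} \<le> 2"
proof -
  let ?Z = "{j. j < levels g \<and> straddles f (int j * g) (bucket_end g j) k}"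
  have fin: "finite ?Z" by simp
  show ?thesis
  proof (cases "?Z = {}")
    case False
    have "?Z \<subseteq> {Min ?Z, Max ?Z}"
    proof
      fix j assume j: "j \<in> ?Z"
      show "j \<in> {Min ?Z, Max ?Z}"
      proof (rule ccontr)
        assume "j \<notin> {Min ?Z, Max ?Z}"
        then have lt: "Min ?Z < j" "j < Max ?Z"
          using Min_le[OF fin j] Max_ge[OF fin j] by simp_all
        define x where "x = Min ?Z"
        define y where "y = Max ?Z"
        have xy: "x \<in> ?Z" "y \<in> ?Z" "x < j" "j < y"
          using Min_in[OF fin False] Max_in[OF fin False] lt by (simp_all add: x_def y_def)
        have "(int x + 1) * g \<le> int j * g" "(int j + 1) * g \<le> int y * g"
          using xy(3,4) g by (intro mult_right_mono; simp)+
        then have d: "int x * g + g \<le> int j * g" "int j * g + g \<le> int y * g" by (simp_all add: algebra_simps)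
        have yn: "int y * g < n" using xy(2) less_levels_iff[OF g] by simp
        have nonneg: "0 \<le> int x * g" using g by simp
        have be: "bucket_end g x = int x * g + g" "bucket_end g j = int j * g + g"
          using d yn g unfolding bucket_end_def by simp_all
        have "f k \<le> M (\<sigma> k (int x * g + g - 1)) k" using xy(1) be unfolding straddles_def by simp
        also have "\<dots> \<le> M (\<sigma> k (int j * g)) k" by (rule perm_sorted) (use k d yn nonneg g in linarith)+
        finally have lo: "f k \<le> M (\<sigma> k (int j * g)) k" .
        have "M (\<sigma> k (int j * g + g - 1)) k \<le> M (\<sigma> k (int y * g)) k"
          by (rule perm_sorted) (use k d yn nonneg g in linarith)+
        also have "\<dots> \<le> f k" using xy(2) unfolding straddles_def by simp
        finally have hi: "M (\<sigma> k (int j * g + g - 1)) k \<le> f k" .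
        have "M (\<sigma> k (int j * g)) k \<le> M (\<sigma> k (int j * g + g - 1)) k"
          by (rule perm_sorted) (use k d yn nonneg g in linarith)+
        then have "uniform (int j * g) (bucket_end g j) k" using lo hi be unfolding uniform_def by simp
        then show False using j unfolding straddles_def by simp
      qed
    qed
    then have "card ?Z \<le> card {Min ?Z, Max ?Z}" by (intro card_mono) simp_all
    also have "\<dots> \<le> 2" by (simp add: card_insert_if)
    finally show ?thesis .
  next
    case True
    then have "card ?Z = 0" by (metis card.empty)
    then show ?thesis by linarith
  qed
qed

text \<open>Exchanging the sums counts by columns instead of levels, and every column contributes at
  most 2.\<close>

lemma straddle_count_sum:
  assumes "1 \<le> g" "j \<le> levels g"
  shows "(\<Sum>i < j. straddle_count f (int i * g) (bucket_end g i)) \<le> 2 * n"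
proof -
  let ?s = "\<lambda>i k. straddles f (int i * g) (bucket_end g i) k"
  have c: "straddle_count f (int i * g) (bucket_end g i) = (\<Sum>k \<in> {0..<n}. of_bool (?s i k))" for i
  proof -
    have "{k. 0 \<le> k \<and> k < n \<and> ?s i k} = {0..<n} \<inter> {k. ?s i k}" by auto
    then show ?thesis unfolding straddle_count_def by (simp add: sum_of_bool_eq)
  qed
  have "(\<Sum>i < j. straddle_count f (int i * g) (bucket_end g i)) \<le>
    (\<Sum>i < levels g. straddle_count f (int i * g) (bucket_end g i))"
    using assms(2) by (intro sum_mono2) (auto simp: straddle_count_def)
  also have "\<dots> = (\<Sum>k \<in> {0..<n}. \<Sum>i < levels g. of_bool (?s i k))"
    unfolding c by (rule sum.swap)
  also have "\<dots> \<le> (\<Sum>k \<in> {0..<n}. 2)"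
  proof (rule sum_mono)
    fix k assume k: "k \<in> {0..<n}"
    have "(\<Sum>i < levels g. of_bool (?s i k)) = int (card {j. j < levels g \<and> ?s j k})"
      by (simp add: sum_of_bool_eq lessThan_def Collect_conj_eq)
    then show "(\<Sum>i < levels g. of_bool (?s i k)) \<le> (2::int)"
      using straddles_at_most_twice[OF assms(1), of k f] k by simp
  qed
  also have "\<dots> = 2 * n" using n_pos by simp
  finally show ?thesis .
qed

lemma hit_join:
  assumes "a \<le> c" "c \<le> e"
  shows "hit f a c k i \<or> hit f c e k i \<longleftrightarrow> hit f a e k i"
proof
  assume "hit f a e k i"
  then obtain r where r: "a \<le> r" "r < e" "\<sigma> k r = i" "M i k = f k" unfolding hit_def by blast
  then show "hit f a c k i \<or> hit f c e k i" unfolding hit_def by (cases "r < c") (auto simp: not_less)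
next
  assume "hit f a c k i \<or> hit f c e k i"
  then obtain r where r: "a \<le> r \<and> r < c \<or> c \<le> r \<and> r < e" "\<sigma> k r = i" "M i k = f k"
    unfolding hit_def by blast
  then have "a \<le> r" "r < e" using assms by linarith+
  then show "hit f a e k i" unfolding hit_def using r by blast
qed

lemma hit_all:
  assumes "0 \<le> k" "k < n" "0 \<le> i" "i < n"
  shows "hit f 0 n k i \<longleftrightarrow> M i k = f k"
proof -
  have "i \<in> \<sigma> k ` {0..<n}" using perm_bij[OF assms(1,2)] assms(3,4) unfolding bij_betw_def by simp
  then show ?thesis unfolding hit_def by auto
qed

lemma fresh_from_agree:
  assumes "fresh_from l0 m" "agree_off (Ans \<union> phase_lanes g) m m'" "n * g + n \<le> l0" "1 \<le> g" "g \<le> G"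
  shows "fresh_from l0 m'"
  unfolding fresh_from_def
proof (intro allI impI)
  fix l v :: int assume l: "l0 \<le> l \<and> l < S \<and> 0 \<le> v"
  note gf = g_facts[OF assms(4,5)]
  have "cell S l v \<notin> phase_lanes g"
  proof
    assume "cell S l v \<in> phase_lanes g"
    then obtain l' v' where l': "n * g \<le> l'" "l' < n * g + n" "cell S l v = cell S l' v'"
      unfolding phase_lanes_def by blast
    then have "l = l'" using cell_eq_iff[of l S l' v v'] l assms(3) gf(1,6) n_pos by simp
    then show False using l' l assms(3) by simp
  qed
  moreover have "cell S l v \<notin> Ans"
    using cell_ge[of v S l] own_less_S[of "ab + n - 1"] l assms(3) gf S_pos n_le_sq n_pos by simp
  ultimately have "m' (cell S l v) = m (cell S l v)" using agree_offD[OF assms(2)] by blast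
  then show "m' (cell S l v) = 0" using assms(1) l unfolding fresh_from_def by simp
qed

lemma static_mem_phase:
  assumes "static_mem m" "agree_off (Ans \<union> phase_lanes g) m m'" "1 \<le> g" "g \<le> G"
  shows "static_mem m'" "\<And>k. 0 \<le> k \<Longrightarrow> k < n \<Longrightarrow> m' (nn + k) = m (nn + k)"
proof -
  have ge: "S \<le> x" if x: "x \<in> phase_lanes g" for x
  proof -
    obtain l v where "n * g \<le> l" "0 \<le> v" "x = cell S l v" using x unfolding phase_lanes_def by auto
    then show ?thesis using cell_ge[of v S l] S_pos g_facts[OF assms(3,4)] by simp
  qed
  show "static_mem m'"
  proof (rule static_mem_agree[OF assms(1,2)])
    fix x assume "x \<in> Ans \<union> phase_lanes g"
    then show "nn \<le> x \<and> x < pb \<or> tb \<le> x"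
      using ge[of x] own_less_S[of x] n_pos by (cases "x \<in> Ans") (simp, fastforce)
  qed
  show "m' (nn + k) = m (nn + k)" if "0 \<le> k" "k < n" for k
  proof (rule agree_offD[OF assms(2)])
    show "nn + k \<notin> Ans \<union> phase_lanes g"
      using ge[of "nn + k"] own_less_S[of "nn + k"] that n_le_sq n_pos by auto
  qed
qed

text \<open>
  The invariant between queries. With bucket size \<open>2 ^ e\<close> and \<open>d\<close> queries answered, the clock is
  bounded by a potential: the count \<open>vC\<close> pays for the current phase, \<open>g * nn\<close> and \<open>e * X\<close> for
  the abandoned ones, and \<open>d * (n * g)\<close> for scanning the straddling buckets.
\<close>

definition query_inv :: "int \<Rightarrow> nat \<Rightarrow> int \<Rightarrow> int \<Rightarrow> env \<Rightarrow> imem \<Rightarrow> bool" where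
  "query_inv T0 r d t V m \<longleftrightarrow> (\<exists>g e. g = 2 ^ e \<and> g \<le> G \<and> static_env V \<and> V vG = g \<and> static_mem m \<and>
    fresh_from (2 * (n * g)) m \<and> 0 \<le> V vC \<and> V vC \<le> g * nn + X \<and>
    ((\<exists>k\<ge>r. alive g k (V vC) m) \<or> exhausted g (V vC)) \<and>
    t \<le> T0 + 220 * (4 * (g * nn) + int e * X + V vC) + 150 * (d * (n * g)))"

text \<open>In the abort case the answer comes from \<open>brute_force\<close> and has to survive
  the following \<open>build\<close>, whose lanes lie above the answer cells. New instances again
  have all n queries ahead, at least as many as remain.\<close>

lemma wp_finish_query:
  assumes g: "g = 2 ^ e" "g \<le> G" "0 \<le> d"
    and env: "static_env V" "V vG = g" "0 \<le> V vC" "V vC \<le> g * nn + X"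
    and mem: "static_mem m" "fresh_from (2 * (n * g)) m" "\<And>k. 0 \<le> k \<Longrightarrow> k < n \<Longrightarrow> m (nn + k) = f k"
    and out: "if V vA < n then exhausted g (V vC) else (\<exists>k\<ge>r. alive g k (V vC) m) \<and>
      (\<forall>i. 0 \<le> i \<and> i < n \<longrightarrow> m (ab + i) = of_bool (matches f n i))"
    and r: "r \<le> N"
    and tm: "t \<le> T0 + 220 * (4 * (g * nn) + int e * X + V vC) + 150 * (d * (n * g)) + 140 * (n * g)"
  shows "wp b (cond (EVar vA <\<^sub>e EVar vN)
        (Seq brute_force (Seq (assign vG (EVar vG +\<^sub>e EVar vG)) (build K p))) Skip)
    (\<lambda>t' V' m'. query_inv T0 r (d + 1) t' V' m' \<and>
      (\<forall>i. 0 \<le> i \<and> i < n \<longrightarrow> m' (ab + i) = of_bool (matches f n i))) t V m" (is "wp b _ ?Post _ _ _")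
proof -
  define Q where "Q = ?Post"
  have g1: "1 \<le> g" using g(1) by simp
  note gf = g_facts[OF g1 g(2)]
  have ng: "1 \<le> n * g" using gf(8) n_pos by linarith
  have vN: "V vN = n" using env(1) by (simp add: static_env_def)
  have completed: "Q (t + 5) V m" if "\<not> V vA < n"
  proof -
    have "t + 5 \<le> T0 + 220 * (4 * (g * nn) + int e * X + V vC) + (150 * (d * (n * g)) + 150 * (n * g))"
      using tm ng by linarith
    also have "150 * (d * (n * g)) + 150 * (n * g) = 150 * ((d + 1) * (n * g))"
      by (simp add: algebra_simps)
    finally have "t + 5 \<le> T0 + 220 * (4 * (g * nn) + int e * X + V vC) + 150 * ((d + 1) * (n * g))" .
    then show ?thesis unfolding Q_def query_inv_def using g env mem out that by auto
  qed
  have abort: "wp b (Seq brute_force (Seq (assign vG (EVar vG +\<^sub>e EVar vG)) (build K p))) Q (t + 4) V m"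
    if lt: "V vA < n"
  proof (rule wp_Seq, rule wp_mono[OF wp_brute_force[where f = f]], goal_cases)
    case (4 t2 V2 m2)
    then have 2: "agree_off {vI, vK} V V2" "agree_off Ans m m2"
      "\<And>i. 0 \<le> i \<Longrightarrow> i < n \<Longrightarrow> m2 (ab + i) = of_bool (matches f n i)" "t2 \<le> t + 4 + 60 * nn" by auto
    have g2: "2 * g \<le> G" using exhausted_bound[OF _ g1] out lt by simp
    have g21: "1 \<le> 2 * g" using g1 by simp
    note gf2 = g_facts[OF g21 g2]
    let ?V = "V2(vG := 2 * g)"
    have ev: "static_env ?V" "?V vG = 2 * g" "V2 vG = g"
      using agree_offD[OF 2(1)] env by (simp_all add: static_env_def)
    have ag2: "agree_off (Ans \<union> phase_lanes g) m m2" using 2(2) by (auto simp: agree_off_def)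
    have st: "static_mem m2" by (rule static_mem_phase(1)[OF mem(1) ag2 g1 g(2)])
    \<comment> \<open>The invariant guarantees zeros from lane \<open>2 * (n * g)\<close> on, which
      is where the doubled phase begins.\<close>
    have fr: "fresh_from (n * (2 * g)) m2"
      using fresh_from_agree[OF mem(2) ag2 gf(4) g1 g(2)] by (simp add: algebra_simps)
    have "wp b (build K p) Q (t2 + 3) ?V m2"
    proof (rule wp_mono[OF wp_build[where V = ?V, OF ev(1,2) g21 g2 st fr]], goal_cases)
      case (1 t3 V3 m3)
      then have 3: "agree_off {vC, vL, vA, vE, vR, vK} ?V V3" "agree_off (phase_lanes (2 * g)) m2 m3"
        "0 \<le> V3 vC" "V3 vC \<le> 2 * g * nn + X" "alive (2 * g) N (V3 vC) m3 \<or> exhausted (2 * g) (V3 vC)"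
        "t3 \<le> t2 + 3 + 220 * (2 * g * nn) + 22 * V3 vC" by auto
      have ag3: "agree_off (Ans \<union> phase_lanes (2 * g)) m2 m3" using 3(2) by (auto simp: agree_off_def)
      have st3: "static_mem m3" by (rule static_mem_phase(1)[OF st ag3 g21 g2])
      have "n * (2 * g) \<le> 2 * (n * (2 * g))" using gf2(6) by linarith
      then have "fresh_from (2 * (n * (2 * g))) m2" using fr unfolding fresh_from_def by (meson order_trans)
      then have fr3: "fresh_from (2 * (n * (2 * g))) m3"
        by (rule fresh_from_agree[OF _ ag3 gf2(4) g21 g2])
      have ev3: "static_env V3" "V3 vG = 2 * g"
        using agree_offD[OF 3(1)] ev by (simp_all add: static_env_def)
      have an: "m3 (ab + i) = of_bool (matches f n i)" if i: "0 \<le> i" "i < n" for i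
      proof -
        have "ab + i \<notin> phase_lanes (2 * g)"
        proof
          assume "ab + i \<in> phase_lanes (2 * g)"
          then obtain l v where "n * (2 * g) \<le> l" "0 \<le> v" "ab + i = cell S l v"
            unfolding phase_lanes_def by auto
          then show False using cell_ge[of v S l] own_less_S[of "ab + i"] S_pos gf2 i n_le_sq by simp
        qed
        then show ?thesis using agree_offD[OF 3(2)] 2(3)[OF i] by simp
      qed
      \<comment> \<open>The abandoned count is at most \<open>g * nn + X\<close>. Its X becomes the
        additional X in \<open>int (Suc e) * X\<close>; the rest, the brute force and the new build
        are paid by the doubling of \<open>4 * (g * nn)\<close>.\<close>
      have "t3 \<le> T0 + 220 * (4 * (2 * g * nn) + int (Suc e) * X + V3 vC) + 150 * ((d + 1) * (n * (2 * g)))"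
      proof -
        define z where "z = d * (n * g)"
        define E where "E = int e * X"
        have eq: "(d + 1) * (n * (2 * g)) = 2 * z + 2 * (n * g)" "int (Suc e) * X = E + X"
          "2 * g * nn = 2 * (g * nn)" by (simp_all add: z_def E_def algebra_simps)
        have "0 \<le> z" using g(3) gf by (simp add: z_def)
        moreover have "t \<le> T0 + 220 * (4 * (g * nn) + E + V vC) + 150 * z + 140 * (n * g)"
          using tm by (simp add: z_def E_def)
        ultimately show ?thesis
          unfolding eq using 3(3) 3(6)[unfolded eq] 2(4) env(4) gf(7) ng n_le_sq n_pos by (smt (verit))
      qed
      moreover have "2 * g = 2 ^ Suc e" using g(1) by simp
      ultimately show ?case unfolding Q_def query_inv_def using 3 st3 fr3 ev3 an g2 r by blast
    qed
    moreover have "2 * g \<in> words b"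
      using gf2 S_fits g1 n_pos by (intro in_words_nonneg) simp_all
    ultimately show ?case using ev
      by (intro wp_Seq wp_assign) (simp_all add: add.commute)
  qed (use env mem in simp_all)
  show ?thesis unfolding Q_def[symmetric]
    by (intro wp_cond wp_Skip)
      (use vN completed abort in \<open>simp_all add: bit_word add.commute split: if_splits\<close>)
qed

lemma sum_upd_lessThan:
  fixes h :: "nat \<Rightarrow> int"
  assumes "j < k"
  shows "(\<Sum>i < k. (h(j := x)) i) = (\<Sum>i < k. h i) - h j + x"
  using assms by (subst (1 2) sum.remove[of _ j]) (auto intro: sum.cong)

lemma wp_eq_query:
  assumes inv: "query_inv T0 (Suc r) d t V m" and d: "0 \<le> d" and r: "r \<le> N"
    and qm: "\<And>k. 0 \<le> k \<Longrightarrow> k < n \<Longrightarrow> m (nn + k) = f k"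
  shows "wp b (eq_query K p q) (\<lambda>t' V' m'. query_inv T0 r (d + 1) t' V' m' \<and>
      (\<forall>i. 0 \<le> i \<and> i < n \<longrightarrow> m' (ab + i) = of_bool (matches f n i))) t V m" (is "wp b _ ?Post _ _ _")
proof -
  define Q where "Q = ?Post"
  let ?fin = "cond (EVar vA <\<^sub>e EVar vN)
        (Seq brute_force (Seq (assign vG (EVar vG +\<^sub>e EVar vG)) (build K p))) Skip"
  let ?loop = "loop levels_left (Seq (query_level K q) next_level)"
  from inv obtain g e where g: "g = 2 ^ e" "g \<le> G" and env: "static_env V" "V vG = g"
    and mem: "static_mem m" "fresh_from (2 * (n * g)) m"
    and c: "0 \<le> V vC" "V vC \<le> g * nn + X"
    and st: "(\<exists>k\<ge>Suc r. alive g k (V vC) m) \<or> exhausted g (V vC)"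
    and tm: "t \<le> T0 + 220 * (4 * (g * nn) + int e * X + V vC) + 150 * (d * (n * g))"
    unfolding query_inv_def by blast
  have g1: "1 \<le> g" using g(1) by simp
  note gf = g_facts[OF g1 g(2)]
  have ng: "50 + 20 * n \<le> 140 * (n * g)" "50 + 20 * n \<le> 40 * (n * g) + 30"
    using gf(8) n_pos by linarith+
  \<comment> \<open>The part of the potential that stays fixed during the query, apart from a later
    abort.\<close>
  define W where "W = T0 + 220 * (4 * (g * nn) + int e * X) + 150 * (d * (n * g))"
  have tmW: "t \<le> W + 220 * V vC" using tm by (simp add: W_def algebra_simps)
  have toW: "T0 + 220 * (4 * (g * nn) + int e * X + c') + 150 * (d * (n * g)) + 140 * (n * g) =
    W + 220 * c' + 140 * (n * g)" for c' by (simp add: W_def algebra_simps)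
  have main: "wp b (Seq ?loop ?fin) Q (t1 + 4) V1 m1"
    if V1: "static_env V1" "V1 vG = g" "V1 vC = V vC" "V1 vA = 0" "V1 vL = n * g"
      and m1: "agree_off Ans m m1" "\<And>i. 0 \<le> i \<Longrightarrow> i < n \<Longrightarrow> m1 (ab + i) = 0"
      and t1: "t1 \<le> t + 20 * n" for t1 V1 m1
  proof -
    have agm1: "agree_off (Ans \<union> phase_lanes g) m m1" using m1(1) by (auto simp: agree_off_def)
    note sm1 = static_mem_phase[OF mem(1) agm1 g1 g(2)]
    have fr1: "fresh_from (2 * (n * g)) m1"
      by (rule fresh_from_agree[OF mem(2) agm1 gf(4) g1 g(2)])
    have fin: "wp b ?fin Q t' V' m'"
      if "static_env V'" "V' vG = g" "0 \<le> V' vC" "V' vC \<le> g * nn + X"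
        "agree_off (Ans \<union> phase_lanes g) m1 m'"
        "if V' vA < n then exhausted g (V' vC) else (\<exists>k\<ge>r. alive g k (V' vC) m') \<and>
          (\<forall>i. 0 \<le> i \<and> i < n \<longrightarrow> m' (ab + i) = of_bool (matches f n i))"
        "t' \<le> T0 + 220 * (4 * (g * nn) + int e * X + V' vC) + 150 * (d * (n * g)) + 140 * (n * g)"
      for t' V' m'
      unfolding Q_def
    proof (rule wp_finish_query[OF g d that(1-4) _ _ _ that(6) r that(7)])
      note sm = static_mem_phase[OF sm1(1) that(5) g1 g(2)]
      show "static_mem m'" by (rule sm(1))
      show "fresh_from (2 * (n * g)) m'" by (rule fresh_from_agree[OF fr1 that(5) gf(4) g1 g(2)])
      show "m' (nn + k) = f k" if "0 \<le> k" "k < n" for k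
        using sm(2) sm1(2) qm that by simp
    qed
    show ?thesis
    proof (cases "exhausted g (V vC)")
      case True
      \<comment> \<open>The count has already reached its limit, so the first test fails and the
        query ends up in the abort branch.\<close>
      have "wp b ?loop (\<lambda>t' V' m'. t' = t1 + 4 + 10 \<and> V' = V1 \<and> m' = m1) (t1 + 4) V1 m1"
        using safe_levels_left(1)[OF V1(1,2) g1 g(2), of m1] safe_levels_left(2)[OF V1(1,2) g1 g(2), of m1]
          safe_levels_left(3)[OF V1(1,2) g1 g(2)] True V1
        by (intro wp_loop_exit) (simp_all add: exhausted_def)
      then show ?thesis
      proof (rule wp_Seq[OF wp_mono], elim conjE)
        fix t' V' m' assume e: "t' = t1 + 4 + 10" "V' = V1" "m' = m1"
        have "t' \<le> T0 + 220 * (4 * (g * nn) + int e * X + V1 vC) + 150 * (d * (n * g)) + 140 * (n * g)"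
          unfolding toW using e(1) t1 tmW V1(3) ng by linarith
        then show "wp b ?fin Q t' V' m'"
          unfolding e(2,3) using True V1 c n_pos by (intro fin) (simp_all add: agree_off_refl)
      qed
    next
      case False
      \<comment> \<open>Only an inequality: instances rebuilt after an abort may have more queries
        left than will arrive.\<close>
      then obtain k st0 tm0 where k: "Suc r \<le> k"
        and ok0: "\<And>j. j < levels g \<Longrightarrow> level_ok g m j k (st0 j) (tm0 j)"
        and c0: "V vC = (\<Sum>j < levels g. tm0 j)"
        using st unfolding alive_def by blast
      obtain k' where k': "k = Suc k'" "r \<le> k'" using k by (cases k) auto
      let ?W = "{vA, vL, vC, vE, vK, vR, vX, vI, vF, vT, vQ}"
      let ?sc = "\<lambda>i. straddle_count f (int i * g) (bucket_end g i)"
      \<comment> \<open>Levels before j have served this query and have \<open>k'\<close> queries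
        left, the others still \<open>Suc k'\<close>. If the loop stops early, the levels stay out
        of step, which is harmless because all of them are abandoned.\<close>
      define I where "I = (\<lambda>t' V' m'. \<exists>j st tm. j \<le> levels g \<and> agree_off ?W V1 V' \<and>
        agree_off (Ans \<union> phase_lanes g) m1 m' \<and> V' vA = int j * g \<and> V' vL = n * g + int j \<and>
        (\<forall>i < levels g. level_ok g m' i (if i < j then k' else Suc k') (st i) (tm i)) \<and>
        V' vC = (\<Sum>i < levels g. tm i) \<and> 0 \<le> V' vC \<and> V' vC \<le> g * nn + X \<and>
        (\<forall>i. 0 \<le> i \<and> i < n \<longrightarrow>
          m' (ab + i) = of_bool (\<exists>k. 0 \<le> k \<and> k < n \<and> hit f 0 (min (int j * g) n) k i)) \<and>
        t' \<le> t1 + 4 + 220 * (V' vC - V vC) + 50 * g * (\<Sum>i < j. ?sc i))"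
      have fr: "static_env V' \<and> V' vG = g" if "agree_off ?W V1 V'" for V'
        using agree_offD[OF that] V1 by (simp add: static_env_def)
      have "wp b ?loop (\<lambda>t' V' m'. wp b ?fin Q t' V' m') (t1 + 4) V1 m1"
      proof (rule wp_loop[where I = I and f = "\<lambda>V' m'. nat (n - V' vA)"], goal_cases)
        case 1
        have "m1 (cell S l v) = m (cell S l v)" if "0 \<le> l" "0 \<le> v" for l v
          by (rule agree_offD[OF m1(1)])
            (use cell_ge[of v S l] own_less_S[of "ab + n - 1"] that S_pos n_le_sq n_pos in simp)
        then have "level_ok g m1 j (Suc k') (st0 j) (tm0 j)" if "j < levels g" for j
          using ok0[OF that] lane_cong[of "n * g + int j" m "st0 j" m1] gf k'
          unfolding level_ok_def by simp
        moreover have "\<not> hit f 0 0 k i" for k i by (rule hit_empty)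
        ultimately show ?case unfolding I_def
          using V1 m1 c c0 n_pos
          by (intro exI[of _ "0::nat"] exI[of _ st0] exI[of _ tm0]) (simp add: agree_off_refl)
      next
        case (2 t' V' m')
        then have "agree_off ?W V1 V'" unfolding I_def by blast
        then show ?case using safe_levels_left(1)[of V' g m'] fr g1 g(2) by blast
      next
        case (3 t' V' m')
        then obtain j st tm where j: "j \<le> levels g"
          and ag: "agree_off ?W V1 V'" "agree_off (Ans \<union> phase_lanes g) m1 m'"
          and v: "V' vA = int j * g" "V' vL = n * g + int j"
          and ok: "\<And>i. i < levels g \<Longrightarrow> level_ok g m' i (if i < j then k' else Suc k') (st i) (tm i)"
          and cc: "V' vC = (\<Sum>i < levels g. tm i)" "0 \<le> V' vC"
          and an: "\<And>i. 0 \<le> i \<Longrightarrow> i < n \<Longrightarrow>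
            m' (ab + i) = of_bool (\<exists>k. 0 \<le> k \<and> k < n \<and> hit f 0 (min (int j * g) n) k i)"
          and tmj: "t' \<le> t1 + 4 + 220 * (V' vC - V vC) + 50 * g * (\<Sum>i < j. ?sc i)"
          unfolding I_def by blast
        have ev: "static_env V'" "V' vG = g" using fr[OF ag(1)] by simp_all
        have lt: "int j * g < n" "V' vC < g * nn"
          using 3(2) safe_levels_left(2)[OF ev g1 g(2), of m'] v by simp_all
        have jJ: "j < levels g" using less_levels_iff[OF g1] lt by simp
        then have jn: "int j < n" using levels_le[OF g1] by simp
        define l where "l = n * g + int j"
        have l: "n * g \<le> l" "0 \<le> l" "l < S - 1" "l < n * g + n" using gf jn by (simp_all add: l_def)
        let ?a = "int j * g" and ?e = "bucket_end g j"
        note sm = static_mem_phase[OF sm1(1) ag(2) g1 g(2)]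
        have qm': "m' (nn + k) = f k" if "0 \<le> k" "k < n" for k
          using sm(2) sm1(2) qm that by simp
        have lj: "lane l m' (st j)" "good (level_matrix g j) (Suc k') (st j) (tm j)"
          using ok[OF jJ] by (simp_all add: level_ok_def l_def)
        obtain u s' where u: "exec b0 q (put_query N (query_vec f ?a ?e) (st j)) u s'"
          "read_answer N s' = boolean_answer (level_matrix g j) (query_vec f ?a ?e)"
          "good (level_matrix g j) k' s' (tm j + int u + n)"
          using good_step[OF lj(2) boolean_query_vec] by blast
        have uX: "tm j + int u + n \<le> X" using good_le[OF u(3)] .
        define P where "P = (\<lambda>t'' V'' m''. I t'' V'' m'' \<and> nat (n - V'' vA) < nat (n - V' vA))"
        have uX': "int u + n \<le> X" using uX lj(2) unfolding good_def by simp
        have "wp b (query_level K q) (\<lambda>t V m. wp b next_level P t V m) (t' + 10) V' m'"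
        proof (rule wp_mono[OF wp_query_level[where a = ?a and g = g and l = l and e = ?e and q = f
              and s = "st j" and u = u and s' = s']], goal_cases)
          case (20 t2 V2 m2)
          then have 2: "agree_off {vC, vE, vK, vR, vX, vI, vF, vT, vQ} V' V2"
            "V2 vC = V' vC + int u + n" "agree_off (Ans \<union> Lane l) m' m2" "lane l m2 s'"
            "\<And>i. 0 \<le> i \<Longrightarrow> i < n \<Longrightarrow> m2 (ab + i) =
              (if \<exists>k. 0 \<le> k \<and> k < n \<and> hit f ?a ?e k i then 1 else m' (ab + i))"
            "t2 \<le> t' + 10 + 22 * int u + 200 * n + 50 * g * ?sc j" by auto
          let ?V = "V2(vA := ?a + g, vL := l + 1)"
          have V2: "V2 vA = ?a" "V2 vG = g" "V2 vL = l"
            using agree_offD[OF 2(1)] ev v by (simp_all add: l_def)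
          have "I (t2 + 6) ?V m2" unfolding I_def
          proof (intro exI[of _ "Suc j"] exI[of _ "st(j := s')"] exI[of _ "tm(j := tm j + int u + n)"] conjI)
            show "Suc j \<le> levels g" using jJ by simp
            have "agree_off ?W V1 V2" by (rule agree_off_trans[OF ag(1) 2(1)]) auto
            then show "agree_off ?W V1 ?V" by (intro agree_off_upd) simp_all
            have "Lane l \<subseteq> phase_lanes g" unfolding Lane_def phase_lanes_def using l by auto
            then show "agree_off (Ans \<union> phase_lanes g) m1 m2"
              by (intro agree_off_trans[OF ag(2) 2(3)]) auto
            show "\<forall>i < levels g. level_ok g m2 i (if i < Suc j then k' else Suc k')
                ((st(j := s')) i) ((tm(j := tm j + int u + n)) i)"
            proof (intro allI impI)
              fix i assume i: "i < levels g"
              show "level_ok g m2 i (if i < Suc j then k' else Suc k')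
                ((st(j := s')) i) ((tm(j := tm j + int u + n)) i)"
              proof (cases "i = j")
                case True
                then show ?thesis using 2(4) u(3) by (simp add: level_ok_def l_def)
              next
                case False
                have "int i < n" using levels_le[OF g1] i by simp
                then have l': "0 \<le> n * g + int i" "n * g + int i < S" "n * g + int i \<noteq> l"
                  using False gf by (simp_all add: l_def)
                have "m2 (cell S (n * g + int i) v) = m' (cell S (n * g + int i) v)" if "0 \<le> v" for v
                proof (rule agree_offD[OF 2(3)])
                  have "cell S (n * g + int i) v \<notin> Ans"
                    using cell_ge[of v S "n * g + int i"] own_less_S[of "ab + n - 1"] that l' S_pos n_le_sq n_pos
                    by simp
                  then show "cell S (n * g + int i) v \<notin> Ans \<union> Lane l"
                    using Lane_disjoint[OF l'(1,2) l(2) _ l'(3)] l by simp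
                qed
                then show ?thesis
                  using ok[OF i] False lane_cong[of "n * g + int i" m' "st i" m2]
                  by (auto simp: level_ok_def)
              qed
            qed
            show "?V vC = (\<Sum>i < levels g. (tm(j := tm j + int u + n)) i)"
              using sum_upd_lessThan[OF jJ, of tm] cc(1) 2(2) by simp
            show "0 \<le> ?V vC" using 2(2) cc(2) n_pos by simp
            show "?V vC \<le> g * nn + X" using 2(2) lt(2) uX' by simp
            show "\<forall>i. 0 \<le> i \<and> i < n \<longrightarrow>
              m2 (ab + i) = of_bool (\<exists>k. 0 \<le> k \<and> k < n \<and> hit f 0 (min (int (Suc j) * g) n) k i)"
            proof (intro allI impI)
              fix i assume i: "0 \<le> i \<and> i < n"
              have "min (int (Suc j) * g) n = ?e" by (simp add: bucket_end_def algebra_simps)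
              moreover have "min (int j * g) n = ?a" using lt by simp
              moreover have "0 \<le> ?a" "?a \<le> ?e" using lt g1 by (simp_all add: bucket_end_def)
              ultimately show "m2 (ab + i) =
                of_bool (\<exists>k. 0 \<le> k \<and> k < n \<and> hit f 0 (min (int (Suc j) * g) n) k i)"
                using 2(5)[of i] an[of i] i hit_join[of 0 ?a ?e f _ i, symmetric] by auto
            qed
            have "50 * g * (\<Sum>i < Suc j. ?sc i) = 50 * g * (\<Sum>i < j. ?sc i) + 50 * g * ?sc j"
              by (simp add: algebra_simps)
            then show "t2 + 6 \<le> t1 + 4 + 220 * (?V vC - V vC) + 50 * g * (\<Sum>i < Suc j. ?sc i)"
              using 2(2,6) tmj n_pos by simp
          qed (simp_all add: l_def algebra_simps)
          then have "P (t2 + 6) ?V m2" unfolding P_def using v lt g1 by simp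
          then show ?case
            using V2 lt g1 g(2) l by (intro wp_next_level[where a = ?a and g = g and l = l]) simp_all
        qed (use ev v lt g1 gf l sm(1) qm' lj(1) u cc(2) uX' regs in
            \<open>simp_all add: l_def bucket_end_def level_matrix_def\<close>)
        then show ?case unfolding P_def[symmetric]
          using safe_levels_left(3)[OF ev g1 g(2)] by (intro wp_Seq) (simp add: add.commute)
      next
        case (4 t' V' m')
        then obtain j st tm where j: "j \<le> levels g"
          and ag: "agree_off ?W V1 V'" "agree_off (Ans \<union> phase_lanes g) m1 m'"
          and v: "V' vA = int j * g"
          and ok: "\<And>i. i < levels g \<Longrightarrow> level_ok g m' i (if i < j then k' else Suc k') (st i) (tm i)"
          and cc: "V' vC = (\<Sum>i < levels g. tm i)" "0 \<le> V' vC" "V' vC \<le> g * nn + X"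
          and an: "\<And>i. 0 \<le> i \<Longrightarrow> i < n \<Longrightarrow>
            m' (ab + i) = of_bool (\<exists>k. 0 \<le> k \<and> k < n \<and> hit f 0 (min (int j * g) n) k i)"
          and tmj: "t' \<le> t1 + 4 + 220 * (V' vC - V vC) + 50 * g * (\<Sum>i < j. ?sc i)"
          unfolding I_def by blast
        have ev: "static_env V'" "V' vG = g" using fr[OF ag(1)] by simp_all
        have ex: "\<not> (int j * g < n \<and> V' vC < g * nn)"
          using 4(2) safe_levels_left(2)[OF ev g1 g(2), of m'] v by simp
        have "if V' vA < n then exhausted g (V' vC) else (\<exists>k\<ge>r. alive g k (V' vC) m') \<and>
          (\<forall>i. 0 \<le> i \<and> i < n \<longrightarrow> m' (ab + i) = of_bool (matches f n i))"
        proof (cases "V' vA < n")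
          case True
          have "(\<Sum>i < levels g. tm i) \<le> (\<Sum>i < levels g. X)"
            using ok good_le unfolding level_ok_def by (intro sum_mono) blast
          then show ?thesis using True ex v cc(1) by (simp add: exhausted_def)
        next
          case False
          then have jl: "j = levels g" using less_levels_iff[OF g1, of j] j v by simp
          have "alive g k' (V' vC) m'" using ok cc(1) unfolding alive_def jl by auto
          moreover have "m' (ab + i) = of_bool (matches f n i)" if i: "0 \<le> i" "i < n" for i
          proof -
            have "min (int j * g) n = n" using False v by simp
            moreover have "(\<exists>k. 0 \<le> k \<and> k < n \<and> hit f 0 n k i) \<longleftrightarrow> matches f n i"
              unfolding matches_def using hit_all i by auto
            ultimately show ?thesis using an[OF i] by simp
          qed
          ultimately show ?thesis using False k'(2) by auto
        qed
        moreover have "t' + 10 \<le> T0 + 220 * (4 * (g * nn) + int e * X + V' vC) + 150 * (d * (n * g)) +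
          140 * (n * g)"
        proof -
          \<comment> \<open>At most 2 n scans of cost 50 g each; with the 20 n for clearing the
            answer they fit into the allowance of 140 n g.\<close>
          have "g * (\<Sum>i < j. ?sc i) \<le> g * (2 * n)"
            using straddle_count_sum[OF g1 j] g1 by (intro mult_left_mono) simp_all
          then have "50 * g * (\<Sum>i < j. ?sc i) \<le> 100 * (n * g)" by (simp add: algebra_simps)
          then show ?thesis unfolding toW using tmj t1 tmW ng by (smt (verit))
        qed
        ultimately show ?case
          unfolding safe_levels_left(3)[OF ev g1 g(2)]
          using ev cc ag by (intro fin) (simp_all add: add.commute)
      qed
      then show ?thesis by (rule wp_Seq)
    qed
  qed
  have w: "n * g \<in> words b" using gf S_fits n_pos by (intro in_words_nonneg) simp_all
  show ?thesis unfolding Q_def[symmetric] eq_query_def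
  proof (rule wp_Seq, rule wp_mono[OF wp_clear_answer[OF env(1)]], goal_cases)
    case (1 t' V' m')
    then have 1: "agree_off {vI} V V'" "agree_off Ans m m'"
      "\<And>i. 0 \<le> i \<Longrightarrow> i < n \<Longrightarrow> m' (ab + i) = 0" "t' \<le> t + 20 * n" by auto
    have ev: "static_env V'" "V' vG = g" "V' vN = n" "V' vC = V vC"
      using agree_offD[OF 1(1)] env by (simp_all add: static_env_def)
    have "wp b (Seq ?loop ?fin) Q (t' + 4) (V'(vL := n * g, vA := 0)) m'"
      using ev 1 by (intro main) (simp_all add: static_env_def)
    then show ?case using w ev
      by (intro wp_Seq[of _ "assign _ _"] wp_assign) (simp_all add: const_word add.commute)
  qed
qed

text \<open>The next query vector is put into memory between two executions. Its cells are disjoint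
  from everything that the invariant mentions.\<close>

lemma query_inv_agree:
  assumes "query_inv T0 r d t V m" "agree_off {nn..<nn + n} m m'"
  shows "query_inv T0 r d t V m'"
proof -
  from assms(1) obtain g e where g: "g = 2 ^ e" "g \<le> G" and env: "static_env V" "V vG = g"
    and mem: "static_mem m" "fresh_from (2 * (n * g)) m"
    and c: "0 \<le> V vC" "V vC \<le> g * nn + X"
    and st: "(\<exists>k\<ge>r. alive g k (V vC) m) \<or> exhausted g (V vC)"
    and tm: "t \<le> T0 + 220 * (4 * (g * nn) + int e * X + V vC) + 150 * (d * (n * g))"
    unfolding query_inv_def by blast
  have g1: "1 \<le> g" using g(1) by simp
  note gf = g_facts[OF g1 g(2)]
  have cells: "m' (cell S l v) = m (cell S l v)" if "0 \<le> l" "0 \<le> v" for l v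
    by (rule agree_offD[OF assms(2)])
      (use cell_ge[of v S l] own_less_S[of "ab"] that S_pos n_le_sq n_pos in simp)
  have "static_mem m'" using n_pos by (intro static_mem_agree[OF mem(1) assms(2)]) simp
  moreover have "fresh_from (2 * (n * g)) m'"
    using mem(2) cells gf(6) unfolding fresh_from_def by simp
  moreover have "alive g k c m'" if "alive g k c m" for k c
  proof -
    have "level_ok g m' j k s t" if "level_ok g m j k s t" for j s t
      using that cells gf(6) lane_cong[of "n * g + int j" m s m'] unfolding level_ok_def by simp
    then show ?thesis using that unfolding alive_def by blast
  qed
  ultimately show ?thesis unfolding query_inv_def using g env c st tm by blast
qed

text \<open>\<open>L\<close> bounds the number of abandoned phases, since the bucket size doubles
  each time and stays within \<open>G\<close>. The constant 1100 = 220 * 5 joins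
  \<open>4 * (g * nn)\<close> with the \<open>g * nn\<close> in the bound on the count.\<close>

lemma query_inv_time:
  assumes "query_inv T0 r d t V m" "0 \<le> d" "\<And>e. 2 ^ e \<le> G \<Longrightarrow> e \<le> L"
  shows "t \<le> T0 + 1100 * (G * nn) + 220 * ((int L + 1) * X) + 150 * (d * (n * G))"
proof -
  from assms(1) obtain g e where g: "g = 2 ^ e" "g \<le> G"
    and c: "V vC \<le> g * nn + X"
    and tm: "t \<le> T0 + 220 * (4 * (g * nn) + int e * X + V vC) + 150 * (d * (n * g))"
    unfolding query_inv_def by blast
  have 1: "g * nn \<le> G * nn" using g n_le_sq n_pos by (intro mult_right_mono) simp_all
  have "int e * X \<le> int L * X" using assms(3) g X_ge by (intro mult_right_mono) simp_all
  then have 2: "int e * X + X \<le> (int L + 1) * X" by (simp add: algebra_simps)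
  have 3: "d * (n * g) \<le> d * (n * G)" using assms(2) g n_pos by (intro mult_left_mono) simp_all
  show ?thesis using 1 2 3 c tm by (smt (verit))
qed

lemma serves_eq_query:
  assumes "query_inv T0 (length vs) d t V m" "represents R h V m" "0 \<le> d" "length vs \<le> N"
    and "\<forall>v \<in> set vs. v \<in> carrier_vec N"
    and A: "A \<in> carrier_mat N N" "\<And>i k. i < N \<Longrightarrow> k < N \<Longrightarrow> M (int i) (int k) = A $$ (i, k)"
  shows "\<exists>u V' m'. serves b (eq_query K p q) N (equality_answer A) (R, h) vs u \<and>
    query_inv T0 0 (d + int (length vs)) (t + int u) V' m'"
  using assms(1-5)
proof (induction vs arbitrary: d t V m R h)
  case Nil
  then show ?case using serves.Nil[of b "eq_query K p q" N "equality_answer A" "(R, h)"]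
    by (intro exI[of _ 0]) auto
next
  case (Cons v vs)
  define f where "f = (\<lambda>k. v $ nat k)"
  define m1 where "m1 = (\<lambda>x. if nn \<le> x \<and> x < nn + n then f (x - nn) else m x)"
  define h1 where "h1 = snd (put_query N v (R, h))"
  have pq: "put_query N v (R, h) = (R, h1)" by (simp add: put_query_def h1_def)
  have "h1 a = m1 (int a)" for a
  proof (cases "a \<in> {N * N..<N * N + N}")
    case True
    then have "int (N * N) \<le> int a" "int a < int (N * N + N)"
      by (simp_all only: of_nat_le_iff of_nat_less_iff atLeastLessThan_iff)
    then have "nn \<le> int a" "int a < nn + n" unfolding of_nat_add int_N .
    moreover have "int (a - N * N) = int a - nn"
      using True int_N(2) by (simp only: of_nat_diff atLeastLessThan_iff)
    then have "nat (int a - nn) = a - N * N" by (metis nat_int)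
    ultimately show ?thesis using True by (simp add: h1_def put_query_def m1_def f_def)
  next
    case False
    then have "\<not> (int (N * N) \<le> int a \<and> int a < int (N * N + N))"
      by (simp only: of_nat_le_iff of_nat_less_iff atLeastLessThan_iff not_False_eq_True)
    then have "\<not> (nn \<le> int a \<and> int a < nn + n)" unfolding of_nat_add int_N .
    then have "m1 (int a) = m (int a)" unfolding m1_def by metis
    moreover have "h1 a = h a" using False by (auto simp: h1_def put_query_def)
    ultimately show ?thesis using Cons.prems(2) by (simp add: represents_def)
  qed
  then have rep: "represents R h1 V m1" using Cons.prems(2) unfolding represents_def by simp
  have "agree_off {nn..<nn + n} m m1" unfolding agree_off_def m1_def by auto
  then have inv: "query_inv T0 (Suc (length vs)) d t V m1"
    using query_inv_agree Cons.prems(1) by simp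
  have qm: "m1 (nn + k) = f k" if "0 \<le> k" "k < n" for k using that by (simp add: m1_def)
  have "wp b (eq_query K p q) (\<lambda>t' V' m'. query_inv T0 (length vs) (d + 1) t' V' m' \<and>
      (\<forall>i. 0 \<le> i \<and> i < n \<longrightarrow> m' (ab + i) = of_bool (matches f n i))) t V m1"
    by (rule wp_eq_query[OF inv Cons.prems(3) _ qm]) (use Cons.prems(4) in auto)
  then obtain u R' h' V' m' where u: "exec b (eq_query K p q) (R, h1) u (R', h')"
    "represents R' h' V' m'" "query_inv T0 (length vs) (d + 1) (t + int u) V' m'"
    "\<And>i. 0 \<le> i \<Longrightarrow> i < n \<Longrightarrow> m' (ab + i) = of_bool (matches f n i)"
    using rep unfolding wp_def by blast
  have ra: "read_answer N (R', h') = equality_answer A v"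
  proof (rule eq_vecI)
    show "dim_vec (read_answer N (R', h')) = dim_vec (equality_answer A v)"
      using A(1) by (simp add: read_answer_def equality_answer_def)
    fix i assume "i < dim_vec (equality_answer A v)"
    then have i: "i < N" using A(1) by (simp add: equality_answer_def)
    then have ii: "0 \<le> int i" "int i < n" by linarith+
    have "int (N * N + N + i) = ab + int i" unfolding of_nat_add int_N by simp
    then have "h' (N * N + N + i) = m' (ab + int i)" using u(2) unfolding represents_def by metis
    also have "\<dots> = of_bool (matches f n (int i))" using u(4) ii by blast
    also have "matches f n (int i) \<longleftrightarrow> (\<exists>k < N. A $$ (i, k) = v $ k)"
    proof
      assume "matches f n (int i)"
      then obtain k where k: "0 \<le> k" "k < n" "M (int i) k = f k" unfolding matches_def by blast
      then have "nat k < N" "int (nat k) = k" by simp_all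
      then have "A $$ (i, nat k) = v $ nat k" using A(2)[OF i, of "nat k"] k by (simp add: f_def)
      then show "\<exists>k < N. A $$ (i, k) = v $ k" using \<open>nat k < N\<close> by blast
    next
      assume "\<exists>k < N. A $$ (i, k) = v $ k"
      then obtain k where k: "k < N" "A $$ (i, k) = v $ k" by blast
      then have "0 \<le> int k" "int k < n" "M (int i) (int k) = f (int k)"
        using A(2)[OF i k(1)] by (simp_all add: f_def zless_nat_eq_int_zless)
      then show "matches f n (int i)" unfolding matches_def by blast
    qed
    finally show "read_answer N (R', h') $ i = equality_answer A v $ i"
      using i A(1) by (simp add: read_answer_def equality_answer_def)
  qed
  have "\<exists>u' V'' m''. serves b (eq_query K p q) N (equality_answer A) (R', h') vs u' \<and>
    query_inv T0 0 (d + 1 + int (length vs)) (t + int u + int u') V'' m''"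
    by (rule Cons.IH[OF u(3,2)]) (use Cons.prems in auto)
  then obtain u' V'' m'' where u': "serves b (eq_query K p q) N (equality_answer A) (R', h') vs u'"
    "query_inv T0 0 (d + 1 + int (length vs)) (t + int u + int u') V'' m''" by blast
  have "serves b (eq_query K p q) N (equality_answer A) (R, h) (v # vs) (u + u')"
    by (rule serves.Cons[OF _ ra u'(1)]) (use u(1) pq in simp)
  moreover have "query_inv T0 0 (d + int (length (v # vs))) (t + int (u + u')) V'' m''"
    using u'(2) by (simp add: algebra_simps)
  ultimately show ?case by blast
qed

lemma wp_first_build:
  assumes env: "static_env V" and mem: "static_mem m" "fresh_from 0 m" and t: "t + 1 \<le> T0"
  shows "wp b (Seq (assign vG (EConst 1)) (build K p)) (\<lambda>t' V' m'. query_inv T0 N 0 t' V' m') t V m"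
proof -
  let ?V = "V(vG := 1)"
  have ev: "static_env ?V" "?V vG = 1" using env by (simp_all add: static_env_def)
  note gf = g_facts[of 1, OF order_refl G_ge]
  have fr: "fresh_from (n * 1) m" using mem(2) n_pos unfolding fresh_from_def by simp
  have "wp b (build K p) (\<lambda>t' V' m'. query_inv T0 N 0 t' V' m') (t + 1) ?V m"
  proof (rule wp_mono[OF wp_build[where V = ?V, OF ev order_refl G_ge mem(1) fr]], goal_cases)
    case (1 t' V' m')
    then have 1: "agree_off {vC, vL, vA, vE, vR, vK} ?V V'" "agree_off (phase_lanes 1) m m'"
      "0 \<le> V' vC" "V' vC \<le> 1 * nn + X" "alive 1 N (V' vC) m' \<or> exhausted 1 (V' vC)"
      "t' \<le> t + 1 + 220 * (1 * nn) + 22 * V' vC" by auto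
    have ag: "agree_off (Ans \<union> phase_lanes 1) m m'" using 1(2) by (auto simp: agree_off_def)
    have "fresh_from (2 * (n * 1)) m" using mem(2) n_pos unfolding fresh_from_def by simp
    then have "fresh_from (2 * (n * 1)) m'"
      by (rule fresh_from_agree[OF _ ag gf(4) order_refl G_ge])
    moreover have "static_env V'" "V' vG = 1"
      using agree_offD[OF 1(1)] ev by (simp_all add: static_env_def)
    moreover have "static_mem m'" by (rule static_mem_phase(1)[OF mem(1) ag order_refl G_ge])
    moreover have "t' \<le> T0 + 220 * (4 * (1 * nn) + int 0 * X + V' vC) + 150 * (0 * (n * 1))"
      using 1(3,6) t n_le_sq n_pos by simp
    ultimately show ?case unfolding query_inv_def using 1 G_ge
      by (intro exI[of _ 1] exI[of _ "0::nat"]) auto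
  qed
  then show ?thesis by (intro wp_Seq wp_assign) (simp_all add: const_word add.commute)
qed

end

section \<open>The complete preprocessing and the run on one input\<close>

definition setup_layout :: "nat \<Rightarrow> com" where
  "setup_layout k0 = Seq (assign vNN (EVar vN *\<^sub>e EVar vN)) (Seq (assign vS (EConst (int k0) *\<^sub>e EVar vNN))
    (Seq (assign vAB (EVar vNN +\<^sub>e EVar vN)) (Seq (assign vPB (EVar vAB +\<^sub>e EVar vN))
      (assign vTB (EVar vPB +\<^sub>e EVar vNN)))))"

definition eq_pre :: "nat \<Rightarrow> nat \<Rightarrow> com \<Rightarrow> com" where
  "eq_pre k0 K p = Seq (Seq (setup_layout k0) sort_columns) (Seq (assign vG (EConst 1)) (build K p))"

lemma (in layout) wp_setup_sort:
  assumes V: "V vN = n" and k0: "S = int k0 * nn" "S < 2 ^ b" and D: "n \<le> 2 ^ D"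
    and mem: "has_matrix m" "\<And>x. nn \<le> x \<Longrightarrow> m x = 0"
  shows "wp b (Seq (setup_layout k0) sort_columns) (\<lambda>t' V' m'. static_env V' \<and>
    agree_off {pb..<tb + 2 * n} m m' \<and> (\<forall>k. 0 \<le> k \<and> k < n \<longrightarrow> sorted_col m' k) \<and>
    t' \<le> t + nn * (120 * int D + 220)) t V m" (is "wp b _ ?Post _ _ _")
proof -
  let ?V = "V(vNN := nn, vS := S, vAB := ab, vPB := pb, vTB := tb)"
  define Q where "Q = ?Post"
  have nn1: "1 \<le> nn" using n_le_sq n_pos by simp
  then have "int k0 * 1 \<le> int k0 * nn" by (intro mult_left_mono) simp_all
  then have "int k0 < 2 ^ b" using k0 by linarith
  then have "int k0 \<in> words b" by (intro in_words_nonneg) simp_all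
  moreover have "S \<in> words b" using k0 nn1 by (intro in_words_nonneg) simp_all
  moreover have "nn \<in> words b" "ab \<in> words b" "pb \<in> words b" "tb \<in> words b"
    using n_le_sq n_pos by (auto intro!: small_word)
  moreover have ev: "static_env ?V" using V by (simp add: static_env_def)
  have "wp b sort_columns Q (15 + t) ?V m"
  proof (rule wp_mono[OF wp_sort_columns[where V = ?V, OF ev D mem(1)]], goal_cases)
    case (1 y)
    then show ?case using mem(2)[of "tb + y"] nn1 n_pos by simp
  next
    case (2 t' V' m')
    then have 2: "agree_off {vX, vF, vT, vI, vR, vK} ?V V'" "agree_off {pb..<tb + 2 * n} m m'"
      "\<forall>k. 0 \<le> k \<and> k < n \<longrightarrow> sorted_col m' k" "t' \<le> 15 + t + nn * (120 * int D + 200)" by auto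
    have "static_env V'" using agree_offD[OF 2(1)] V by (simp add: static_env_def)
    moreover have "nn * (120 * int D + 220) = nn * (120 * int D + 200) + 20 * nn"
      by (simp add: algebra_simps)
    ultimately show ?case unfolding Q_def using 2 nn1 by simp
  qed
  moreover have "n * n = nn" by (simp add: nn_def)
  ultimately show ?thesis unfolding Q_def[symmetric] setup_layout_def
    using V k0(1)[symmetric]
    by (intro wp_Seq wp_assign) (simp_all add: add.commute[of "2 * n" nn])
qed

text \<open>The permutations exist only once the sorting program has run: they are read off its
  final memory. Hence \<open>layout\<close> is entered first, and the context of the reduction is
  assumed for every \<sigma> that sorts the columns. \<open>D\<close> bounds the height of the tree,
  \<open>L\<close> the number of doublings.\<close>

lemma eq_solves_instance:
  fixes N :: nat and A :: "int mat"
  defines "n \<equiv> int N"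
  assumes A: "A \<in> carrier_mat N N" and vs: "length vs = N" "\<forall>v \<in> set vs. v \<in> carrier_vec N"
    and S: "S = int k0 * (n * n)" "S < 2 ^ b" and D: "n \<le> 2 ^ D" and L: "\<And>e. 2 ^ e \<le> G \<Longrightarrow> e \<le> L"
    and lay: "layout n S b"
    and red: "\<And>\<sigma>. (\<And>k. 0 \<le> k \<Longrightarrow> k < n \<Longrightarrow> bij_betw (\<sigma> k) {0..<n} {0..<n}) \<Longrightarrow>
      (\<And>k r r'. 0 \<le> k \<Longrightarrow> k < n \<Longrightarrow> 0 \<le> r \<Longrightarrow> r \<le> r' \<Longrightarrow> r' < n \<Longrightarrow>
        A $$ (nat (\<sigma> k r), nat k) \<le> A $$ (nat (\<sigma> k r'), nat k)) \<Longrightarrow>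
      reduction n S b (\<lambda>i k. A $$ (nat i, nat k)) K b0 \<sigma> p q TB G"
  shows "\<exists>t0 s t. exec b (eq_pre k0 K p) (init_state N A) t0 s \<and>
    serves b (eq_query K p q) N (equality_answer A) s vs t \<and>
    int (t0 + t) \<le> (n * n) * (120 * int D + 230) + 1250 * (G * (n * n)) +
      220 * ((int L + 1) * (int TB + n * n))"
proof -
  define M where "M = (\<lambda>i k. A $$ (nat i, nat k))"
  interpret layout n S b M by (rule lay)
  define R where "R = fst (init_state N A)"
  define h where "h = snd (init_state N A)"
  define m where "m = (\<lambda>x. h (nat x))"
  have init: "init_state N A = (R, h)" by (simp add: R_def h_def)
  have rep: "represents R h R m" unfolding represents_def m_def by simp
  have RN: "R vN = n" by (simp add: R_def init_state_def n_def)
  have Npos: "0 < N" using n_pos n_def by simp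
  have hm: "has_matrix m" unfolding has_matrix_def
  proof (intro allI impI)
    fix i k assume ik: "0 \<le> i \<and> i < n \<and> 0 \<le> k \<and> k < n"
    have x: "nat (i * n + k) = nat i * N + nat k"
      using ik n_def by (simp add: nat_add_distrib nat_mult_distrib)
    have kn: "nat k < N" "nat i < N" using ik n_def by linarith+
    have "nat i * N + nat k < (nat i + 1) * N" using kn by simp
    also have "\<dots> \<le> N * N" using kn by (intro mult_right_mono) simp_all
    finally have "nat (i * n + k) < N * N" using x by simp
    moreover have "nat (i * n + k) div N = nat i" "nat (i * n + k) mod N = nat k"
      using x kn by simp_all
    ultimately show "m (i * n + k) = M i k" by (simp add: m_def h_def init_state_def M_def)
  qed
  have z: "m x = 0" if "nn \<le> x" for x
  proof -
    have "int (N * N) \<le> x" using that nn_def by (simp add: n_def)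
    then have "\<not> nat x < N * N" by linarith
    then show ?thesis by (simp add: m_def h_def init_state_def)
  qed
  have Sk: "S = int k0 * nn" using S by (simp add: nn_def)
  obtain u1 R1 h1 V1 m1 where 1: "exec b (Seq (setup_layout k0) sort_columns) (R, h) u1 (R1, h1)"
    "represents R1 h1 V1 m1" "static_env V1" "agree_off {pb..<tb + 2 * n} m m1"
    "\<And>k. 0 \<le> k \<Longrightarrow> k < n \<Longrightarrow> sorted_col m1 k" "int u1 \<le> nn * (120 * int D + 220)"
    using wp_setup_sort[where t = 0 and V = R and m = m, OF RN Sk S(2) D hm z] rep
    unfolding wp_def add_0 by blast
  define \<sigma> where "\<sigma> = (\<lambda>k r. m1 (pb + k * n + r))"
  have p1: "bij_betw (\<sigma> k) {0..<n} {0..<n}" if "0 \<le> k" "k < n" for k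
    using 1(5)[OF that] unfolding sorted_col_def \<sigma>_def by blast
  have p2: "M (\<sigma> k r) k \<le> M (\<sigma> k r') k" if "0 \<le> k" "k < n" "0 \<le> r" "r \<le> r'" "r' < n" for k r r'
    using 1(5)[OF that(1,2)] that(3-) unfolding sorted_col_def \<sigma>_def by blast
  interpret reduction n S b M K b0 \<sigma> p q TB G
    using red[OF p1 p2[unfolded M_def]] unfolding M_def by blast
  have "has_matrix m1"
    by (rule has_matrix_cong[OF hm]) (use agree_offD[OF 1(4)] n_pos in auto)
  moreover have "m1 (pb + k * n + r) = \<sigma> k r" for k r by (simp add: \<sigma>_def)
  then have "has_perm m1" unfolding has_perm_def by blast
  ultimately have st: "static_mem m1" unfolding static_mem_def by blast
  have fr: "fresh_from 0 m1" unfolding fresh_from_def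
  proof (intro allI impI)
    fix l v :: int assume l: "0 \<le> l \<and> l < S \<and> 0 \<le> v"
    then have "S \<le> cell S l v" using cell_ge S_pos by simp
    moreover have "tb + 2 * n \<le> S" using own_less_S[of S] by (meson leI less_irrefl)
    moreover from this have "nn \<le> S" using n_le_sq n_pos by linarith
    ultimately show "m1 (cell S l v) = 0" using agree_offD[OF 1(4), of "cell S l v"] z by simp
  qed
  have nN: "nat n = N" by (simp add: n_def)
  define T0 where "T0 = nn * (120 * int D + 230)"
  have T0: "int u1 + 1 \<le> T0"
    using 1(6) n_le_sq n_pos unfolding T0_def by (simp add: algebra_simps)
  obtain u2 R2 h2 V2 m2 where 2: "exec b (Seq (assign vG (EConst 1)) (build K p)) (R1, h1) u2 (R2, h2)"
    "represents R2 h2 V2 m2" "query_inv T0 N 0 (int u1 + int u2) V2 m2"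
    using wp_first_build[OF 1(3) st fr T0] 1(2) unfolding wp_def nN by blast
  have AM: "M (int i) (int k) = A $$ (i, k)" for i k by (simp add: M_def)
  have "\<exists>u V' m'. serves b (eq_query K p q) (nat n) (equality_answer A) (R2, h2) vs u \<and>
    query_inv T0 0 (0 + int (length vs)) (int u1 + int u2 + int u) V' m'"
    by (rule serves_eq_query[OF _ 2(2) order_refl]) (use 2(3) vs A AM n_def in simp_all)
  then obtain u V' m' where 3: "serves b (eq_query K p q) N (equality_answer A) (R2, h2) vs u"
    "query_inv T0 0 n (int u1 + int u2 + int u) V' m'"
    using vs n_def by auto
  have ex: "exec b (eq_pre k0 K p) (init_state N A) (u1 + u2) (R2, h2)"
    unfolding eq_pre_def init by (rule exec.Seq[OF 1(1) 2(1)])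
  have "int u1 + int u2 + int u \<le>
      T0 + 1100 * (G * nn) + 220 * ((int L + 1) * X) + 150 * (n * (n * G))"
    by (rule query_inv_time[OF 3(2) _ L]) (use n_pos in simp_all)
  moreover have "n * (n * G) = G * nn" by (simp add: nn_def)
  ultimately have "int (u1 + u2 + u) \<le> nn * (120 * int D + 230) + 1250 * (G * nn) +
      220 * ((int L + 1) * X)" unfolding T0_def by simp
  then show ?thesis using ex 3(1) unfolding X_def nn_def by blast
qed

section \<open>Boolean-OMv needs quadratic time\<close>

text \<open>The vector \<open>a\<close> is what the answer cells show before the next query; each
  answer must differ from its predecessor in all n cells.\<close>

fun flips :: "nat \<Rightarrow> (int vec \<Rightarrow> int vec) \<Rightarrow> int vec \<Rightarrow> int vec list \<Rightarrow> bool" where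
  "flips n ans a [] \<longleftrightarrow> True"
| "flips n ans a (v # vs) \<longleftrightarrow> (\<forall>i < n. ans v $ i \<noteq> a $ i) \<and> flips n ans (ans v) vs"

text \<open>Placing a query leaves the answer cells alone, so the program itself has to change all n
  of them, at one cell per step.\<close>

lemma flips_time:
  "serves b q n ans s vs t \<Longrightarrow> flips n ans (read_answer n s) vs \<Longrightarrow> n * length vs \<le> t"
proof (induction rule: serves.induct)
  case (Cons v s t s' vs t')
  let ?D = "{a. snd s' a \<noteq> snd (put_query n v s) a}"
  have "(\<lambda>i. n * n + n + i) ` {..<n} \<subseteq> ?D"
  proof
    fix a assume "a \<in> (\<lambda>i. n * n + n + i) ` {..<n}"
    then obtain i where i: "i < n" "a = n * n + n + i" by auto
    then have "snd s' a = ans v $ i" using Cons.hyps(2) by (metis read_answer_def index_vec)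
    moreover have "snd (put_query n v s) a = read_answer n s $ i"
      using i by (simp add: put_query_def read_answer_def)
    ultimately show "a \<in> ?D" using Cons.prems i by simp
  qed
  moreover have "card ((\<lambda>i. n * n + n + i) ` {..<n}) = n" by (simp add: card_image inj_on_def)
  ultimately have "n \<le> t"
    using exec_changes_few_cells[OF Cons.hyps(1)]
      card_mono[of ?D "(\<lambda>i. n * n + n + i) ` {..<n}"] by linarith
  moreover have "n * length vs \<le> t'" using Cons.IH Cons.prems Cons.hyps(2) by simp
  ultimately show ?case by simp
qed simp

fun alternating :: "nat \<Rightarrow> nat \<Rightarrow> bool \<Rightarrow> int vec list" where
  "alternating n 0 x = []"
| "alternating n (Suc k) x = vec n (\<lambda>_. of_bool x) # alternating n k (\<not> x)"

text \<open>The identity matrix echoes the query, so alternating all-ones and zero queries flip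
  every bit of the answer.\<close>

lemma boolean_answer_identity:
  "boolean_answer (1\<^sub>m n) (vec n (\<lambda>_. of_bool x)) = vec n (\<lambda>_. of_bool x)"
proof (rule eq_vecI)
  fix i assume "i < dim_vec (vec n (\<lambda>_. of_bool x :: int))"
  then have i: "i < n" by simp
  have "(\<exists>k < n. (1\<^sub>m n :: int mat) $$ (i, k) = 1 \<and> vec n (\<lambda>_. of_bool x) $ k = (1::int)) \<longleftrightarrow> x"
    using i by (auto intro!: exI[of _ i])
  then show "boolean_answer (1\<^sub>m n) (vec n (\<lambda>_. of_bool x)) $ i = vec n (\<lambda>_. of_bool x) $ i"
    using i by (simp add: boolean_answer_def)
qed (simp add: boolean_answer_def)

lemma flips_alternating:
  "flips n (boolean_answer (1\<^sub>m n)) (vec n (\<lambda>_. of_bool (\<not> x))) (alternating n k x)"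
proof (induction k arbitrary: x)
  case (Suc k)
  then show ?case using Suc[of "\<not> x"] by (simp add: boolean_answer_identity)
qed simp

lemma boolean_omv_lower_bound:
  assumes "solves_online {0, 1} boolean_answer p q c T" "1 \<le> n"
  shows "n * (n - 1) \<le> T n"
proof -
  obtain w where w: "n < 2 ^ w" using less_exp by blast
  then have "1 < (2::nat) ^ w" using assms(2) by linarith
  then have "(1::int) < 2 ^ w" by (metis of_nat_1 of_nat_less_iff of_nat_numeral of_nat_power)
  moreover have "int n < 2 ^ w" using w by (metis of_nat_less_iff of_nat_numeral of_nat_power)
  ultimately have ww: "{0, 1} \<subseteq> words w" "int n \<in> words w" by (auto simp: in_words_nonneg)
  have el: "elements_mat (1\<^sub>m n :: int mat) \<subseteq> {0, 1}" by (auto simp: elements_mat_def)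
  have len: "length (alternating n k x) = k" for k x by (induction k arbitrary: x) auto
  have vs: "\<forall>v \<in> set (alternating n k x). v \<in> carrier_vec n \<and> vec_set v \<subseteq> {0, 1}" for k x
    by (induction k arbitrary: x) (auto simp: vec_set_def of_bool_def split: if_splits)
  have "elements_mat (1\<^sub>m n :: int mat) \<subseteq> {0, 1} \<inter> words w" using el ww by blast
  moreover have "\<forall>v \<in> set (alternating n n True). v \<in> carrier_vec n \<and> vec_set v \<subseteq> {0, 1} \<inter> words w"
    using vs[of n True] ww by blast
  ultimately obtain t0 s t where
    t: "serves (c * w) q n (boolean_answer (1\<^sub>m n)) s (alternating n n True) t" "t0 + t \<le> T n"
    using assms(1)[unfolded solves_online_def, rule_format, of n w "1\<^sub>m n" "alternating n n True"]
      assms(2) ww len by auto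
  obtain n' where n': "n = Suc n'" using assms(2) by (cases n) auto
  have "alternating n n True = vec n (\<lambda>_. of_bool True) # alternating n n' False"
    using alternating.simps(2)[of n n' True] n' by simp
  with t(1) have "serves (c * w) q n (boolean_answer (1\<^sub>m n)) s
      (vec n (\<lambda>_. of_bool True) # alternating n n' False) t" by simp
  then obtain u s' u' where u: "read_answer n s' = boolean_answer (1\<^sub>m n) (vec n (\<lambda>_. of_bool True))"
    "serves (c * w) q n (boolean_answer (1\<^sub>m n)) s' (alternating n n' False) u'" "t = u + u'"
    by cases blast
  \<comment> \<open>Counting starts with the second query: before the first one, preprocessing may
    already have written its answer.\<close>
  have "n * length (alternating n n' False) \<le> u'"
    using flips_time[OF u(2)] flips_alternating[of n False n'] u(1) boolean_answer_identity[of n True]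
    by simp
  then show ?thesis using t(2) u(3) len n' by simp
qed

section \<open>Constants and asymptotics\<close>

text \<open>The finitely many n below the threshold are covered by adding all their quotients to the
  constant. A bound without exceptions is needed because the constants of the program have to work
  for every n.\<close>

lemma bigo_uniform_bound:
  fixes f g :: "nat \<Rightarrow> real"
  assumes "f \<in> O(g)" "\<And>n. 1 \<le> n \<Longrightarrow> 0 < g n" "\<And>n. 0 \<le> f n"
  shows "\<exists>C \<ge> 1. \<forall>n \<ge> 1. f n \<le> C * g n"
proof -
  obtain c where c: "c > 0" "eventually (\<lambda>n. norm (f n) \<le> c * norm (g n)) at_top"
    using assms(1) by (elim landau_o.bigE)
  then obtain n0 where n0: "\<And>n. n0 \<le> n \<Longrightarrow> norm (f n) \<le> c * norm (g n)"
    unfolding eventually_at_top_linorder by blast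
  define C where "C = 1 + c + (\<Sum>i \<in> {1..<n0}. f i / g i)"
  have s0: "0 \<le> (\<Sum>i \<in> {1..<n0}. f i / g i)"
    using assms(2,3) by (intro sum_nonneg divide_nonneg_pos) auto
  have "f n \<le> C * g n" if "1 \<le> n" for n
  proof (cases "n0 \<le> n")
    case True
    then have "f n \<le> c * g n" using n0[of n] assms(2)[OF that] assms(3)[of n] by simp
    also have "\<dots> \<le> C * g n" using s0 c(1) assms(2)[OF that] by (intro mult_right_mono) (auto simp: C_def)
    finally show ?thesis .
  next
    case False
    have "f n / g n \<le> (\<Sum>i \<in> {1..<n0}. f i / g i)"
      using that False assms(2,3) by (intro member_le_sum) (auto intro!: divide_nonneg_pos)
    then have "f n / g n \<le> C" using c(1) by (simp add: C_def)
    then show ?thesis using assms(2)[OF that] by (simp add: pos_divide_le_eq)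
  qed
  moreover have "1 \<le> C" using s0 c(1) by (simp add: C_def)
  ultimately show ?thesis by blast
qed

lemma exponent_le_one:
  fixes \<epsilon> C :: real
  assumes "\<And>n. 1 \<le> n \<Longrightarrow> real (n * (n - 1)) \<le> C * real n powr (3 - \<epsilon>)" "1 \<le> C"
  shows "\<epsilon> \<le> 1"
proof (rule ccontr)
  assume "\<not> \<epsilon> \<le> 1"
  then have e: "0 < \<epsilon> - 1" by simp
  \<comment> \<open>Chosen such that n^(\<epsilon>-1) \<ge> 2 C + 1; the summand 2 ensures n - 1
    \<ge> n / 2.\<close>
  define n where "n = nat \<lceil>(2 * C + 1) powr (1 / (\<epsilon> - 1))\<rceil> + 2"
  have n: "(2 * C + 1) powr (1 / (\<epsilon> - 1)) \<le> real n" "2 \<le> n"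
    unfolding n_def by linarith+
  have "2 * C + 1 = ((2 * C + 1) powr (1 / (\<epsilon> - 1))) powr (\<epsilon> - 1)"
    using e assms(2) by (simp add: powr_powr)
  also have "\<dots> \<le> real n powr (\<epsilon> - 1)" using n e by (intro powr_mono2) auto
  finally have big: "2 * C + 1 \<le> real n powr (\<epsilon> - 1)" .
  have "real n * real n / 2 \<le> real (n * (n - 1))"
    using n(2) by (simp add: of_nat_diff field_simps)
  also have "\<dots> \<le> C * real n powr (3 - \<epsilon>)" using assms(1)[of n] n(2) by simp
  finally have "real n * real n \<le> 2 * C * real n powr (3 - \<epsilon>)" by simp
  moreover have "real n * real n = real n powr (\<epsilon> - 1) * real n powr (3 - \<epsilon>)"
    using n(2) by (simp add: powr_add[symmetric] powr_numeral power2_eq_square)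
  ultimately have "real n powr (\<epsilon> - 1) \<le> 2 * C" using n(2) by simp
  then show False using big by simp
qed

text \<open>With P = n^(1-\<epsilon>/2), the budget is at most C n P^2. For g \<le> n the hypothesis
  gives g^2 \<le> 2 C P^2; for g > n it gives g n \<le> 2 C P^2 \<le> 2 C P n. Both yield g \<le> 2
  C P.\<close>

lemma abandoned_bucket_size:
  fixes n g X \<epsilon> C :: real
  assumes "1 \<le> n" "1 \<le> g" "g * (g * (n * n)) \<le> (n + g) * X" "X \<le> C * n powr (3 - \<epsilon>)" "1 \<le> C" "0 < \<epsilon>"
  shows "g \<le> 2 * C * n powr (1 - \<epsilon> / 2)"
proof -
  define P where "P = n powr (1 - \<epsilon> / 2)"
  have P: "0 < P" "P \<le> n"
    using assms powr_mono[of "1 - \<epsilon> / 2" 1 n] by (simp_all add: P_def)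
  have "n powr (3 - \<epsilon>) = n powr (1 + (1 - \<epsilon> / 2) + (1 - \<epsilon> / 2))" by (simp add: algebra_simps)
  also have "\<dots> = n powr 1 * P * P" by (simp only: powr_add P_def)
  also have "\<dots> = n * (P * P)" using assms(1) by simp
  finally have X: "X \<le> C * (n * (P * P))" using assms(4) by simp
  have CP: "0 \<le> C * (n * (P * P))" using P assms by simp
  have "g \<le> 2 * C * P"
  proof (cases "g \<le> n")
    case True
    have "g * (g * (n * n)) \<le> (n + g) * (C * (n * (P * P)))"
      using assms(1-3) X by (meson add_nonneg_nonneg mult_left_mono order_trans zero_le_one)
    also have "\<dots> \<le> (2 * n) * (C * (n * (P * P)))" using True CP by (intro mult_right_mono) auto
    finally have "(g * g) * (n * n) \<le> (2 * C * (P * P)) * (n * n)" by (simp add: algebra_simps)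
    then have "g * g \<le> 2 * C * (P * P)" using assms(1) by (simp add: mult_le_cancel_right)
    also have "\<dots> \<le> (2 * C) * (2 * C) * (P * P)"
      using assms(5) P by (intro mult_right_mono) auto
    also have "\<dots> = (2 * C * P) * (2 * C * P)" by (simp add: algebra_simps)
    finally show ?thesis using assms(5) P
      by (intro power2_le_imp_le[of g]) (simp_all add: power2_eq_square)
  next
    case False
    have "g * (g * (n * n)) \<le> (n + g) * (C * (n * (P * P)))"
      using assms(1-3) X by (meson add_nonneg_nonneg mult_left_mono order_trans zero_le_one)
    also have "\<dots> \<le> (2 * g) * (C * (n * (P * P)))" using False CP by (intro mult_right_mono) auto
    finally have "(g * n) * (g * n) \<le> (2 * C * (P * P)) * (g * n)" by (simp add: algebra_simps)
    then have "g * n \<le> 2 * C * (P * P)" using assms(1,2) by (simp add: mult_le_cancel_right)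
    also have "\<dots> \<le> 2 * C * (P * n)" using P assms(5) by (intro mult_left_mono) auto
    finally have "g * n \<le> (2 * C * P) * n" by (simp add: algebra_simps)
    then show ?thesis using assms(1) by (simp add: mult_le_cancel_right)
  qed
  then show ?thesis by (simp add: P_def)
qed

text \<open>The crude estimate ln 2 \<ge> 1/2 is the source of the factor 2.\<close>

lemma log2_le_powr:
  fixes x a :: real
  assumes "1 \<le> x" "0 < a"
  shows "log 2 x \<le> 2 / a * x powr a"
proof -
  have "1 / 2 \<le> ln (2::real)" using exp_half_le2 by (subst ln_ge_iff) auto
  then have "log 2 x \<le> 2 * ln x"
    using assms(1) mult_right_mono[of "1/2" "ln 2" "ln x"] by (simp add: log_def field_simps)
  also have "\<dots> \<le> 2 * (x powr a / a)" using ln_powr_bound[OF assms] by simp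
  finally show ?thesis by simp
qed

text \<open>Since n < W = 2^w, every power of n fits into a fixed multiple of w bits. Constants are
  absorbed the same way: W \<ge> 2 gives Z < 2^Z \<le> W^Z, so Z more words of w bits cover any
  factor up to Z.\<close>

lemma word_size_bounds:
  fixes n W :: int and w c Z K k0 C :: nat
  assumes W: "W = 2 ^ w" and n: "1 \<le> n" "n < W" and k0: "1 \<le> k0"
    and Z: "(K + 3) * k0 + 6 * C + 6 \<le> Z"
  shows "n * n + 2 * n \<le> 2 ^ ((c + 4) * w)"
    and "(2 ^ ((c + 4) * w) + int K + 2) * (int k0 * (n * n)) \<le> 2 ^ ((c + 7 + Z) * w)"
    and "int k0 * (n * n) < 2 ^ ((c + 7 + Z) * w)"
    and "(6 * int C + 5) * (n * n * n) < 2 ^ ((c + 7 + Z) * w)"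
proof -
  have W2: "2 \<le> W" using n by simp
  have w1: "1 \<le> w" using W2 W by (cases w) auto
  have pw: "(2::int) ^ (a * w) = W ^ a" for a by (simp add: W power_mult mult.commute flip: power_mult)
  have nW: "n * n \<le> W * W" using n by (intro mult_mono) auto
  have n3: "n * n * n \<le> W * W * W" using n nW by (intro mult_mono) auto
  have ge1: "1 \<le> W ^ a" for a using W2 by simp
  have "n * n + 2 * n \<le> 4 * (W * W)"
    using nW n mult_mono[of 1 W n W] by (simp add: algebra_simps) 
  also have "\<dots> \<le> (W * W) * (W * W)" using W2 mult_mono[of 2 W 2 W] by (intro mult_right_mono) auto
  also have "\<dots> = W ^ 4" by (simp add: power4_eq_xxxx mult.assoc)
  also have "\<dots> \<le> W ^ (c + 4)" using W2 by (intro power_increasing) auto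
  finally show "n * n + 2 * n \<le> 2 ^ ((c + 4) * w)" by (simp add: pw)
  have "Z < 2 ^ Z" by (rule less_exp)
  then have "int Z < 2 ^ Z" by (metis of_nat_less_iff of_nat_numeral of_nat_power)
  also have "\<dots> \<le> W ^ Z" using W2 by (intro power_mono) auto
  finally have ZW: "int Z < W ^ Z" .
  have Zi: "(int K + 3) * int k0 + 6 * int C + 6 \<le> int Z"
  proof -
    have "int ((K + 3) * k0 + 6 * C + 6) \<le> int Z" using Z by (simp only: of_nat_le_iff)
    then show ?thesis by simp
  qed
  have kk: "0 \<le> (int K + 3) * int k0" by simp
  have S: "(2 ^ ((c + 4) * w) + int K + 2) * (int k0 * (n * n)) \<le> W ^ (c + 7 + Z)"
  proof -
    have "2 ^ ((c + 4) * w) + int K + 2 \<le> W ^ (c + 4) * (int K + 3)"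
    proof -
      have "1 * (int K + 2) \<le> W ^ (c + 4) * (int K + 2)"
        using ge1[of "c + 4"] by (intro mult_right_mono) simp_all
      moreover have "W ^ (c + 4) * (int K + 3) = W ^ (c + 4) + W ^ (c + 4) * (int K + 2)"
        by (simp add: algebra_simps)
      ultimately show ?thesis unfolding pw by (smt (verit))
    qed
    then have "(2 ^ ((c + 4) * w) + int K + 2) * (int k0 * (n * n)) \<le>
        (W ^ (c + 4) * (int K + 3)) * (int k0 * (W * W))"
      using nW W2 n by (intro mult_mono) auto
    also have "\<dots> = ((int K + 3) * int k0) * (W ^ (c + 4) * (W * W))" by (simp add: algebra_simps)
    also have "\<dots> \<le> W ^ Z * (W ^ (c + 4) * (W * W))"
      using ZW Zi W2 by (intro mult_right_mono) auto
    also have "\<dots> = W ^ (c + 6 + Z)" by (simp add: power_add power_numeral_reduce)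
    also have "\<dots> \<le> W ^ (c + 7 + Z)" using W2 by (intro power_increasing) auto
    finally show ?thesis .
  qed
  then show "(2 ^ ((c + 4) * w) + int K + 2) * (int k0 * (n * n)) \<le> 2 ^ ((c + 7 + Z) * w)"
    by (simp only: pw)
  have "1 \<le> n * n" using n mult_mono[of 1 n 1 n] by simp
  then have pos: "0 < int k0 * (n * n)" using k0 by simp
  have "1 * (int k0 * (n * n)) < (2 ^ ((c + 4) * w) + int K + 2) * (int k0 * (n * n))"
    using pos ge1[of "c + 4"] by (intro mult_strict_right_mono) (simp_all add: pw)
  then show "int k0 * (n * n) < 2 ^ ((c + 7 + Z) * w)" using S unfolding pw by linarith
  have "(6 * int C + 5) * (n * n * n) \<le> (6 * int C + 5) * (W * W * W)"
    using n3 by (intro mult_left_mono) auto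
  also have "\<dots> < W ^ Z * (W * W * W)"
    using ZW Zi kk W2 by (intro mult_strict_right_mono) (linarith, simp)
  also have "\<dots> = W ^ (3 + Z)" by (simp add: power_add power3_eq_cube)
  also have "\<dots> \<le> W ^ (c + 7 + Z)" using W2 by (intro power_increasing) auto
  finally show "(6 * int C + 5) * (n * n * n) < 2 ^ ((c + 7 + Z) * w)" by (simp only: pw)
qed

theorem theorem3p1:
  fixes \<epsilon> :: real
  assumes "\<epsilon> > 0"
    and "Boolean_OMv_in_time_O (\<lambda>n. real n powr (3 - \<epsilon>))"
  shows "Ex_Equality_OMv_in_time_O (\<lambda>n. real n powr (3 - \<epsilon> / 2))"
proof -
  obtain p q c T where sol: "solves_online {0, 1} boolean_answer p q c T"
    and TO: "(\<lambda>n. real (T n)) \<in> O(\<lambda>n. real n powr (3 - \<epsilon>))"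
    using assms(2) unfolding Boolean_OMv_in_time_O_def solvable_in_time_O_def by blast
  obtain C' where C': "1 \<le> C'" "\<And>n. 1 \<le> n \<Longrightarrow> real (T n) \<le> C' * real n powr (3 - \<epsilon>)"
    using bigo_uniform_bound[OF TO] by auto
  have "real (n * (n - 1)) \<le> C' * real n powr (3 - \<epsilon>)" if "1 \<le> n" for n
    using boolean_omv_lower_bound[OF sol that] C'(2)[OF that] by (meson of_nat_le_iff order_trans)
  \<comment> \<open>This makes n^2 part of the budget n^(3-\<epsilon>), and n^2 log n part of the
    final bound.\<close>
  then have eps: "\<epsilon> \<le> 1" using exponent_le_one C'(1) by blast
  \<comment> \<open>One more than a bound for C': the extra unit accounts for the n^2 in X.\<close>
  define C :: nat where "C = nat \<lceil>C'\<rceil> + 1"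
  have C1: "1 \<le> C" "C' + 1 \<le> real C" unfolding C_def by linarith+
  define X where "X = (\<lambda>n. int (T n) + int n * int n)"
  have X: "real_of_int (X n) \<le> real C * real n powr (3 - \<epsilon>)" if n: "1 \<le> n" for n
  proof -
    have "real n * real n = real n powr 2" using n by (simp add: powr_numeral power2_eq_square)
    also have "\<dots> \<le> real n powr (3 - \<epsilon>)" using n eps by (intro powr_mono) auto
    finally have "real_of_int (X n) \<le> (C' + 1) * real n powr (3 - \<epsilon>)"
      using C'(2)[OF n] by (simp add: X_def algebra_simps)
    also have "\<dots> \<le> real C * real n powr (3 - \<epsilon>)" using C1 by (intro mult_right_mono) auto
    finally show ?thesis .
  qed
  \<comment> \<open>Twice the bound 2 C n^(1-\<epsilon>/2) on an abandoned bucket size: the program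
    doubles once more after abandoning.\<close>
  define G where "G = (\<lambda>n::nat. \<lfloor>4 * real C * real n powr (1 - \<epsilon> / 2)\<rfloor>)"
  have Gle: "real_of_int (G n) \<le> 4 * real C * real n powr (1 - \<epsilon> / 2)" for n
    unfolding G_def by linarith
  have Gn: "1 \<le> G n" "G n \<le> 4 * int C * int n" if n: "1 \<le> n" for n
  proof -
    have "1 * 1 \<le> 4 * real C * real n powr (1 - \<epsilon> / 2)"
      using n eps C1 by (intro mult_mono ge_one_powr_ge_zero) auto
    then show "1 \<le> G n" unfolding G_def by linarith
    have "real n powr (1 - \<epsilon> / 2) \<le> real n powr 1" using n assms(1) by (intro powr_mono) auto
    then have "4 * real C * real n powr (1 - \<epsilon> / 2) \<le> 4 * real C * real n"
      using n by (intro mult_left_mono) auto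
    then have "real_of_int (G n) \<le> real_of_int (4 * int C * int n)" using Gle[of n] by simp
    then show "G n \<le> 4 * int C * int n" by (simp only: of_int_le_iff)
  qed
  have Xn: "X n \<le> int C * (int n * int n * int n)" if n: "1 \<le> n" for n
  proof -
    have "real n powr (3 - \<epsilon>) \<le> real n powr 3" using n assms(1) by (intro powr_mono) auto
    also have "\<dots> = real n * real n * real n" using n by (simp add: powr_numeral power3_eq_cube)
    finally have "real_of_int (X n) \<le> real C * (real n * real n * real n)"
      using X[OF n] C1 by (meson mult_left_mono of_nat_0_le_iff order_trans)
    then have "real_of_int (X n) \<le> real_of_int (int C * (int n * int n * int n))" by simp
    then show ?thesis by (simp only: of_int_le_iff)
  qed
  obtain K1 K2 where "regs_below K1 p" "regs_below K2 q" using ex_regs_below by blast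
  define K where "K = Suc (K1 + K2)"
  have regs: "regs_below K p" "regs_below K q"
    using \<open>regs_below K1 p\<close> \<open>regs_below K2 q\<close> by (auto simp: K_def elim: regs_below_mono)
  \<comment> \<open>With S = k0 n^2, the summand 4 C n^2 makes room for n G lanes, and 12 n^2
    exceeds both the remaining n lanes and the 10 n^2 of the layout.\<close>
  define k0 where "k0 = 4 * C + 12"
  define Z where "Z = (K + 3) * k0 + 6 * C + 6"
  define D where "D = (\<lambda>n::nat. nat \<lceil>log 2 (real n)\<rceil>)"
  \<comment> \<open>G n \<le> 4 C n, so 2^e \<le> G n forces e \<le> L n.\<close>
  define L where "L = (\<lambda>n::nat. nat \<lfloor>log 2 (4 * real C * real n)\<rfloor>)"
  define T' where "T' = (\<lambda>n. nat ((int n * int n) * (120 * int (D n) + 230) +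
    1250 * (G n * (int n * int n)) + 220 * ((int (L n) + 1) * X n)))"
  have "solves_online UNIV equality_answer (eq_pre k0 K p) (eq_query K p q) (c + 7 + Z) T'"
    unfolding solves_online_def
  proof (intro allI impI, elim conjE)
    fix N w :: nat and A :: "int mat" and vs :: "int vec list"
    assume N: "1 \<le> N" and wd: "int N \<in> words w" and A: "A \<in> carrier_mat N N" and len: "length vs = N"
      and vs: "\<forall>v \<in> set vs. v \<in> carrier_vec N \<and> vec_set v \<subseteq> UNIV \<inter> words w"
    define n where "n = int N"
    define W :: int where "W = 2 ^ w"
    define S where "S = int k0 * (n * n)"
    \<comment> \<open>The given algorithm runs with c w bits; its simulation allows at least 4 w, so
      that the input and output cells are addressable whatever c is.\<close>
    let ?inner = "(c + 4) * w" and ?b = "(c + 7 + Z) * w"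
    have n1: "1 \<le> n" "n < W" using N wd by (simp_all add: n_def W_def words_def)
    have k01: "1 \<le> k0" by (simp add: k0_def)
    have "(K + 3) * k0 + 6 * C + 6 \<le> Z" by (simp add: Z_def)
    note wb = word_size_bounds[where c = c, OF W_def n1 k01 this]
    have b01: "{0, 1} \<subseteq> words w" using n1 unfolding W_def by (auto simp: in_words_nonneg)
    have nn1: "1 \<le> n * n" using n1 mult_mono[of 1 n 1 n] by simp
    have lay: "layout n S ?b"
    proof
      have "10 * (n * n) \<le> int k0 * (n * n)" using nn1 by (intro mult_right_mono) (auto simp: k0_def)
      then show "10 * (n * n) \<le> S" by (simp add: S_def)
    qed (use n1 wb(3) in \<open>simp_all add: S_def\<close>)
    have Nn: "nat n = N" by (simp add: n_def)
    have red: "reduction n S ?b (\<lambda>i k. A $$ (nat i, nat k)) K ?inner \<sigma> p q (T N) (G N)"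
      if sig: "\<And>k. 0 \<le> k \<Longrightarrow> k < n \<Longrightarrow> bij_betw (\<sigma> k) {0..<n} {0..<n}"
        "\<And>k r r'. 0 \<le> k \<Longrightarrow> k < n \<Longrightarrow> 0 \<le> r \<Longrightarrow> r \<le> r' \<Longrightarrow> r' < n \<Longrightarrow>
          A $$ (nat (\<sigma> k r), nat k) \<le> A $$ (nat (\<sigma> k r'), nat k)" for \<sigma>
    proof -
      interpret layout n S ?b "\<lambda>i k. A $$ (nat i, nat k)" by (rule lay)
      show ?thesis
      proof
        show "0 < S" using nn1 k01 by (simp add: S_def)
        show "?inner \<le> ?b" by (intro mult_right_mono) simp_all
        show "(2 ^ ?inner + int K + 2) * S \<le> 2 ^ ?b" using wb(2) by (simp add: S_def)
        show "1 \<le> K" by (simp add: K_def)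
        show "nn + 2 * n \<le> 2 ^ ?inner" using wb(1) by (simp add: nn_def)
        show "regs_below K p" "regs_below K q" by (fact regs)+
        show "1 \<le> G N" by (rule Gn[OF N])
        have g1: "n * G N \<le> 4 * int C * (n * n)"
          using mult_left_mono[OF Gn(2)[OF N], of n] n1 by (simp add: n_def algebra_simps)
        have "n \<le> n * n" using n1 mult_right_mono[of 1 n n] by simp
        moreover have "S = 4 * int C * (n * n) + 12 * (n * n)" by (simp add: S_def k0_def algebra_simps)
        ultimately show "n * G N + n < S" using g1 nn1 by linarith
        have "G N * (n * n) \<le> 4 * int C * n * (n * n)"
          using Gn(2)[OF N] nn1 by (intro mult_right_mono) (simp_all add: n_def)
        then have g2: "G N * (n * n) \<le> 4 * int C * (n * n * n)" by (simp add: algebra_simps)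
        have x: "int (T N) + n * n \<le> int C * (n * n * n)" using Xn[OF N] by (simp add: X_def n_def)
        have n3: "n \<le> n * n * n" using n1 nn1 mult_right_mono[of 1 "n * n" n] by simp
        have "(6 * int C + 5) * (n * n * n) = 4 * int C * (n * n * n) + int C * (n * n * n) +
          int C * (n * n * n) + 5 * (n * n * n)" by (simp add: algebra_simps)
        moreover have "0 \<le> int C * (n * n * n)" using n1 by simp
        ultimately show "G N * (n * n) + int (T N) + n * n + n < 2 ^ ?b"
          using g2 x n3 n1 wb(4) by (smt (verit))
        show "2 * g \<le> G N" if g: "1 \<le> g" "g * (g * (n * n)) \<le> (n + g) * (int (T N) + n * n)" for g
        proof -
          have "real_of_int g \<le> 2 * real C * real N powr (1 - \<epsilon> / 2)"
          proof (rule abandoned_bucket_size[where X = "real_of_int (X N)"])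
            have "real_of_int (g * (g * (n * n))) \<le> real_of_int ((n + g) * (int (T N) + n * n))"
              using g(2) by (simp only: of_int_le_iff)
            then show "real_of_int g * (real_of_int g * (real N * real N)) \<le>
              (real N + real_of_int g) * real_of_int (X N)"
              by (simp add: n_def X_def)
          qed (use N g X[OF N] C1 assms(1) in simp_all)
          then have "real_of_int (2 * g) \<le> 4 * real C * real N powr (1 - \<epsilon> / 2)" by simp
          then show ?thesis unfolding G_def by (simp only: le_floor_iff)
        qed
        show "\<exists>t0 s t. exec ?inner p (init_state (nat n) B) t0 s \<and>
            serves ?inner q (nat n) (boolean_answer B) s us t \<and> t0 + t \<le> T N"
          if B: "B \<in> carrier_mat (nat n) (nat n)" "elements_mat B \<subseteq> {0, 1}"
            "length us = nat n" "\<forall>v \<in> set us. boolean_vec (nat n) v" for B us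
        proof -
          have "elements_mat B \<subseteq> {0, 1} \<inter> words w" using B b01 by blast
          moreover have "\<forall>v \<in> set us. v \<in> carrier_vec N \<and> vec_set v \<subseteq> {0, 1} \<inter> words w"
            using B(4) b01 unfolding boolean_vec_def Nn by blast
          ultimately obtain t0 s t where "exec (c * w) p (init_state N B) t0 s"
            "serves (c * w) q N (boolean_answer B) s us t" "t0 + t \<le> T N"
            using sol[unfolded solves_online_def, rule_format, of N w B us] N wd B(1,3) unfolding Nn by blast
          moreover have "c * w \<le> ?inner" by (intro mult_right_mono) simp_all
          ultimately show ?thesis unfolding Nn
            using exec_mono_word_length serves_mono_word_length by blast
        qed
      qed (use sig in auto)
    qed
    have D1: "n \<le> 2 ^ D N"
    proof -
      have "real N = 2 powr (log 2 (real N))" using N by simp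
      also have "\<dots> \<le> 2 powr real (D N)" unfolding D_def by (intro powr_mono) linarith+
      also have "\<dots> = real (2 ^ D N)" by (simp add: powr_realpow)
      finally have "N \<le> 2 ^ D N" by (simp only: of_nat_le_iff)
      then have "int N \<le> int (2 ^ D N)" by (simp only: of_nat_le_iff)
      then show ?thesis by (simp add: n_def)
    qed
    have L1: "e \<le> L N" if e: "2 ^ e \<le> G N" for e
    proof -
      have "real_of_int (2 ^ e) \<le> real_of_int (4 * int C * int N)"
        using e Gn(2)[OF N] by (simp only: of_int_le_iff)
      then have "2 powr real e \<le> 4 * real C * real N" by (simp add: powr_realpow)
      then have "real e \<le> log 2 (4 * real C * real N)"
        using C1 N by (subst le_log_iff) auto
      then show ?thesis unfolding L_def by linarith
    qed
    have "\<exists>t0 s t. exec ?b (eq_pre k0 K p) (init_state N A) t0 s \<and>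
      serves ?b (eq_query K p q) N (equality_answer A) s vs t \<and>
      int (t0 + t) \<le> (n * n) * (120 * int (D N) + 230) + 1250 * (G N * (n * n)) +
        220 * ((int (L N) + 1) * (int (T N) + n * n))"
      unfolding n_def
      by (rule eq_solves_instance[where S = S and ?b0.0 = ?inner])
        (use A len vs wb(3) D1 L1 lay red in \<open>simp_all add: n_def S_def\<close>)
    then show "\<exists>t0 s t. exec ?b (eq_pre k0 K p) (init_state N A) t0 s \<and>
      serves ?b (eq_query K p q) N (equality_answer A) s vs t \<and> t0 + t \<le> T' N"
      unfolding T'_def X_def n_def by (metis nat_int nat_mono)
  qed
  moreover have "(\<lambda>n. real (T' n)) \<in> O(\<lambda>n. real n powr (3 - \<epsilon> / 2))"
  proof -
    define l where "l = log 2 (4 * real C)"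
    define E where "E = 830 + 5000 * real C + 220 * ((l + 1 + 4 / \<epsilon>) * real C)"
    have l0: "0 \<le> l" unfolding l_def using C1 by simp
    have "real (T' n) \<le> E * real n powr (3 - \<epsilon> / 2)" if n: "1 \<le> n" for n
    proof -
      define x where "x = real n"
      have x: "1 \<le> x" using n by (simp add: x_def)
      \<comment> \<open>For sorting, bounding the logarithm by a square root is enough: n^(5/2)
        \<le> n^(3-\<epsilon>/2) because \<epsilon> \<le> 1.\<close>
      have "real (D n) \<le> log 2 x + 1" unfolding D_def x_def[symmetric] using x
        by (simp add: of_nat_nat)
      also have "\<dots> \<le> 4 * x powr (1 / 2) + x powr (1 / 2)"
        using log2_le_powr[OF x, of "1 / 2"] x by (intro add_mono ge_one_powr_ge_zero) auto
      finally have "120 * real (D n) + 230 \<le> 600 * x powr (1 / 2) + 230 * 1" by simp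
      also have "\<dots> \<le> 600 * x powr (1 / 2) + 230 * x powr (1 / 2)"
        using x by (intro add_left_mono mult_left_mono ge_one_powr_ge_zero) auto
      finally have "x * x * (120 * real (D n) + 230) \<le> x * x * (830 * x powr (1 / 2))"
        using x by (intro mult_left_mono) auto
      also have "\<dots> = 830 * (x powr 2 * x powr (1 / 2))" using x by (simp add: powr_numeral power2_eq_square)
      also have "\<dots> = 830 * x powr (2 + 1 / 2)" by (simp only: powr_add)
      also have "\<dots> \<le> 830 * x powr (3 - \<epsilon> / 2)" using x eps by (intro mult_left_mono powr_mono) auto
      finally have A1: "x * x * (120 * real (D n) + 230) \<le> 830 * x powr (3 - \<epsilon> / 2)" .
      have "real_of_int (G n) * (x * x) \<le> (4 * real C * x powr (1 - \<epsilon> / 2)) * (x * x)"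
        using Gle[of n] x by (intro mult_right_mono) (auto simp: x_def)
      also have "\<dots> = 4 * real C * (x powr (1 - \<epsilon> / 2) * x powr 2)"
        using x by (simp add: powr_numeral power2_eq_square)
      also have "x powr (1 - \<epsilon> / 2) * x powr 2 = x powr (3 - \<epsilon> / 2)"
        by (simp add: powr_add[symmetric])
      finally have A2: "real_of_int (G n) * (x * x) \<le> 4 * real C * x powr (3 - \<epsilon> / 2)" .
      have "log 2 (4 * real C * x) = l + log 2 x" using C1 x by (simp add: l_def log_mult)
      moreover have "0 \<le> log 2 x" using x by simp
      ultimately have "real (L n) \<le> l + log 2 x"
        using l0 unfolding L_def x_def[symmetric] by (simp add: of_nat_nat)
      \<comment> \<open>Here the logarithm is bounded by n^(\<epsilon>/2), precisely the gap between
        the exponents 3 - \<epsilon> and 3 - \<epsilon>/2.\<close>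
      then have "real (L n) + 1 \<le> (l + 1) * 1 + 4 / \<epsilon> * x powr (\<epsilon> / 2)"
        using log2_le_powr[OF x, of "\<epsilon> / 2"] assms(1) by simp
      also have "\<dots> \<le> (l + 1) * x powr (\<epsilon> / 2) + 4 / \<epsilon> * x powr (\<epsilon> / 2)"
        using x l0 assms(1) by (intro add_right_mono mult_left_mono ge_one_powr_ge_zero) auto
      also have "\<dots> = (l + 1 + 4 / \<epsilon>) * x powr (\<epsilon> / 2)" by (simp add: algebra_simps)
      finally have "(real (L n) + 1) * real_of_int (X n) \<le>
          ((l + 1 + 4 / \<epsilon>) * x powr (\<epsilon> / 2)) * (real C * x powr (3 - \<epsilon>))"
        using X[OF n] x l0 assms(1) by (intro mult_mono) (auto simp: x_def X_def)
      also have "\<dots> = (l + 1 + 4 / \<epsilon>) * real C * (x powr (\<epsilon> / 2) * x powr (3 - \<epsilon>))" by simp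
      also have "x powr (\<epsilon> / 2) * x powr (3 - \<epsilon>) = x powr (3 - \<epsilon> / 2)"
        by (simp add: powr_add[symmetric])
      finally have A3: "(real (L n) + 1) * real_of_int (X n) \<le>
          (l + 1 + 4 / \<epsilon>) * real C * x powr (3 - \<epsilon> / 2)" .
      have "0 \<le> (int n * int n) * (120 * int (D n) + 230) + 1250 * (G n * (int n * int n)) +
          220 * ((int (L n) + 1) * X n)"
        using Gn(1)[OF n] by (simp add: X_def)
      then have "real (T' n) = x * x * (120 * real (D n) + 230) + 1250 * (real_of_int (G n) * (x * x)) +
          220 * ((real (L n) + 1) * real_of_int (X n))"
        unfolding T'_def by (simp add: x_def)
      also have "\<dots> \<le> 830 * x powr (3 - \<epsilon> / 2) + 1250 * (4 * real C * x powr (3 - \<epsilon> / 2)) +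
          220 * ((l + 1 + 4 / \<epsilon>) * real C * x powr (3 - \<epsilon> / 2))"
        using A1 A2 A3 by linarith
      also have "\<dots> = E * x powr (3 - \<epsilon> / 2)" by (simp add: E_def algebra_simps)
      finally show ?thesis by (simp add: x_def)
    qed
    then have "eventually (\<lambda>n. norm (real (T' n)) \<le> E * norm (real n powr (3 - \<epsilon> / 2))) at_top"
      unfolding eventually_at_top_linorder by (intro exI[of _ 1]) simp
    then show ?thesis by (rule bigoI)
  qed
  ultimately show ?thesis unfolding Ex_Equality_OMv_in_time_O_def solvable_in_time_O_def by blast
qed

end
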